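(* Let $(M,g)$ be a compact connected Riemannian manifold and let $G$ be a compact Lie group acting transitively on $(M,g)$ by isometries, with Lie algebra $\mathfrak{g}=\mathfrak{c}\oplus\mathfrak{g}_1\oplus\cdots\oplus\mathfrak{g}_k$, where $\mathfrak{c}$ is the center and the $\mathfrak{g}_i$ are the simple ideals of $\mathfrak{g}$; elements of $\mathfrak{g}$ are identified with Killing vector fields on $(M,g)$. Let $1\le l\le k$ and let $Z=Z_0+Z_1+\cdots+Z_l\in\mathfrak{g}$, where $Z_0\in\mathfrak{c}$, $Z_i\in\mathfrak{g}_i$ and $Z_i\neq 0$ for $1\le i\le l$. (A) Suppose that $Z$ is a Killing vector field of constant length on $(M,g)$. Then: 1) for all $i\ne j$, $1\le i,j\le l$, we have $g(\mathfrak{g}_i,\mathfrak{g}_j)=0$ at every point of $M$ (in particular, $g(Z_i,\mathfrak{g}_j)=0$ and $g(Z_i,Z_j)=0$); 2) every Killing field $Z_0+Z_i$, $1\le i\le l$, has constant length on $(M,g)$. (B) Conversely, if for every $i$, $1\le i\le l$, the Killing field $Z_0+Z_i$ has constant length on $(M,g)$, and for all $i\ne j$, $1\le i,j\le l$, the equality $g(\mathfrak{g}_i,\mathfrak{g}_j)=0$ holds on $M$, then the Killing field $Z=Z_0+Z_1+\cdots+Z_l$ has constant length on $(M,g)$.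
   Context: The group $G$ is a group of isometries of $(M,g)$ (so the action is effective). Each $U\in\mathfrak{g}$ is identified with the Killing vector field $\widetilde U(x)=\frac{d}{dt}\exp(tU)(x)\big|_{t=0}$ on $M$; the map $U\mapsto\widetilde U$ is linear and injective, and $[\widetilde U,\widetilde V]=-\widetilde{[U,V]}$. For $U,V\in\mathfrak{g}$, $g(U,V)$ denotes the function $x\mapsto g_x(\widetilde U(x),\widetilde V(x))$ on $M$; for subsets $A,B\subset\mathfrak{g}$, "$g(A,B)=0$" means $g(U,V)=0$ at every point of $M$ for all $U\in A$, $V\in B$. $U\in\mathfrak g$ has constant length if $g(U,U)$ is constant on $M$. *)

theory Defs
  imports
    "HOL-Analysis.Analysis"
    "HOL-Algebra.Group_Action"
    "HOL-Library.Function_Algebras"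
begin

section \<open>Functions into a real vector space form a real vector space\<close>

instantiation "fun" :: (type, real_vector) real_vector
begin

definition "r *\<^sub>R f = (\<lambda>x. r *\<^sub>R f x)"

instance
  by standard (simp_all add: scaleR_fun_def fun_eq_iff algebra_simps)

end


section \<open>Smooth manifolds\<close>

primrec times_differentiable_on ::
  "nat \<Rightarrow> ('a::real_normed_vector \<Rightarrow> 'b::real_normed_vector) \<Rightarrow> 'a set \<Rightarrow> bool"
where
  "times_differentiable_on 0 f S \<longleftrightarrow> continuous_on S f"
| "times_differentiable_on (Suc n) f S \<longleftrightarrow>
     (\<forall>x\<in>S. f differentiable (at x)) \<and>
     (\<forall>v. times_differentiable_on n (\<lambda>x. frechet_derivative f (at x) v) S)"

text \<open>Only meant for open \<open>S\<close>.\<close>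

definition smooth_on ::
  "('a::real_normed_vector \<Rightarrow> 'b::real_normed_vector) \<Rightarrow> 'a set \<Rightarrow> bool" where
  "smooth_on f S \<longleftrightarrow> (\<forall>n. times_differentiable_on n f S)"

text \<open>
  A chart is a pair of its domain and a coordinate function; the values of the coordinate function
  outside the domain are irrelevant.
\<close>

type_synonym ('m, 'e) chart = "'m set \<times> ('m \<Rightarrow> 'e)"

definition is_chart :: "('m::topological_space, 'e::topological_space) chart \<Rightarrow> bool" where
  "is_chart c \<longleftrightarrow> open (fst c) \<and> open (snd c ` fst c) \<and>
     (\<exists>h. homeomorphism (fst c) (snd c ` fst c) (snd c) h)"

definition chart_inv :: "('m, 'e) chart \<Rightarrow> 'e \<Rightarrow> 'm" where
  "chart_inv c = inv_into (fst c) (snd c)"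

definition charts_at :: "('m, 'e) chart set \<Rightarrow> 'm \<Rightarrow> ('m, 'e) chart set" where
  "charts_at A x = {c \<in> A. x \<in> fst c}"

locale smooth_manifold =
  fixes A :: "('m::{t2_space, second_countable_topology}, 'e::euclidean_space) chart set"
  assumes is_chart: "c \<in> A \<Longrightarrow> is_chart c"
    and covering: "charts_at A x \<noteq> {}"
    and compatible: "c \<in> A \<Longrightarrow> d \<in> A \<Longrightarrow>
      smooth_on (snd d \<circ> chart_inv c) (snd c ` (fst c \<inter> fst d))"

definition smooth_map ::
  "('m::topological_space, 'e::euclidean_space) chart set \<Rightarrow>
   ('n::topological_space, 'f::euclidean_space) chart set \<Rightarrow> ('m \<Rightarrow> 'n) \<Rightarrow> bool" where
  "smooth_map A B F \<longleftrightarrow> continuous_on UNIV F \<and>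
     (\<forall>c\<in>A. \<forall>d\<in>B. smooth_on (snd d \<circ> F \<circ> chart_inv c) (snd c ` (fst c \<inter> F -` fst d)))"

definition prod_atlas ::
  "('m, 'e) chart set \<Rightarrow> ('n, 'f) chart set \<Rightarrow> ('m \<times> 'n, 'e \<times> 'f) chart set" where
  "prod_atlas A B = {(fst c \<times> fst d, map_prod (snd c) (snd d)) | c d. c \<in> A \<and> d \<in> B}"


section \<open>Tangent vectors and vector fields\<close>

text \<open>
  A tangent vector is given by its components in all charts of the atlas around the base point;
  these are related by the derivatives of the coordinate changes. At the remaining arguments it is
  set to zero, so that equality and the vector space operations are those of the function space.
\<close>

type_synonym ('m, 'e) tangent = "('m, 'e) chart \<Rightarrow> 'e"

type_synonym ('m, 'e) vfield = "'m \<Rightarrow> ('m, 'e) tangent"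

definition tangent_space ::
  "('m, 'e::euclidean_space) chart set \<Rightarrow> 'm \<Rightarrow> ('m, 'e) tangent set" where
  "tangent_space A x = {v.
     (\<forall>c\<in>charts_at A x. \<forall>d\<in>charts_at A x.
        v d = frechet_derivative (snd d \<circ> chart_inv c) (at (snd c x)) (v c)) \<and>
     (\<forall>c. c \<notin> charts_at A x \<longrightarrow> v c = 0)}"

text \<open>The choice of the chart \<open>c\<close> is irrelevant on tangent vectors.\<close>

definition tangent_map ::
  "('m, 'e::euclidean_space) chart set \<Rightarrow> ('n, 'f::euclidean_space) chart set \<Rightarrow>
   ('m \<Rightarrow> 'n) \<Rightarrow> 'm \<Rightarrow> ('m, 'e) tangent \<Rightarrow> ('n, 'f) tangent" where
  "tangent_map A B F x v = (\<lambda>d. if d \<in> charts_at B (F x)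
     then let c = (SOME c. c \<in> charts_at A x)
          in frechet_derivative (snd d \<circ> F \<circ> chart_inv c) (at (snd c x)) (v c)
     else 0)"

definition has_velocity ::
  "('m::topological_space, 'e::euclidean_space) chart set \<Rightarrow>
   (real \<Rightarrow> 'm) \<Rightarrow> real \<Rightarrow> ('m, 'e) tangent \<Rightarrow> bool" where
  "has_velocity A \<gamma> t v \<longleftrightarrow> isCont \<gamma> t \<and> v \<in> tangent_space A (\<gamma> t) \<and>
     (\<forall>c\<in>charts_at A (\<gamma> t). ((snd c \<circ> \<gamma>) has_vector_derivative v c) (at t))"

definition smooth_vfield ::
  "('m, 'e::euclidean_space) chart set \<Rightarrow> ('m, 'e) vfield \<Rightarrow> bool" where
  "smooth_vfield A X \<longleftrightarrow> (\<forall>x. X x \<in> tangent_space A x) \<and>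
     (\<forall>c\<in>A. smooth_on (\<lambda>y. X (chart_inv c y) c) (snd c ` fst c))"

text \<open>In a chart, \<open>[X, Y]\<close> is \<open>DY(X) - DX(Y)\<close>, so that \<open>[X, Y] f = X (Y f) - Y (X f)\<close>.\<close>

definition vfield_bracket ::
  "('m, 'e::euclidean_space) chart set \<Rightarrow> ('m, 'e) vfield \<Rightarrow> ('m, 'e) vfield \<Rightarrow> ('m, 'e) vfield"
where
  "vfield_bracket A X Y = (\<lambda>x c. if c \<in> charts_at A x
     then frechet_derivative (\<lambda>y. Y (chart_inv c y) c) (at (snd c x)) (X x c)
        - frechet_derivative (\<lambda>y. X (chart_inv c y) c) (at (snd c x)) (Y x c)
     else 0)"


section \<open>Riemannian manifolds\<close>

type_synonym ('m, 'e) metric = "'m \<Rightarrow> ('m, 'e) tangent \<Rightarrow> ('m, 'e) tangent \<Rightarrow> real"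

locale riemannian_manifold = smooth_manifold A
  for A :: "('m::{t2_space, second_countable_topology}, 'e::euclidean_space) chart set" +
  fixes g :: "('m, 'e) metric"
  assumes metric_add: "\<lbrakk>u \<in> tangent_space A x; v \<in> tangent_space A x; w \<in> tangent_space A x\<rbrakk>
      \<Longrightarrow> g x (u + v) w = g x u w + g x v w"
    and metric_scale: "\<lbrakk>u \<in> tangent_space A x; w \<in> tangent_space A x\<rbrakk>
      \<Longrightarrow> g x (r *\<^sub>R u) w = r * g x u w"
    and metric_sym: "\<lbrakk>u \<in> tangent_space A x; v \<in> tangent_space A x\<rbrakk> \<Longrightarrow> g x u v = g x v u"
    and metric_pos: "\<lbrakk>u \<in> tangent_space A x; u \<noteq> 0\<rbrakk> \<Longrightarrow> g x u u > 0"
    and metric_smooth: "\<lbrakk>smooth_vfield A X; smooth_vfield A Y\<rbrakk>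
      \<Longrightarrow> smooth_map A {(UNIV, \<lambda>r::real. r)} (\<lambda>x. g x (X x) (Y x))"

definition riemannian_isometry ::
  "('m::topological_space, 'e::euclidean_space) chart set \<Rightarrow> ('m, 'e) metric \<Rightarrow> ('m \<Rightarrow> 'm) \<Rightarrow> bool"
where
  "riemannian_isometry A g F \<longleftrightarrow>
     bij F \<and> smooth_map A A F \<and> smooth_map A A (inv_into UNIV F) \<and>
     (\<forall>x. \<forall>u\<in>tangent_space A x. \<forall>v\<in>tangent_space A x.
        g (F x) (tangent_map A A F x u) (tangent_map A A F x v) = g x u v)"


section \<open>Lie algebras inside a real vector space\<close>

definition lie_ideal ::
  "('v::real_vector \<Rightarrow> 'v \<Rightarrow> 'v) \<Rightarrow> 'v set \<Rightarrow> 'v set \<Rightarrow> bool" where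
  "lie_ideal br L I \<longleftrightarrow> subspace I \<and> I \<subseteq> L \<and> (\<forall>X\<in>L. \<forall>Y\<in>I. br X Y \<in> I)"

definition lie_center :: "('v::real_vector \<Rightarrow> 'v \<Rightarrow> 'v) \<Rightarrow> 'v set \<Rightarrow> 'v set" where
  "lie_center br L = {X \<in> L. \<forall>Y\<in>L. br X Y = 0}"

definition simple_lie_algebra :: "('v::real_vector \<Rightarrow> 'v \<Rightarrow> 'v) \<Rightarrow> 'v set \<Rightarrow> bool" where
  "simple_lie_algebra br L \<longleftrightarrow> (\<exists>X\<in>L. \<exists>Y\<in>L. br X Y \<noteq> 0) \<and>
     (\<forall>I. lie_ideal br L I \<longrightarrow> I = {0} \<or> I = L)"

definition simple_ideals :: "('v::real_vector \<Rightarrow> 'v \<Rightarrow> 'v) \<Rightarrow> 'v set \<Rightarrow> 'v set set" where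
  "simple_ideals br L = {I. lie_ideal br L I \<and> simple_lie_algebra br I}"

definition internal_direct_sum :: "'v::real_vector set \<Rightarrow> 'i set \<Rightarrow> ('i \<Rightarrow> 'v set) \<Rightarrow> bool" where
  "internal_direct_sum L I V \<longleftrightarrow> (\<forall>i\<in>I. subspace (V i) \<and> V i \<subseteq> L) \<and>
     (\<forall>X\<in>L. \<exists>!Y. Y \<in> (\<Pi>\<^sub>E i\<in>I. V i) \<and> X = (\<Sum>i\<in>I. Y i))"


section \<open>Lie groups\<close>

locale lie_group = group G + smooth_manifold A
  for G :: "'g::{t2_space, second_countable_topology} monoid" (structure)
    and A :: "('g, 'd::euclidean_space) chart set" +
  assumes carrier_UNIV: "carrier G = UNIV"
    and smooth_mult: "smooth_map (prod_atlas A A) A (\<lambda>(a, b). a \<otimes> b)"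
    and smooth_inverse: "smooth_map A A (m_inv G)"

text \<open>The Lie algebra consists of the left-invariant vector fields, with \<^const>\<open>vfield_bracket\<close>.\<close>

definition lie_algebra :: "('g, 'b) monoid_scheme \<Rightarrow> ('g, 'd::euclidean_space) chart set \<Rightarrow>
   ('g, 'd) vfield set" where
  "lie_algebra G A = {X. smooth_vfield A X \<and>
     (\<forall>a b. tangent_map A A (\<lambda>b. a \<otimes>\<^bsub>G\<^esub> b) b (X b) = X (a \<otimes>\<^bsub>G\<^esub> b))}"

text \<open>\<open>exp X\<close> is the value at time 1 of the integral curve of \<open>X\<close> starting at the identity.\<close>

definition lie_exp :: "('g::topological_space, 'b) monoid_scheme \<Rightarrow>
   ('g, 'd::euclidean_space) chart set \<Rightarrow> ('g, 'd) vfield \<Rightarrow> 'g" where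
  "lie_exp G A X =
     (THE \<gamma>. \<gamma> 0 = \<one>\<^bsub>G\<^esub> \<and> (\<forall>t. has_velocity A \<gamma> t (X (\<gamma> t)))) 1"


section \<open>Transitive effective isometric actions\<close>

locale homogeneous_riemannian_manifold =
  lie_group G AG + riemannian_manifold AM g +
  transitive_action G "UNIV :: 'm set" act + faithful_action G "UNIV :: 'm set" act
  for G :: "'g::{t2_space, second_countable_topology} monoid" (structure)
    and AG :: "('g, 'd::euclidean_space) chart set"
    and AM :: "('m::{t2_space, second_countable_topology}, 'e::euclidean_space) chart set"
    and g :: "('m, 'e) metric"
    and act :: "'g \<Rightarrow> 'm \<Rightarrow> 'm" +
  assumes smooth_action: "smooth_map (prod_atlas AG AM) AM (\<lambda>(a, x). act a x)"
    and isometric_action: "riemannian_isometry AM g (act a)"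

text \<open>The vector field on \<open>M\<close> with value \<open>d/dt exp(tU)(x)\<close> at \<open>t = 0\<close>.\<close>

definition killing_field ::
  "('g::topological_space, 'b) monoid_scheme \<Rightarrow> ('g, 'd::euclidean_space) chart set \<Rightarrow>
   ('m::topological_space, 'e::euclidean_space) chart set \<Rightarrow> ('g \<Rightarrow> 'm \<Rightarrow> 'm) \<Rightarrow>
   ('g, 'd) vfield \<Rightarrow> ('m, 'e) vfield" where
  "killing_field G AG AM act U =
     (\<lambda>x. THE v. has_velocity AM (\<lambda>t. act (lie_exp G AG (t *\<^sub>R U)) x) 0 v)"

definition killing_inner ::
  "('g::topological_space, 'b) monoid_scheme \<Rightarrow> ('g, 'd::euclidean_space) chart set \<Rightarrow>
   ('m::topological_space, 'e::euclidean_space) chart set \<Rightarrow> ('m, 'e) metric \<Rightarrow>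
   ('g \<Rightarrow> 'm \<Rightarrow> 'm) \<Rightarrow> ('g, 'd) vfield \<Rightarrow> ('g, 'd) vfield \<Rightarrow> 'm \<Rightarrow> real" where
  "killing_inner G AG AM g act U V =
     (\<lambda>x. g x (killing_field G AG AM act U x) (killing_field G AG AM act V x))"

definition killing_orthogonal ::
  "('g::topological_space, 'b) monoid_scheme \<Rightarrow> ('g, 'd::euclidean_space) chart set \<Rightarrow>
   ('m::topological_space, 'e::euclidean_space) chart set \<Rightarrow> ('m, 'e) metric \<Rightarrow>
   ('g \<Rightarrow> 'm \<Rightarrow> 'm) \<Rightarrow> ('g, 'd) vfield set \<Rightarrow> ('g, 'd) vfield set \<Rightarrow> bool" where
  "killing_orthogonal G AG AM g act P Q \<longleftrightarrow>
     (\<forall>U\<in>P. \<forall>V\<in>Q. \<forall>x. killing_inner G AG AM g act U V x = 0)"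

definition constant_length ::
  "('g::topological_space, 'b) monoid_scheme \<Rightarrow> ('g, 'd::euclidean_space) chart set \<Rightarrow>
   ('m::topological_space, 'e::euclidean_space) chart set \<Rightarrow> ('m, 'e) metric \<Rightarrow>
   ('g \<Rightarrow> 'm \<Rightarrow> 'm) \<Rightarrow> ('g, 'd) vfield \<Rightarrow> bool" where
  "constant_length G AG AM g act U \<longleftrightarrow> killing_inner G AG AM g act U U constant_on UNIV"

end

(*
  For x in M put f_x(U, V) = g(U, V)(x). Isometries carry orbits to orbits, so
  f_{ax}(U, V) = f_x(Ad(a^-1) U, Ad(a^-1) V); differentiating along a curve through the identity with
  velocity Y gives  Y f(U, V) = - f([Y, U], V) - f(U, [Y, V]).  Hence U has constant length iff
  f([Y, U], U) = 0 for all Y: the converse direction makes f(U, U) locally constant along G, hence its level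
  sets in M are continuous images of clopen subsets of the compact group G.

  If Z has constant length, then f([Y, Z], Z) = 0; differentiating this for Y in g_i along W in g_j, i different from j,
  gives f([Y, Z_i], [W, Z_j]) = 0. The elements of g_i that are orthogonal to all [W, Z_j] form an ideal of g_i,
  which contains the nonzero set [g_i, Z_i] and therefore is g_i; the same argument in g_j yields
  f(g_i, g_j) = 0. The statements about Z_0 + Z_i now follow from [Y, Z] = [Y, Z_i] for Y in g_i.
*)
theory Submission
  imports Defs
begin

section \<open>Iterated differentiability and mixed second derivatives\<close>

text \<open>The derivative formula is where the analysis lies. A left-invariant field is determined
  by its value at the identity, so the forms live on one tangent space, read in one chart
  \<open>c\<close>. There the bracket is the antisymmetrized mixed second derivative
  \<open>mu2\<close> of the multiplication. Left and right translation differ only in which factor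
  is differentiated first, so symmetry of second derivatives makes the same \<open>mu2\<close>
  describe both, and the derivative of Ad(a^-1) at the identity becomes minus the bracket.

  \<open>lie_exp\<close> and \<open>killing_field\<close> are definite descriptions. They get a
  meaning only once integral curves are known to exist for all times and velocities to be unique;
  this is the purpose of the part on differential equations.

  That the left-invariant fields are closed under the bracket is read off from the given
  decomposition into center and ideals. With closure and the derivative formula at hand, the rest
  about ideals is pure algebra of a family of forms indexed by the points of M.\<close>

lemma times_differentiable_on_Suc_imp: "times_differentiable_on (Suc n) f S \<Longrightarrow> times_differentiable_on n f S"
proof (induction n arbitrary: f)
  case 0
  then show ?case
    by (auto intro!: differentiable_imp_continuous_on differentiable_at_imp_differentiable_on)
next
  case (Suc n)
  then have "times_differentiable_on (Suc n) (\<lambda>x. frechet_derivative f (at x) v) S" for v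
    by simp
  then have "times_differentiable_on n (\<lambda>x. frechet_derivative f (at x) v) S" for v
    using Suc.IH by blast
  moreover have "\<forall>x\<in>S. f differentiable at x"
    using Suc.prems by simp
  ultimately show ?case by simp
qed

lemma times_differentiable_on_subset: "times_differentiable_on n f S \<Longrightarrow> T \<subseteq> S \<Longrightarrow> times_differentiable_on n f T"
  by (induction n arbitrary: f) (auto intro: continuous_on_subset)

text \<open>\<open>frechet_derivative\<close> chooses from the set of all derivatives at the point;
  the two sets coincide, so the choices do as well, differentiable or not.\<close>

lemma frechet_derivative_cong:
  assumes "open S" "x \<in> S" "\<And>y. y \<in> S \<Longrightarrow> f y = g y"
  shows "frechet_derivative f (at x) = frechet_derivative g (at x)"
proof -
  have "(f has_derivative D) (at x) \<longleftrightarrow> (g has_derivative D) (at x)" for D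
    using has_derivative_transform_within_open[OF _ assms(1,2), where f=f and g=g]
      has_derivative_transform_within_open[OF _ assms(1,2), where f=g and g=f] assms(3) by metis
  then show ?thesis by (simp add: frechet_derivative_def)
qed

lemma times_differentiable_on_cong:
  assumes "open S" "\<And>x. x \<in> S \<Longrightarrow> f x = g x" "times_differentiable_on n f S"
  shows "times_differentiable_on n g S"
  using assms(2,3)
proof (induction n arbitrary: f g)
  case 0
  then show ?case using continuous_on_cong[of S S f g] by simp
next
  case (Suc n)
  have eq: "frechet_derivative f (at x) v = frechet_derivative g (at x) v" if "x \<in> S" for x v
    using frechet_derivative_cong[OF assms(1) that] Suc.prems(1) by metis
  have "times_differentiable_on n (\<lambda>x. frechet_derivative g (at x) v) S" for v
    using Suc.IH[of "\<lambda>x. frechet_derivative f (at x) v" "\<lambda>x. frechet_derivative g (at x) v"]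
      eq Suc.prems(2) by simp
  moreover have "g differentiable at x" if "x \<in> S" for x
  proof -
    have "(f has_derivative frechet_derivative f (at x)) (at x)"
      using Suc.prems(2) that by (simp add: frechet_derivative_works[symmetric])
    then have "(g has_derivative frechet_derivative f (at x)) (at x)"
      by (rule has_derivative_transform_within_open[OF _ assms(1) that]) (simp add: Suc.prems(1))
    then show ?thesis by (auto simp: differentiable_def)
  qed
  ultimately show ?case by simp
qed

lemma times_differentiable_on_add:
  assumes "open S" "times_differentiable_on n f S" "times_differentiable_on n g S"
  shows "times_differentiable_on n (\<lambda>x. f x + g x) S"
  using assms(2,3)
proof (induction n arbitrary: f g)
  case 0
  then show ?case by (simp add: continuous_on_add)
next
  case (Suc n)
  have eq: "frechet_derivative (\<lambda>x. f x + g x) (at x) v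
      = frechet_derivative f (at x) v + frechet_derivative g (at x) v" if "x \<in> S" for x v
  proof -
    have "((\<lambda>x. f x + g x) has_derivative
        (\<lambda>v. frechet_derivative f (at x) v + frechet_derivative g (at x) v)) (at x)"
      using Suc.prems that by (intro has_derivative_add) (auto simp: frechet_derivative_works[symmetric])
    from frechet_derivative_at[OF this] show ?thesis by (simp add: fun_eq_iff)
  qed
  have "times_differentiable_on n (\<lambda>x. frechet_derivative (\<lambda>x. f x + g x) (at x) v) S" for v
    by (rule times_differentiable_on_cong[OF assms(1) eq[symmetric] Suc.IH]) (use Suc.prems in auto)
  then show ?case using Suc.prems by auto
qed

lemma times_differentiable_on_scaleR:
  assumes "open S" "times_differentiable_on n f S"
  shows "times_differentiable_on n (\<lambda>x. r *\<^sub>R f x) S"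
  using assms(2)
proof (induction n arbitrary: f)
  case 0
  then show ?case by (simp add: continuous_on_scaleR)
next
  case (Suc n)
  have d: "((\<lambda>x. r *\<^sub>R f x) has_derivative (\<lambda>v. r *\<^sub>R frechet_derivative f (at x) v)) (at x)"
    if "x \<in> S" for x
    using Suc.prems that
    by (intro has_derivative_scaleR_right) (auto simp: frechet_derivative_works)
  have "times_differentiable_on n (\<lambda>x. frechet_derivative (\<lambda>x. r *\<^sub>R f x) (at x) v) S" for v
    by (rule times_differentiable_on_cong[OF assms(1) _ Suc.IH[of "\<lambda>x. frechet_derivative f (at x) v"]])
      (use Suc.prems frechet_derivative_at[OF d] in \<open>auto simp: fun_eq_iff\<close>)
  then show ?case using d by (auto simp: differentiable_def)
qed

lemma times_differentiable_on_zero: "times_differentiable_on n (\<lambda>x. 0) S"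
  by (induction n) auto

text \<open>The derivative of the slice along \<open>v\<close> is the slice of the derivative along
  \<open>(v, 0)\<close>, so the induction hypothesis applies to it. In coordinates, left-invariant
  fields are such slices of a derivative of the multiplication.\<close>

lemma times_differentiable_on_slice:
  assumes "open S" "times_differentiable_on n f S"
  shows "times_differentiable_on n (\<lambda>y. f (y, e)) {y. (y, e) \<in> S}"
  using assms(2)
proof (induction n arbitrary: f)
  case 0
  then show ?case by (auto intro!: continuous_on_compose2[of S f] continuous_intros)
next
  case (Suc n)
  have op: "open {y. (y, e) \<in> S}"
    using open_vimage[OF assms(1), of "\<lambda>y. (y, e)"] by (simp add: vimage_def continuous_on_Pair)
  have d: "((\<lambda>y. f (y, e)) has_derivative (\<lambda>v. frechet_derivative f (at (y, e)) (v, 0))) (at y)"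
    if "(y, e) \<in> S" for y
  proof -
    have "(f has_derivative frechet_derivative f (at (y, e))) (at (y, e))"
      using Suc.prems that by (simp add: frechet_derivative_works[symmetric])
    then show ?thesis
      by (rule has_derivative_compose[of "\<lambda>y. (y, e)" "\<lambda>v. (v, 0)", rotated])
        (auto intro!: derivative_eq_intros)
  qed
  have "times_differentiable_on n (\<lambda>y. frechet_derivative (\<lambda>y. f (y, e)) (at y) v) {y. (y, e) \<in> S}" for v
    by (rule times_differentiable_on_cong[OF op _ Suc.IH[of "\<lambda>p. frechet_derivative f (at p) (v, 0)"]])
      (use Suc.prems frechet_derivative_at[OF d] in \<open>auto simp: fun_eq_iff\<close>)
  then show ?case using d by (auto simp: differentiable_def)
qed

lemma vector_derivative_bound:
  fixes f :: "real \<Rightarrow> 'a::real_normed_vector"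
  assumes "convex S" "\<And>t. t \<in> S \<Longrightarrow> (f has_vector_derivative f' t) (at t within S)"
    "\<And>t. t \<in> S \<Longrightarrow> norm (f' t) \<le> B" "a \<in> S" "b \<in> S"
  shows "norm (f a - f b) \<le> B * \<bar>a - b\<bar>"
proof -
  have "onorm (\<lambda>h. h *\<^sub>R f' t) \<le> B" if "t \<in> S" for t
    using assms(3)[OF that] by (intro onorm_le) (simp add: mult_right_mono mult.commute[of "\<bar>_\<bar>"])
  then show ?thesis
    using differentiable_bound[OF assms(1), of f "\<lambda>t h. h *\<^sub>R f' t" B a b] assms
    by (simp add: has_vector_derivative_def)
qed

text \<open>One-sided half of the symmetry of second derivatives: only the derivative along
  \<open>v\<close> has to be differentiable, and only at the point \<open>x\<close>. The mean value
  inequality is applied in the direction \<open>v\<close> alone.\<close>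

lemma second_difference:
  fixes f :: "'a::real_normed_vector \<Rightarrow> 'b::real_normed_vector"
  assumes S: "open S" "x \<in> S" "\<And>y. y \<in> S \<Longrightarrow> f differentiable (at y)"
    and g: "((\<lambda>y. frechet_derivative f (at y) v) has_derivative g') (at x)" and e: "e > 0"
  shows "\<exists>\<delta>>0. \<forall>t. 0 < t \<and> t < \<delta> \<longrightarrow>
    norm (f (x + t *\<^sub>R v + t *\<^sub>R w) - f (x + t *\<^sub>R v) - f (x + t *\<^sub>R w) + f x - (t * t) *\<^sub>R g' w)
      \<le> e * (t * t)"
proof -
  \<comment> \<open>\<open>C * t\<close> bounds every displacement
    \<open>s *\<^sub>R v + q *\<^sub>R w\<close> with \<open>s\<close> and \<open>q\<close> between
    0 and \<open>t\<close>; the summand 1 keeps \<open>C\<close> positive.\<close>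
  define C where "C = norm v + norm w + 1"
  have C: "C > 0" by (simp add: C_def add_nonneg_pos)
  let ?g = "\<lambda>y. frechet_derivative f (at y) v"
  interpret g': bounded_linear g' using g by (rule has_derivative_bounded_linear)
  have "e / (2 * C) > 0" using C e by simp
  then obtain d where d: "d > 0" "\<And>y. norm (y - x) < d \<Longrightarrow>
      norm (?g y - ?g x - g' (y - x)) \<le> e / (2 * C) * norm (y - x)"
    using g unfolding has_derivative_at_alt by metis
  obtain r where r: "r > 0" "ball x r \<subseteq> S" using S open_contains_ball by metis
  define \<delta> where "\<delta> = min d r / C"
  have \<delta>: "\<delta> > 0" using C d r by (simp add: \<delta>_def)
  have main: "norm (f (x + t *\<^sub>R v + t *\<^sub>R w) - f (x + t *\<^sub>R v) - f (x + t *\<^sub>R w) + f x - (t * t) *\<^sub>R g' w)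
      \<le> e * (t * t)" if t: "0 < t" "t < \<delta>" for t
  proof -
    have tC: "C * t < d" "C * t < r" using t C
      by (auto simp: \<delta>_def field_simps)
    have small: "norm (s *\<^sub>R v + q *\<^sub>R w) \<le> C * t" if "0 \<le> s" "s \<le> t" "0 \<le> q" "q \<le> t" for s q
    proof -
      have "norm (s *\<^sub>R v + q *\<^sub>R w) \<le> s * norm v + q * norm w"
        using norm_triangle_ineq[of "s *\<^sub>R v" "q *\<^sub>R w"] that by simp
      also have "\<dots> \<le> t * norm v + t * norm w" using that by (intro add_mono mult_right_mono) auto
      also have "\<dots> \<le> C * t" using t by (simp add: C_def algebra_simps)
      finally show ?thesis .
    qed
    \<comment> \<open>Difference of \<open>f\<close> along two opposite sides of the parallelogram,
      with the expected linear growth in \<open>s\<close> removed. The quantity to be estimated is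
      \<open>\<phi> t - \<phi> 0\<close>.\<close>
    define \<phi> where "\<phi> s = f (x + s *\<^sub>R v + t *\<^sub>R w) - f (x + s *\<^sub>R v) - (s * t) *\<^sub>R g' w" for s
    define \<phi>' where "\<phi>' s = ?g (x + s *\<^sub>R v + t *\<^sub>R w) - ?g (x + s *\<^sub>R v) - t *\<^sub>R g' w" for s
    have inS: "x + s *\<^sub>R v + q *\<^sub>R w \<in> S" if "0 \<le> s" "s \<le> t" "0 \<le> q" "q \<le> t" for s q
    proof -
      have "dist x (x + (s *\<^sub>R v + q *\<^sub>R w)) = norm (s *\<^sub>R v + q *\<^sub>R w)"
        unfolding dist_norm by (subst norm_minus_commute) simp
      then have "x + (s *\<^sub>R v + q *\<^sub>R w) \<in> ball x r"
        using small[OF that] tC by simp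
      then show ?thesis using r by (auto simp: add.assoc)
    qed
    have fd: "((\<lambda>s. f (x + s *\<^sub>R v + q *\<^sub>R w)) has_vector_derivative ?g (x + s *\<^sub>R v + q *\<^sub>R w)) (at s)"
      if "0 \<le> s" "s \<le> t" "0 \<le> q" "q \<le> t" for s q
    proof -
      have f: "(f has_derivative frechet_derivative f (at (x + s *\<^sub>R v + q *\<^sub>R w))) (at (x + s *\<^sub>R v + q *\<^sub>R w))"
        using S(3)[OF inS[OF that]] by (simp add: frechet_derivative_works)
      have "((\<lambda>s. f (x + s *\<^sub>R v + q *\<^sub>R w)) has_derivative
          (\<lambda>h. frechet_derivative f (at (x + s *\<^sub>R v + q *\<^sub>R w)) (h *\<^sub>R v))) (at s)"
        by (rule has_derivative_compose[where f="\<lambda>s. x + s *\<^sub>R v + q *\<^sub>R w", OF _ f]) (auto intro!: derivative_eq_intros)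
      then show ?thesis
        unfolding has_vector_derivative_def
        by (simp add: linear_scale[OF bounded_linear.linear[OF has_derivative_bounded_linear[OF f]]])
    qed
    have \<phi>d: "(\<phi> has_vector_derivative \<phi>' s) (at s within {0..t})" if "s \<in> {0..t}" for s
    proof -
      have "((\<lambda>s. (s * t) *\<^sub>R g' w) has_vector_derivative t *\<^sub>R g' w) (at s)"
        unfolding has_vector_derivative_def
        by (rule derivative_eq_intros refl)+ simp
      moreover have "((\<lambda>s. f (x + s *\<^sub>R v)) has_vector_derivative ?g (x + s *\<^sub>R v)) (at s)"
        using fd[of s 0] that t by simp
      ultimately show ?thesis
        unfolding \<phi>_def[abs_def] \<phi>'_def using fd[of s t] that t
        by (auto intro: has_vector_derivative_at_within[OF has_vector_derivative_diff[OF has_vector_derivative_diff]])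
    qed
    have \<phi>b: "norm (\<phi>' s) \<le> e * t" if "s \<in> {0..t}" for s
    proof -
      have b: "norm (?g (x + s *\<^sub>R v + q *\<^sub>R w) - ?g x - g' (s *\<^sub>R v + q *\<^sub>R w)) \<le> e * t / 2"
        if "0 \<le> q" "q \<le> t" for q
      proof -
        have sm: "norm (s *\<^sub>R v + q *\<^sub>R w) \<le> C * t"
          using small[of s q] \<open>s \<in> {0..t}\<close> that by simp
        have "norm (?g (x + s *\<^sub>R v + q *\<^sub>R w) - ?g x - g' (s *\<^sub>R v + q *\<^sub>R w))
          \<le> e / (2 * C) * norm (s *\<^sub>R v + q *\<^sub>R w)"
          using d(2)[of "x + s *\<^sub>R v + q *\<^sub>R w"] sm tC by (simp add: add.assoc)
        also have "\<dots> \<le> e / (2 * C) * (C * t)" using sm C e by (intro mult_left_mono) auto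
        finally show ?thesis using C by simp
      qed
      \<comment> \<open>Both values of the derivative are expanded at \<open>x\<close>; each
        remainder contributes at most \<open>e * t / 2\<close>.\<close>
      have "\<phi>' s = (?g (x + s *\<^sub>R v + t *\<^sub>R w) - ?g x - g' (s *\<^sub>R v + t *\<^sub>R w))
          - (?g (x + s *\<^sub>R v + 0 *\<^sub>R w) - ?g x - g' (s *\<^sub>R v + 0 *\<^sub>R w))"
        by (simp add: \<phi>'_def g'.add g'.scaleR)
      then have "norm (\<phi>' s) \<le> e * t / 2 + e * t / 2"
        using norm_triangle_le_diff[OF add_mono[OF b[of t] b[of 0]]] t by simp
      then show ?thesis by simp
    qed
    have "norm (\<phi> t - \<phi> 0) \<le> e * t * \<bar>t - 0\<bar>"
      by (rule vector_derivative_bound[OF _ \<phi>d \<phi>b]) (use t in auto)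
    then show ?thesis using t by (simp add: \<phi>_def algebra_simps)
  qed
  show ?thesis using \<delta> main by blast
qed

text \<open>The second difference of \<open>f\<close> over a parallelogram does not change when
  \<open>v\<close> and \<open>w\<close> are exchanged, and divided by \<open>t * t\<close> it tends
  to either iterated derivative.\<close>

lemma frechet_derivative_symmetric:
  fixes f :: "'a::real_normed_vector \<Rightarrow> 'b::real_normed_vector"
  assumes S: "open S" "x \<in> S" and f: "times_differentiable_on 2 f S"
  shows "frechet_derivative (\<lambda>y. frechet_derivative f (at y) v) (at x) w
    = frechet_derivative (\<lambda>y. frechet_derivative f (at y) w) (at x) v"
    (is "?a = ?b")
proof -
  have f': "f differentiable (at y)" if "y \<in> S" for y
    using f that by (simp add: numeral_2_eq_2)
  have f'': "((\<lambda>y. frechet_derivative f (at y) v) has_derivative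
      frechet_derivative (\<lambda>y. frechet_derivative f (at y) v) (at x)) (at x)" for v
    using f S by (simp add: numeral_2_eq_2 frechet_derivative_works[symmetric])
  have "norm (?a - ?b) \<le> e" if e: "e > 0" for e
  proof -
    have e2: "e / 2 > 0" using e by simp
    obtain d1 where d1: "d1 > 0" "\<And>t. 0 < t \<and> t < d1 \<Longrightarrow>
      norm (f (x + t *\<^sub>R v + t *\<^sub>R w) - f (x + t *\<^sub>R v) - f (x + t *\<^sub>R w) + f x - (t * t) *\<^sub>R ?a)
      \<le> e / 2 * (t * t)"
      using second_difference[OF S f' f'' e2] by metis
    obtain d2 where d2: "d2 > 0" "\<And>t. 0 < t \<and> t < d2 \<Longrightarrow>
      norm (f (x + t *\<^sub>R w + t *\<^sub>R v) - f (x + t *\<^sub>R w) - f (x + t *\<^sub>R v) + f x - (t * t) *\<^sub>R ?b)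
      \<le> e / 2 * (t * t)"
      using second_difference[OF S f' f'' e2] by metis
    define t where "t = min d1 d2 / 2"
    have t: "0 < t" "t < d1" "t < d2" using d1 d2 by (auto simp: t_def)
    let ?D = "f (x + t *\<^sub>R v + t *\<^sub>R w) - f (x + t *\<^sub>R v) - f (x + t *\<^sub>R w) + f x"
    have 1: "norm (?D - (t * t) *\<^sub>R ?a) \<le> e / 2 * (t * t)" using d1(2) t by simp
    have "?D = f (x + t *\<^sub>R w + t *\<^sub>R v) - f (x + t *\<^sub>R w) - f (x + t *\<^sub>R v) + f x"
      by (simp add: algebra_simps)
    then have 2: "norm (?D - (t * t) *\<^sub>R ?b) \<le> e / 2 * (t * t)" using d2(2)[of t] t by (simp only: conj_absorb)
    have "norm ((t * t) *\<^sub>R (?a - ?b)) = norm ((?D - (t * t) *\<^sub>R ?b) - (?D - (t * t) *\<^sub>R ?a))"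
      by (simp add: algebra_simps)
    also have "\<dots> \<le> e / 2 * (t * t) + e / 2 * (t * t)"
      using norm_triangle_le_diff[OF add_mono[OF 2 1]] .
    finally have "t * t * norm (?a - ?b) \<le> t * t * e" by (simp only: norm_scaleR) (simp add: mult.commute)
    then show ?thesis using t by simp
  qed
  then have "norm (?a - ?b) \<le> 0" by (rule field_le_epsilon[of _ 0, simplified])
  then show ?thesis by simp
qed

section \<open>Ordinary differential equations\<close>

text \<open>Continuity is known only for each directional derivative separately. Compactness bounds
  it for every basis vector, and the sum of these bounds dominates the operator norm.\<close>

lemma times_differentiable_on_lipschitz:
  fixes X :: "'a::euclidean_space \<Rightarrow> 'b::real_normed_vector"
  assumes S: "open S" "x \<in> S" and X: "times_differentiable_on 1 X S"
  obtains r L where "r > 0" "L \<ge> 0" "cball x r \<subseteq> S"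
    "\<And>a b. a \<in> cball x r \<Longrightarrow> b \<in> cball x r \<Longrightarrow> norm (X a - X b) \<le> L * norm (a - b)"
proof -
  obtain r where r: "r > 0" "cball x r \<subseteq> S" using S open_contains_cball by metis
  have "\<exists>B. \<forall>y\<in>cball x r. norm (frechet_derivative X (at y) i) \<le> B" for i
  proof -
    have "continuous_on (cball x r) (\<lambda>y. frechet_derivative X (at y) i)"
      using X r by (auto intro: continuous_on_subset)
    then have "bounded ((\<lambda>y. frechet_derivative X (at y) i) ` cball x r)"
      by (intro compact_imp_bounded compact_continuous_image) auto
    then show ?thesis by (auto simp: bounded_iff)
  qed
  then obtain B where B: "\<And>i y. y \<in> cball x r \<Longrightarrow> norm (frechet_derivative X (at y) i) \<le> B i"
    by metis
  define L where "L = (\<Sum>i\<in>Basis. B i)"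
  have d: "(X has_derivative frechet_derivative X (at y)) (at y)" if "y \<in> cball x r" for y
    using X that r by (auto simp: frechet_derivative_works[symmetric])
  have on: "onorm (frechet_derivative X (at y)) \<le> L" if y: "y \<in> cball x r" for y
  proof (rule onorm_le)
    fix v :: 'a
    interpret bounded_linear "frechet_derivative X (at y)"
      using d[OF y] by (rule has_derivative_bounded_linear)
    have "frechet_derivative X (at y) v = frechet_derivative X (at y) (\<Sum>i\<in>Basis. (v \<bullet> i) *\<^sub>R i)"
      by (simp add: euclidean_representation)
    also have "\<dots> = (\<Sum>i\<in>Basis. (v \<bullet> i) *\<^sub>R frechet_derivative X (at y) i)"
      by (simp add: sum scaleR)
    finally have "norm (frechet_derivative X (at y) v) \<le> (\<Sum>i\<in>Basis. \<bar>v \<bullet> i\<bar> * norm (frechet_derivative X (at y) i))"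
      by (metis (mono_tags, lifting) norm_sum norm_scaleR sum.cong)
    also have "\<dots> \<le> (\<Sum>i\<in>Basis. norm v * B i)"
      by (intro sum_mono mult_mono B y) (auto simp: Basis_le_norm)
    finally show "norm (frechet_derivative X (at y) v) \<le> L * norm v"
      by (simp add: L_def sum_distrib_left mult.commute)
  qed
  have "L \<ge> 0"
    unfolding L_def using order_trans[OF norm_ge_zero B[of x]] r by (intro sum_nonneg) simp
  moreover have "norm (X a - X b) \<le> L * norm (a - b)" if "a \<in> cball x r" "b \<in> cball x r" for a b
    by (rule differentiable_bound[OF convex_cball _ on that])
      (use d in \<open>auto intro: has_derivative_at_withinI\<close>)
  ultimately show ?thesis using r that by blast
qed

text \<open>Picard iteration, as a contraction of the complete space of bounded continuous functions
  on the whole real line.\<close>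

lemma lipschitz_ode_solution:
  fixes X :: "'a::euclidean_space \<Rightarrow> 'a"
  assumes L: "L \<ge> 0" "\<And>a b. norm (X a - X b) \<le> L * norm (a - b)" and bnd: "\<And>a. norm (X a) \<le> M"
  obtains \<delta> y where "\<delta> > 0" "y 0 = y0"
    "\<And>t. t \<in> {-\<delta><..<\<delta>} \<Longrightarrow> (y has_vector_derivative X (y t)) (at t)"
proof -
  \<comment> \<open>Small enough that \<open>L * \<delta>\<close> is at most 1/2, the contraction
    factor; \<open>L + 1\<close> avoids division by zero.\<close>
  define \<delta> where "\<delta> = 1 / (2 * (L + 1))"
  have \<delta>: "\<delta> > 0" "L * \<delta> \<le> 1 / 2" using L by (auto simp: \<delta>_def field_simps)
  \<comment> \<open>Time is clamped to the interval, so that the iterates are defined and bounded on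
    the whole line.\<close>
  define c where "c t = max (-\<delta>) (min \<delta> t)" for t
  have c: "c t \<in> {-\<delta>..\<delta>}" for t using \<delta> by (auto simp: c_def)
  have Xc: "continuous_on UNIV X"
    using L by (intro lipschitz_on_continuous_on[of L] lipschitz_onI) (auto simp: dist_norm)
  define F where "F f u = integral {-\<delta>..u} (\<lambda>s. X (apply_bcontfun f s))" for f u
  have Fd: "(F f has_vector_derivative X (apply_bcontfun f u)) (at u within {-\<delta>..\<delta>})"
    if "u \<in> {-\<delta>..\<delta>}" for f u
    unfolding F_def
    by (rule integral_has_vector_derivative[OF _ that]) (auto intro!: continuous_on_compose2[OF Xc])
  \<comment> \<open>The integral runs from the left end of the interval; subtracting its value at
    time 0 moves the initial condition there and avoids integrals with reversed bounds.\<close>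
  define T where "T f t = y0 + F f (c t) - F f (c 0)" for f t
  have Tb: "T f \<in> bcontfun" for f
  proof (rule bcontfun_normI)
    have "continuous_on {-\<delta>..\<delta>} (F f)"
      using Fd has_vector_derivative_continuous continuous_on_eq_continuous_within by blast
    moreover have "continuous_on UNIV c" unfolding c_def by (intro continuous_intros)
    ultimately have "continuous_on UNIV (\<lambda>t. F f (c t))"
      using c by (intro continuous_on_compose2[of "{-\<delta>..\<delta>}" "F f" UNIV c]) auto
    then show "continuous_on UNIV (T f)" unfolding T_def by (intro continuous_intros)
    show "norm (T f t) \<le> norm y0 + M * (2 * \<delta>)" for t
    proof -
      have "norm (F f (c t) - F f (c 0)) \<le> M * \<bar>c t - c 0\<bar>"
        by (rule vector_derivative_bound[OF _ Fd bnd c c]) auto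
      also have "\<dots> \<le> M * (2 * \<delta>)"
        using c[of t] c[of 0] order_trans[OF norm_ge_zero bnd] by (intro mult_left_mono) auto
      finally show ?thesis
        unfolding T_def using norm_triangle_le[of y0 "F f (c t) - F f (c 0)"] by (simp add: algebra_simps)
    qed
  qed
  have "\<exists>!f. Bcontfun (T f) = f"
  proof (rule banach_fix_type[of "1/2"])
    show "\<forall>f h. dist (Bcontfun (T f)) (Bcontfun (T h)) \<le> 1 / 2 * dist f h"
    proof (intro allI dist_bound)
      fix f h :: "real \<Rightarrow>\<^sub>C 'a" and t
      let ?D = "\<lambda>u. F f u - F h u"
      have Dd: "(?D has_vector_derivative X (apply_bcontfun f u) - X (apply_bcontfun h u)) (at u within {-\<delta>..\<delta>})"
        if "u \<in> {-\<delta>..\<delta>}" for u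
        using Fd[OF that] by (intro has_vector_derivative_diff)
      have "norm (X (apply_bcontfun f u) - X (apply_bcontfun h u)) \<le> L * dist f h" for u
        using L(2)[of "apply_bcontfun f u" "apply_bcontfun h u"] dist_bounded[of f u h] L(1)
        by (metis dist_norm mult_left_mono order_trans)
      then have "norm (?D (c t) - ?D (c 0)) \<le> L * dist f h * \<bar>c t - c 0\<bar>"
        by (intro vector_derivative_bound[OF _ Dd _ c c]) auto
      also have "\<dots> \<le> L * dist f h * \<delta>"
        using \<delta> L(1) by (intro mult_left_mono) (auto simp: c_def)
      also have "\<dots> = (L * \<delta>) * dist f h" by simp
      also have "\<dots> \<le> 1 / 2 * dist f h" using \<delta>(2) by (intro mult_right_mono) auto
      finally show "dist (apply_bcontfun (Bcontfun (T f)) t) (apply_bcontfun (Bcontfun (T h)) t) \<le> 1 / 2 * dist f h"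
        using Tb by (simp add: Bcontfun_inverse dist_norm T_def algebra_simps)
    qed
  qed auto
  then obtain f where "Bcontfun (T f) = f" by blast
  then have f: "apply_bcontfun f = T f" using Tb Bcontfun_inverse by metis
  show ?thesis
  proof (rule that[of \<delta> "apply_bcontfun f"])
    show "apply_bcontfun f 0 = y0" by (simp add: f T_def)
    show "(apply_bcontfun f has_vector_derivative X (apply_bcontfun f t)) (at t)"
      if t: "t \<in> {-\<delta><..<\<delta>}" for t
    proof -
      have "(F f has_vector_derivative X (apply_bcontfun f t)) (at t within {-\<delta>..\<delta>})"
        using Fd t by simp
      then have "(F f has_vector_derivative X (apply_bcontfun f t)) (at t)"
        using at_within_interior[of t "{-\<delta>..\<delta>}"] t by simp
      then have "((\<lambda>t. y0 + F f t - F f (c 0)) has_vector_derivative X (apply_bcontfun f t)) (at t)"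
        by (auto intro!: derivative_eq_intros)
      then show ?thesis
        by (rule has_vector_derivative_transform_within_open[of _ _ _ "{-\<delta><..<\<delta>}"])
          (use t in \<open>auto simp: f T_def c_def\<close>)
    qed
  qed (rule \<delta>)
qed

text \<open>Composing \<open>X\<close> with the nearest-point map onto a closed ball makes it
  bounded and Lipschitz everywhere. For short times the solution stays in the ball, where nothing
  has been changed.\<close>

lemma ode_solution:
  fixes X :: "'a::euclidean_space \<Rightarrow> 'a"
  assumes S: "open S" "y0 \<in> S" and X: "times_differentiable_on 1 X S"
  obtains \<delta> y where "\<delta> > 0" "y 0 = y0"
    "\<And>t. t \<in> {-\<delta><..<\<delta>} \<Longrightarrow> y t \<in> S \<and> (y has_vector_derivative X (y t)) (at t)"
proof -
  obtain r L where r: "r > 0" and L: "L \<ge> 0" and rS: "cball y0 r \<subseteq> S" and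
    lip: "\<And>a b. a \<in> cball y0 r \<Longrightarrow> b \<in> cball y0 r \<Longrightarrow> norm (X a - X b) \<le> L * norm (a - b)"
    using times_differentiable_on_lipschitz[OF S X] by metis
  define p where "p = closest_point (cball y0 r)"
  have ne: "cball y0 r \<noteq> {}" using r by simp
  have p: "p a \<in> cball y0 r" for a
    unfolding p_def using ne by (intro closest_point_in_set) auto
  have pl: "norm (p a - p b) \<le> norm (a - b)" for a b
    using closest_point_lipschitz[of "cball y0 r" a b] ne by (simp add: p_def dist_norm)
  have 1: "norm (X (p a) - X (p b)) \<le> L * norm (a - b)" for a b
    using lip[OF p p] pl[of a b] L by (meson mult_left_mono order_trans)
  have 2: "norm (X (p a)) \<le> norm (X y0) + L * r" for a
  proof -
    have "norm (X (p a) - X y0) \<le> L * norm (p a - y0)" using lip[OF p] r by simp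
    also have "\<dots> \<le> L * r" using p[of a] L by (intro mult_left_mono) (auto simp: dist_norm norm_minus_commute)
    finally show ?thesis using norm_triangle_sub[of "X (p a)" "X y0"] by linarith
  qed
  obtain \<delta> y where \<delta>: "\<delta> > 0" and y: "y 0 = y0"
    "\<And>t. t \<in> {-\<delta><..<\<delta>} \<Longrightarrow> (y has_vector_derivative X (p (y t))) (at t)"
    using lipschitz_ode_solution[of L "\<lambda>a. X (p a)" "norm (X y0) + L * r" y0] L 1 2 by metis
  have "isCont y 0" using y(2)[of 0] \<delta> by (auto intro: has_vector_derivative_continuous)
  then obtain d where d: "d > 0" "\<And>t. \<bar>t\<bar> < d \<Longrightarrow> dist (y t) y0 < r"
    using r y(1) unfolding continuous_at_eps_delta by (auto simp: dist_norm)
  show ?thesis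
  proof (rule that[of "min \<delta> d" y])
    fix t assume t: "t \<in> {-(min \<delta> d)<..<min \<delta> d}"
    then have in_ball: "y t \<in> cball y0 r" using d(2)[of t] by (auto simp: dist_commute less_imp_le)
    then have "p (y t) = y t" by (simp add: p_def closest_point_self)
    then show "y t \<in> S \<and> (y has_vector_derivative X (y t)) (at t)"
      using y(2)[of t] t in_ball rS by auto
  qed (use \<delta> d y in auto)
qed

text \<open>On a short closed interval the distance of the two solutions attains a maximum. The mean
  value inequality bounds this maximum by half of itself.\<close>

lemma ode_local_unique:
  fixes X :: "'a::euclidean_space \<Rightarrow> 'a"
  assumes S: "open S" "y t0 \<in> S" and X: "times_differentiable_on 1 X S"
    and d: "d > 0"
    and y: "\<And>t. t \<in> ball t0 d \<Longrightarrow> (y has_vector_derivative X (y t)) (at t)"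
    and z: "\<And>t. t \<in> ball t0 d \<Longrightarrow> (z has_vector_derivative X (z t)) (at t)"
    and eq: "z t0 = y t0"
  obtains e where "e > 0" "\<And>t. t \<in> ball t0 e \<Longrightarrow> y t = z t"
proof -
  obtain r L where r: "r > 0" and L: "L \<ge> 0" and
    lip: "\<And>a b. a \<in> cball (y t0) r \<Longrightarrow> b \<in> cball (y t0) r \<Longrightarrow> norm (X a - X b) \<le> L * norm (a - b)"
    using times_differentiable_on_lipschitz[OF S X] by metis
  have "isCont y t0" "isCont z t0"
    using y[of t0] z[of t0] d by (auto intro: has_vector_derivative_continuous)
  then obtain d1 d2 where d1: "d1 > 0" "\<And>t. dist t t0 < d1 \<Longrightarrow> dist (y t) (y t0) < r"
    and d2: "d2 > 0" "\<And>t. dist t t0 < d2 \<Longrightarrow> dist (z t) (y t0) < r"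
    using r eq unfolding continuous_at_eps_delta by metis
  define e where "e = min (min d1 d2) (min d (1 / (L + 1))) / 2"
  have e: "e > 0" "e < d1" "e < d2" "e < d" using d1 d2 d L by (auto simp: e_def min_def)
  have "e \<le> 1 / (L + 1) / 2" unfolding e_def by (intro divide_right_mono) auto
  then have Le: "L * e \<le> 1 / 2" using L e by (simp add: field_simps)
  let ?u = "\<lambda>t. y t - z t"
  have ud: "(?u has_vector_derivative X (y t) - X (z t)) (at t within cball t0 e)" if "t \<in> cball t0 e" for t
    using y[of t] z[of t] that e by (auto intro: has_vector_derivative_at_within[OF has_vector_derivative_diff])
  have "continuous_on (cball t0 e) ?u"
    using ud has_vector_derivative_continuous continuous_on_eq_continuous_within by blast
  then have "continuous_on (cball t0 e) (\<lambda>t. norm (?u t))" by (rule continuous_on_norm)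
  moreover have "cball t0 e \<noteq> {}" using e by simp
  ultimately obtain s where s: "s \<in> cball t0 e" "\<And>t. t \<in> cball t0 e \<Longrightarrow> norm (?u t) \<le> norm (?u s)"
    using continuous_attains_sup[of "cball t0 e" "\<lambda>t. norm (?u t)"] by auto
  have b: "norm (X (y t) - X (z t)) \<le> L * norm (?u s)" if t: "t \<in> cball t0 e" for t
  proof -
    have "y t \<in> cball (y t0) r" "z t \<in> cball (y t0) r"
      using d1(2)[of t] d2(2)[of t] t e by (auto simp: dist_commute)
    then have "norm (X (y t) - X (z t)) \<le> L * norm (?u t)" by (rule lip)
    then show ?thesis using s(2)[OF t] L by (meson mult_left_mono order_trans)
  qed
  have "norm (?u s - ?u t0) \<le> L * norm (?u s) * \<bar>s - t0\<bar>"
    by (rule vector_derivative_bound[OF _ ud b]) (use s e in auto)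
  also have "\<dots> \<le> L * norm (?u s) * e"
    using s L by (intro mult_left_mono) (auto simp: dist_real_def)
  also have "\<dots> = L * e * norm (?u s)" by simp
  also have "\<dots> \<le> 1 / 2 * norm (?u s)" using Le by (intro mult_right_mono) auto
  finally have "norm (?u s) \<le> 0" by (simp add: eq)
  then have "norm (?u t) \<le> 0" if "t \<in> ball t0 e" for t using s(2)[of t] that by (simp add: less_imp_le)
  then show ?thesis using e that by (metis eq_iff_diff_eq_0 norm_le_zero_iff)
qed

lemma has_vector_derivative_at_0_iff:
  "(f has_vector_derivative D) (at 0) \<longleftrightarrow> ((\<lambda>s. (f s - f 0) /\<^sub>R s) \<longlongrightarrow> D) (at (0::real))"
proof -
  have "norm (f h - f 0 - h *\<^sub>R D) / norm h = norm ((f h - f 0) /\<^sub>R h - D)" if "h \<noteq> 0" for h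
  proof -
    have "(f h - f 0) /\<^sub>R h - D = (f h - f 0 - h *\<^sub>R D) /\<^sub>R h"
      using that by (simp add: scaleR_diff_right)
    then show ?thesis by (simp add: divide_inverse_commute)
  qed
  then have "((\<lambda>h. norm (f h - f 0 - h *\<^sub>R D) / norm h) \<longlongrightarrow> 0) (at 0)
      \<longleftrightarrow> ((\<lambda>h. norm ((f h - f 0) /\<^sub>R h - D)) \<longlongrightarrow> 0) (at 0)"
    by (intro filterlim_cong) (auto simp: eventually_at_filter)
  then show ?thesis
    unfolding has_vector_derivative_def has_derivative_at
    by (simp add: bounded_linear_scaleR_left tendsto_norm_zero_iff Lim_null[symmetric])
qed

text \<open>The value is what formal differentiation of \<open>P s (b s) = q s\<close> at 0 gives,
  \<open>P 0\<close> being the identity. The content is that \<open>b\<close> is differentiable at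
  all: it is first shown to be continuous, then its difference quotient is solved for.\<close>

lemma linear_solution_has_vector_derivative:
  fixes P :: "real \<Rightarrow> 'a::euclidean_space \<Rightarrow> 'a"
  assumes lin: "eventually (\<lambda>s. linear (P s)) (at 0)" and P0: "\<And>w. P 0 w = w"
    and P': "\<And>w. ((\<lambda>s. P s w) has_vector_derivative P' w) (at 0)"
    and q: "(q has_vector_derivative q') (at 0)"
    and sol: "eventually (\<lambda>s. P s (b s) = q s) (at 0)" and b0: "b 0 = q 0"
  shows "(b has_vector_derivative q' - P' (b 0)) (at 0)"
proof -
  \<comment> \<open>Stands in for the operator norm of \<open>P s\<close> minus the identity:
    \<open>P\<close> is controlled only one vector at a time, hence on a basis.\<close>
  define \<eta> where "\<eta> s = (\<Sum>i\<in>Basis. norm (P s i - i))" for s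
  have \<eta>0: "\<eta> s \<ge> 0" for s by (auto simp: \<eta>_def intro: sum_nonneg)
  have est: "norm (P s w - w) \<le> norm w * \<eta> s" if "linear (P s)" for s w
  proof -
    have "P s w - w = (\<Sum>i\<in>Basis. (w \<bullet> i) *\<^sub>R (P s i - i))"
    proof -
      have "P s w = P s (\<Sum>i\<in>Basis. (w \<bullet> i) *\<^sub>R i)" by (simp add: euclidean_representation)
      also have "\<dots> = (\<Sum>i\<in>Basis. (w \<bullet> i) *\<^sub>R P s i)"
        by (simp add: linear_sum[OF that] linear_scale[OF that])
      finally show ?thesis
        by (simp add: scaleR_diff_right sum_subtractf euclidean_representation)
    qed
    then have "norm (P s w - w) \<le> (\<Sum>i\<in>Basis. \<bar>w \<bullet> i\<bar> * norm (P s i - i))"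
      by (metis (mono_tags, lifting) norm_sum norm_scaleR sum.cong)
    also have "\<dots> \<le> (\<Sum>i\<in>Basis. norm w * norm (P s i - i))"
      by (intro sum_mono mult_right_mono) (auto simp: Basis_le_norm)
    finally show ?thesis by (simp add: \<eta>_def sum_distrib_left)
  qed
  have Pc: "((\<lambda>s. P s w) \<longlongrightarrow> w) (at 0)" for w
    using has_vector_derivative_continuous[OF P'[of w]] by (simp add: continuous_at P0)
  have \<eta>: "(\<eta> \<longlongrightarrow> 0) (at 0)"
    unfolding \<eta>_def by (intro tendsto_null_sum tendsto_norm_zero LIM_zero Pc)
  have qc: "(q \<longlongrightarrow> q 0) (at 0)"
    using has_vector_derivative_continuous[OF q] by (simp add: continuous_at)
  \<comment> \<open>Below 1/2 the error \<open>norm (b s) * \<eta> s\<close> can be absorbed, which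
    bounds \<open>b s\<close> by \<open>2 * norm (q s)\<close> and leads to continuity of
    \<open>b\<close> at 0.\<close>
  have "eventually (\<lambda>s. \<eta> s < 1/2) (at 0)" using \<eta> by (rule order_tendstoD) simp
  then have "eventually (\<lambda>s. norm (b s - q s) \<le> 2 * norm (q s) * \<eta> s) (at 0)"
    using lin sol
  proof eventually_elim
    case (elim s)
    have 1: "norm (q s - b s) \<le> norm (b s) * \<eta> s" using est[OF elim(2), of "b s"] elim(3) by simp
    also have "\<dots> \<le> norm (b s) * (1/2)" using elim(1) by (intro mult_left_mono) auto
    finally have "norm (b s) \<le> 2 * norm (q s)"
      using norm_triangle_sub[of "b s" "q s"] by (simp add: norm_minus_commute)
    then show ?case using 1 \<eta>0[of s] by (metis mult_right_mono norm_minus_commute order_trans)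
  qed
  moreover have "((\<lambda>s. 2 * norm (q s) * \<eta> s) \<longlongrightarrow> 0) (at 0)"
    using tendsto_mult[OF tendsto_mult[OF tendsto_const tendsto_norm[OF qc]] \<eta>, of 2] by simp
  ultimately have "((\<lambda>s. b s - q s) \<longlongrightarrow> 0) (at 0)" by (rule Lim_null_comparison)
  from tendsto_add[OF this qc] have bc: "(b \<longlongrightarrow> b 0) (at 0)" by (simp add: b0)
  have D: "((\<lambda>s. (P s w - w) /\<^sub>R s) \<longlongrightarrow> P' w) (at 0)" for w
    using P'[of w] by (simp add: has_vector_derivative_at_0_iff P0)
  \<comment> \<open>The mixed term of the difference quotient. It tends to 0 as a product of the
    vanishing \<open>b s - b 0\<close> with the difference quotients of \<open>P\<close>, which
    converge on the basis.\<close>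
  define R where "R s = (P s (b s - b 0) - (b s - b 0)) /\<^sub>R s" for s
  have "(R \<longlongrightarrow> 0) (at 0)"
  proof (rule Lim_null_comparison)
    show "eventually (\<lambda>s. norm (R s) \<le> norm (b s - b 0) * (\<Sum>i\<in>Basis. norm ((P s i - i) /\<^sub>R s))) (at 0)"
      using lin
    proof eventually_elim
      case (elim s)
      have "norm (R s) = inverse \<bar>s\<bar> * norm (P s (b s - b 0) - (b s - b 0))" by (simp add: R_def)
      also have "\<dots> \<le> inverse \<bar>s\<bar> * (norm (b s - b 0) * \<eta> s)"
        using est[OF elim] by (intro mult_left_mono) auto
      finally show ?case by (simp add: \<eta>_def sum_distrib_left mult_ac)
    qed
    have "((\<lambda>s. norm (b s - b 0) * (\<Sum>i\<in>Basis. norm ((P s i - i) /\<^sub>R s))) \<longlongrightarrow> 0 * (\<Sum>i\<in>Basis. norm (P' i))) (at 0)"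
      using bc by (intro tendsto_mult tendsto_sum tendsto_norm D tendsto_norm_zero LIM_zero)
    then show "((\<lambda>s. norm (b s - b 0) * (\<Sum>i\<in>Basis. norm ((P s i - i) /\<^sub>R s))) \<longlongrightarrow> 0) (at 0)"
      by simp
  qed
  then have "((\<lambda>s. (q s - q 0) /\<^sub>R s - (P s (b 0) - b 0) /\<^sub>R s - R s) \<longlongrightarrow> q' - P' (b 0) - 0) (at 0)"
    using q by (intro tendsto_diff D) (simp_all add: has_vector_derivative_at_0_iff)
  moreover have "eventually (\<lambda>s. (q s - q 0) /\<^sub>R s - (P s (b 0) - b 0) /\<^sub>R s - R s = (b s - b 0) /\<^sub>R s) (at 0)"
    using lin sol
  proof eventually_elim
    case (elim s)
    have "P s (b s - q 0) = q s - P s (q 0)" using linear_diff[OF elim(1)] elim(2) by simp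
    then show ?case by (simp add: R_def b0 scaleR_diff_right)
  qed
  ultimately have "((\<lambda>s. (b s - b 0) /\<^sub>R s) \<longlongrightarrow> q' - P' (b 0)) (at 0)"
    using tendsto_cong by fastforce
  then show ?thesis by (simp add: has_vector_derivative_at_0_iff)
qed

section \<open>Calculus on manifolds\<close>

lemma charts_atD: "c \<in> charts_at A x \<Longrightarrow> c \<in> A" "c \<in> charts_at A x \<Longrightarrow> x \<in> fst c"
  by (auto simp: charts_at_def)

lemma charts_atI: "c \<in> A \<Longrightarrow> x \<in> fst c \<Longrightarrow> c \<in> charts_at A x"
  by (auto simp: charts_at_def)

lemma is_chart_facts:
  assumes "is_chart c"
  shows is_chart_open: "open (fst c)" "open (snd c ` fst c)"
    and is_chart_inj: "inj_on (snd c) (fst c)"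
    and is_chart_cont: "continuous_on (fst c) (snd c)"
    and is_chart_cont_inv: "continuous_on (snd c ` fst c) (chart_inv c)"
proof -
  obtain h where h: "homeomorphism (fst c) (snd c ` fst c) (snd c) h"
    using assms by (auto simp: is_chart_def)
  show "open (fst c)" "open (snd c ` fst c)" using assms by (auto simp: is_chart_def)
  show inj: "inj_on (snd c) (fst c)" using h by (auto simp: homeomorphism_def intro: inj_on_inverseI)
  show "continuous_on (fst c) (snd c)" using h by (auto simp: homeomorphism_def)
  have "chart_inv c y = h y" if "y \<in> snd c ` fst c" for y
    using that inj h by (auto simp: chart_inv_def homeomorphism_def)
  then show "continuous_on (snd c ` fst c) (chart_inv c)"
    using h continuous_on_cong[of "snd c ` fst c" _ "chart_inv c" h] by (simp add: homeomorphism_def)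
qed

text \<open>Inverse to evaluation at \<open>c\<close>: it identifies the model space with the
  tangent space at \<open>x\<close>.\<close>

definition tangent_of ::
  "('m, 'e::euclidean_space) chart set \<Rightarrow> 'm \<Rightarrow> ('m, 'e) chart \<Rightarrow> 'e \<Rightarrow> ('m, 'e) tangent" where
  "tangent_of A x c w = (\<lambda>d. if d \<in> charts_at A x
     then frechet_derivative (snd d \<circ> chart_inv c) (at (snd c x)) w else 0)"

context smooth_manifold begin

lemma chart_inv_chart [simp]: "c \<in> charts_at A x \<Longrightarrow> chart_inv c (snd c x) = x"
  using is_chart_inj[OF is_chart] by (auto simp: charts_at_def chart_inv_def)

lemma chart_chart_inv: "c \<in> A \<Longrightarrow> y \<in> snd c ` fst c \<Longrightarrow> snd c (chart_inv c y) = y"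
  by (simp add: chart_inv_def f_inv_into_f)

lemma chart_inv_in: "c \<in> A \<Longrightarrow> y \<in> snd c ` fst c \<Longrightarrow> chart_inv c y \<in> fst c"
  by (simp add: chart_inv_def inv_into_into)

lemma chart_inv_charts_at: "c \<in> A \<Longrightarrow> y \<in> snd c ` fst c \<Longrightarrow> c \<in> charts_at A (chart_inv c y)"
  by (simp add: charts_atI chart_inv_in)

lemma chart_inv_isCont: "c \<in> A \<Longrightarrow> y \<in> snd c ` fst c \<Longrightarrow> isCont (chart_inv c) y"
  using is_chart_cont_inv[OF is_chart, of c] is_chart_open(2)[OF is_chart, of c]
  by (auto simp: continuous_on_eq_continuous_at)

lemma charts_at_eventually:
  assumes "c \<in> charts_at A (Q p)" "isCont Q p"
  shows "eventually (\<lambda>q. c \<in> charts_at A (Q q)) (nhds p)"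
proof -
  have "eventually (\<lambda>y. y \<in> fst c) (nhds (Q p))"
    using assms is_chart_open(1)[OF is_chart] unfolding charts_at_def eventually_nhds by blast
  then have "eventually (\<lambda>q. Q q \<in> fst c) (nhds p)"
    using assms(2) unfolding isCont_def tendsto_at_iff_tendsto_nhds by (rule eventually_compose_filterlim)
  then show ?thesis
    using assms by (auto simp: charts_at_def elim: eventually_mono)
qed

text \<open>Near \<open>p\<close> the map \<open>Q\<close> can be factored through the chart. As
  \<open>Q\<close> starts in any normed space, this one chain rule serves both for curves and for
  maps read in a chart of their source.\<close>

lemma chain_through_chart:
  fixes f :: "'m \<Rightarrow> 'b::real_normed_vector" and Q :: "'p::real_normed_vector \<Rightarrow> 'm"
  assumes c: "c \<in> charts_at A (Q p)" and Q: "isCont Q p"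
    and dQ: "((snd c \<circ> Q) has_derivative Q') (at p)"
    and df: "((f \<circ> chart_inv c) has_derivative f') (at (snd c (Q p)))"
  shows "((f \<circ> Q) has_derivative (\<lambda>v. f' (Q' v))) (at p)"
proof -
  have "((\<lambda>q. (f \<circ> chart_inv c) ((snd c \<circ> Q) q)) has_derivative (\<lambda>v. f' (Q' v))) (at p)"
    by (rule has_derivative_compose[OF dQ]) (use df in \<open>simp add: o_def\<close>)
  then show ?thesis
  proof (rule has_derivative_transform_eventually)
    have "eventually (\<lambda>q. c \<in> charts_at A (Q q)) (at p)"
      using charts_at_eventually[OF c Q] by (simp add: eventually_nhds_conv_at)
    then show "eventually (\<lambda>q. (f \<circ> chart_inv c) ((snd c \<circ> Q) q) = (f \<circ> Q) q) (at p)"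
      by eventually_elim simp
  qed (use c in simp_all)
qed

lemma transition_has_derivative:
  assumes "c \<in> charts_at A x" "d \<in> charts_at A x"
  shows "((snd d \<circ> chart_inv c) has_derivative frechet_derivative (snd d \<circ> chart_inv c) (at (snd c x)))
    (at (snd c x))"
proof -
  have "times_differentiable_on 1 (snd d \<circ> chart_inv c) (snd c ` (fst c \<inter> fst d))"
    using compatible assms unfolding smooth_on_def charts_at_def by blast
  then show ?thesis
    using assms by (auto simp: charts_at_def frechet_derivative_works[symmetric])
qed

lemma transition_derivative_id:
  assumes "c \<in> charts_at A x"
  shows "frechet_derivative (snd c \<circ> chart_inv c) (at (snd c x)) = (\<lambda>v. v)"
proof -
  have "((\<lambda>y. y) has_derivative (\<lambda>v. v)) (at (snd c x))" by simp
  then have "((snd c \<circ> chart_inv c) has_derivative (\<lambda>v. v)) (at (snd c x))"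
    by (rule has_derivative_transform_within_open[of _ _ _ _ "snd c ` fst c"])
      (use assms is_chart_open[OF is_chart] in \<open>auto simp: charts_at_def chart_chart_inv\<close>)
  from frechet_derivative_at[OF this] show ?thesis by simp
qed

lemma tangent_spaceI:
  assumes "\<And>c d. c \<in> charts_at A x \<Longrightarrow> d \<in> charts_at A x \<Longrightarrow>
      v d = frechet_derivative (snd d \<circ> chart_inv c) (at (snd c x)) (v c)"
    and "\<And>c. c \<notin> charts_at A x \<Longrightarrow> v c = 0"
  shows "v \<in> tangent_space A x"
  unfolding tangent_space_def using assms by blast

lemma tangent_transform:
  assumes "v \<in> tangent_space A x" "c \<in> charts_at A x" "d \<in> charts_at A x"
  shows "v d = frechet_derivative (snd d \<circ> chart_inv c) (at (snd c x)) (v c)"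
  using assms unfolding tangent_space_def by blast

lemma tangent_outside: "v \<in> tangent_space A x \<Longrightarrow> c \<notin> charts_at A x \<Longrightarrow> v c = 0"
  unfolding tangent_space_def by blast

lemma tangent_of_chart [simp]: "c \<in> charts_at A x \<Longrightarrow> tangent_of A x c w c = w"
  by (simp add: tangent_of_def transition_derivative_id)

text \<open>The cocycle identity for derivatives of transition maps: passing from \<open>c\<close>
  to a third chart directly or through \<open>d\<close> gives the same.\<close>

lemma tangent_of_in:
  assumes c: "c \<in> charts_at A x"
  shows "tangent_of A x c w \<in> tangent_space A x"
proof -
  have *: "frechet_derivative (snd d' \<circ> chart_inv c) (at (snd c x)) w =
      frechet_derivative (snd d' \<circ> chart_inv d) (at (snd d x)) (frechet_derivative (snd d \<circ> chart_inv c) (at (snd c x)) w)"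
    if d: "d \<in> charts_at A x" "d' \<in> charts_at A x" for d d'
  proof -
    have y: "c \<in> A" "snd c x \<in> snd c ` fst c" using c by (auto simp: charts_at_def)
    have "((snd d' \<circ> chart_inv c) has_derivative (\<lambda>v. frechet_derivative (snd d' \<circ> chart_inv d) (at (snd d x))
        (frechet_derivative (snd d \<circ> chart_inv c) (at (snd c x)) v))) (at (snd c x))"
      by (rule chain_through_chart[where Q="chart_inv c" and c=d
            and f'="frechet_derivative (snd d' \<circ> chart_inv d) (at (snd d x))"])
        (use c d transition_has_derivative[OF c d(1)] transition_has_derivative[OF d]
          chart_inv_isCont[OF y] in simp_all)
    from frechet_derivative_at[OF this] show ?thesis by metis
  qed
  show ?thesis
    by (rule tangent_spaceI) (simp_all only: tangent_of_def if_True if_False *[symmetric])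
qed

lemma tangent_eqI:
  assumes "v \<in> tangent_space A x" "w \<in> tangent_space A x" "c \<in> charts_at A x" "v c = w c"
  shows "v = w"
proof
  fix d show "v d = w d"
  proof (cases "d \<in> charts_at A x")
    case True
    then show ?thesis
      using tangent_transform[OF assms(1,3)] tangent_transform[OF assms(2,3)] assms(4) by metis
  next
    case False
    then show ?thesis using tangent_outside assms(1,2) by metis
  qed
qed

lemma tangent_of_eq: "v \<in> tangent_space A x \<Longrightarrow> c \<in> charts_at A x \<Longrightarrow> tangent_of A x c (v c) = v"
  by (rule tangent_eqI) (auto simp: tangent_of_in)

lemma transition_linear:
  "c \<in> charts_at A x \<Longrightarrow> d \<in> charts_at A x \<Longrightarrow>
    linear (frechet_derivative (snd d \<circ> chart_inv c) (at (snd c x)))"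
  using transition_has_derivative has_derivative_linear by blast

lemma tangent_space_subspace: "subspace (tangent_space A x)"
proof (rule subspaceI)
  show "0 \<in> tangent_space A x"
    by (rule tangent_spaceI) (simp_all add: linear_0[OF transition_linear])
next
  fix v w assume v: "v \<in> tangent_space A x" and w: "w \<in> tangent_space A x"
  show "v + w \<in> tangent_space A x"
  proof (rule tangent_spaceI)
    fix c d assume cd: "c \<in> charts_at A x" "d \<in> charts_at A x"
    show "(v + w) d = frechet_derivative (snd d \<circ> chart_inv c) (at (snd c x)) ((v + w) c)"
      using tangent_transform[OF v cd] tangent_transform[OF w cd]
      by (simp add: linear_add[OF transition_linear[OF cd]])
  qed (simp add: tangent_outside[OF v] tangent_outside[OF w])
next
  fix v and r :: real assume v: "v \<in> tangent_space A x"
  show "r *\<^sub>R v \<in> tangent_space A x"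
  proof (rule tangent_spaceI)
    fix c d assume cd: "c \<in> charts_at A x" "d \<in> charts_at A x"
    show "(r *\<^sub>R v) d = frechet_derivative (snd d \<circ> chart_inv c) (at (snd c x)) ((r *\<^sub>R v) c)"
      using tangent_transform[OF v cd]
      by (simp add: scaleR_fun_def linear_scale[OF transition_linear[OF cd]])
  qed (simp add: scaleR_fun_def tangent_outside[OF v])
qed

text \<open>A single chart suffices, since the tangent vector and the derivative of the curve change
  charts by the same linear map.\<close>

lemma has_velocityI:
  assumes c: "c \<in> charts_at A (\<gamma> t)" and "isCont \<gamma> t" and v: "v \<in> tangent_space A (\<gamma> t)"
    and "((snd c \<circ> \<gamma>) has_vector_derivative v c) (at t)"
  shows "has_velocity A \<gamma> t v"
proof -
  have "((snd d \<circ> \<gamma>) has_vector_derivative v d) (at t)" if d: "d \<in> charts_at A (\<gamma> t)" for d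
  proof -
    have lin: "linear (frechet_derivative (snd d \<circ> chart_inv c) (at (snd c (\<gamma> t))))"
      using transition_has_derivative[OF c d] has_derivative_linear by blast
    have "((snd d \<circ> \<gamma>) has_derivative
        (\<lambda>h. frechet_derivative (snd d \<circ> chart_inv c) (at (snd c (\<gamma> t))) (h *\<^sub>R v c))) (at t)"
      by (rule chain_through_chart[where Q=\<gamma> and p=t and Q'="\<lambda>h. h *\<^sub>R v c", OF c _ _ transition_has_derivative[OF c d]])
        (use assms in \<open>auto simp: has_vector_derivative_def\<close>)
    moreover have "v d = frechet_derivative (snd d \<circ> chart_inv c) (at (snd c (\<gamma> t))) (v c)"
      using v c d unfolding tangent_space_def by blast
    ultimately show ?thesis by (simp add: has_vector_derivative_def linear_scale[OF lin])
  qed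
  then show ?thesis using assms by (auto simp: has_velocity_def)
qed

lemma has_velocity_chart:
  "has_velocity A \<gamma> t v \<Longrightarrow> c \<in> charts_at A (\<gamma> t) \<Longrightarrow> ((snd c \<circ> \<gamma>) has_vector_derivative v c) (at t)"
  by (simp add: has_velocity_def)

lemma has_velocity_unique:
  assumes "has_velocity A \<gamma> t v" "has_velocity A \<gamma> t w"
  shows "v = w"
proof -
  obtain c where c: "c \<in> charts_at A (\<gamma> t)" using covering by blast
  show ?thesis
    using assms c vector_derivative_unique_at[of "snd c \<circ> \<gamma>" "v c" t "w c"]
    by (intro tangent_eqI[OF _ _ c]) (auto simp: has_velocity_def)
qed

text \<open>Every tangent vector is a velocity. Identities between tangent maps can therefore be
  tested on curves and follow from uniqueness of velocities.\<close>

lemma chart_line_velocity: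
  assumes c: "c \<in> charts_at A x" and v: "v \<in> tangent_space A x"
  shows "has_velocity A (\<lambda>s. chart_inv c (snd c x + s *\<^sub>R v c)) 0 v"
proof (rule has_velocityI[of c])
  let ?\<gamma> = "\<lambda>s::real. chart_inv c (snd c x + s *\<^sub>R v c)"
  have cA: "c \<in> A" and y: "snd c x \<in> snd c ` fst c" using c by (auto simp: charts_at_def)
  have "isCont (\<lambda>s::real. snd c x + s *\<^sub>R v c) 0" by (intro continuous_intros)
  then show "isCont ?\<gamma> 0"
    by (rule isCont_o2) (use chart_inv_isCont[OF cA y] in simp)
  show "c \<in> charts_at A (?\<gamma> 0)" "v \<in> tangent_space A (?\<gamma> 0)" using c v by simp_all
  have "((\<lambda>s. snd c x + s *\<^sub>R v c) has_vector_derivative v c) (at 0)"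
    by (auto intro!: derivative_eq_intros simp: has_vector_derivative_def)
  moreover have "open ((\<lambda>s::real. snd c x + s *\<^sub>R v c) -` (snd c ` fst c))"
    using is_chart_open[OF is_chart[OF cA]] by (intro open_vimage continuous_intros) auto
  ultimately show "((snd c \<circ> ?\<gamma>) has_vector_derivative v c) (at 0)"
    by (rule has_vector_derivative_transform_within_open)
      (use y cA in \<open>auto simp: chart_chart_inv\<close>)
qed

end

section \<open>Maps differentiable at a point, tangent maps and the chain rule\<close>

definition mdiff ::
  "('m::t2_space, 'e::euclidean_space) chart set \<Rightarrow>
   ('n::topological_space, 'f::euclidean_space) chart set \<Rightarrow> ('m \<Rightarrow> 'n) \<Rightarrow> 'm \<Rightarrow> bool" where
  "mdiff A B F x \<longleftrightarrow> isCont F x \<and> (\<forall>c\<in>charts_at A x. \<forall>d\<in>charts_at B (F x).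
     (snd d \<circ> F \<circ> chart_inv c) differentiable (at (snd c x)))"

lemma mdiff_isCont: "mdiff A B F x \<Longrightarrow> isCont F x"
  by (simp add: mdiff_def)

lemma mdiff_has_derivative:
  assumes "mdiff A B F x" "c \<in> charts_at A x" "d \<in> charts_at B (F x)"
  shows "((snd d \<circ> F \<circ> chart_inv c) has_derivative
    frechet_derivative (snd d \<circ> F \<circ> chart_inv c) (at (snd c x))) (at (snd c x))"
  using assms by (auto simp: mdiff_def frechet_derivative_works[symmetric])

locale manifold_pair = A: smooth_manifold A + B: smooth_manifold B
  for A :: "('m::{t2_space, second_countable_topology}, 'e::euclidean_space) chart set"
    and B :: "('n::{t2_space, second_countable_topology}, 'f::euclidean_space) chart set"
begin

lemma isCont_in_chart:
  assumes "mdiff A B F x" and c: "c \<in> charts_at A x"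
  shows "isCont (F \<circ> chart_inv c) (snd c x)"
proof -
  have "isCont (chart_inv c) (snd c x)"
    by (rule A.chart_inv_isCont[OF charts_atD(1)[OF c]]) (use charts_atD(2)[OF c] in blast)
  moreover have "isCont F (chart_inv c (snd c x))"
    using assms by (simp add: mdiff_def)
  ultimately show ?thesis unfolding o_def by (rule isCont_o2)
qed

text \<open>The components in the charts of \<open>B\<close> are related by the chain rule for
  \<open>F\<close> read in the one chart chosen at \<open>x\<close>. Only the coordinate of
  \<open>v\<close> in that chart enters, so \<open>v\<close> may be arbitrary.\<close>

lemma tangent_map_in:
  assumes F: "mdiff A B F x"
  shows "tangent_map A B F x v \<in> tangent_space B (F x)"
proof -
  define c where "c = (SOME c. c \<in> charts_at A x)"
  have c: "c \<in> charts_at A x" using A.covering someI_ex unfolding c_def by (metis ex_in_conv)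
  have *: "frechet_derivative (snd d' \<circ> F \<circ> chart_inv c) (at (snd c x)) w =
      frechet_derivative (snd d' \<circ> chart_inv d) (at (snd d (F x))) (frechet_derivative (snd d \<circ> F \<circ> chart_inv c) (at (snd c x)) w)"
    if d: "d \<in> charts_at B (F x)" "d' \<in> charts_at B (F x)" for d d' w
  proof -
    have "((snd d' \<circ> (F \<circ> chart_inv c)) has_derivative (\<lambda>v. frechet_derivative (snd d' \<circ> chart_inv d) (at (snd d (F x)))
        (frechet_derivative (snd d \<circ> F \<circ> chart_inv c) (at (snd c x)) v))) (at (snd c x))"
      by (rule B.chain_through_chart[where Q="F \<circ> chart_inv c" and c=d
            and f'="frechet_derivative (snd d' \<circ> chart_inv d) (at (snd d (F x)))"])
        (use c d(1) B.transition_has_derivative[OF d] mdiff_has_derivative[OF F c d(1)]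
          isCont_in_chart[OF F c] in \<open>simp_all only: o_assoc[symmetric] o_apply A.chart_inv_chart\<close>)
    from frechet_derivative_at[OF this] show ?thesis by (metis o_assoc)
  qed
  show ?thesis
    by (rule B.tangent_spaceI)
      (simp_all only: tangent_map_def Let_def c_def[symmetric] if_True if_False *[symmetric])
qed

lemma velocity_in_chart:
  assumes F: "mdiff A B F (\<gamma> t)" and v: "has_velocity A \<gamma> t v"
    and c: "c \<in> charts_at A (\<gamma> t)" and d: "d \<in> charts_at B (F (\<gamma> t))"
  shows "((snd d \<circ> F \<circ> \<gamma>) has_vector_derivative
    frechet_derivative (snd d \<circ> F \<circ> chart_inv c) (at (snd c (\<gamma> t))) (v c)) (at t)"
proof -
  have lin: "linear (frechet_derivative (snd d \<circ> F \<circ> chart_inv c) (at (snd c (\<gamma> t))))"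
    using mdiff_has_derivative[OF F c d] has_derivative_linear by blast
  have "((snd d \<circ> F \<circ> \<gamma>) has_derivative
      (\<lambda>h. frechet_derivative (snd d \<circ> F \<circ> chart_inv c) (at (snd c (\<gamma> t))) (h *\<^sub>R v c))) (at t)"
    by (rule A.chain_through_chart[where Q=\<gamma> and p=t and Q'="\<lambda>h. h *\<^sub>R v c", OF c _ _ mdiff_has_derivative[OF F c d]])
      (use v c in \<open>auto simp: has_velocity_def has_vector_derivative_def\<close>)
  then show ?thesis by (simp add: has_vector_derivative_def linear_scale[OF lin])
qed

lemma velocity_map:
  assumes F: "mdiff A B F (\<gamma> t)" and v: "has_velocity A \<gamma> t v"
  shows "has_velocity B (F \<circ> \<gamma>) t (tangent_map A B F (\<gamma> t) v)"
proof -
  obtain d where d: "d \<in> charts_at B (F (\<gamma> t))" using B.covering by blast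
  define c where "c = (SOME c. c \<in> charts_at A (\<gamma> t))"
  have c: "c \<in> charts_at A (\<gamma> t)" using A.covering someI_ex unfolding c_def by (metis ex_in_conv)
  show ?thesis
  proof (rule B.has_velocityI[of d])
    show "isCont (F \<circ> \<gamma>) t"
      unfolding o_def using v mdiff_isCont[OF F] by (intro isCont_o2[of t \<gamma> F]) (simp_all add: has_velocity_def)
    show "((snd d \<circ> (F \<circ> \<gamma>)) has_vector_derivative tangent_map A B F (\<gamma> t) v d) (at t)"
      using velocity_in_chart[OF F v c d] d by (simp add: tangent_map_def Let_def c_def[symmetric] o_assoc)
  qed (use d tangent_map_in[OF F] in auto)
qed

text \<open>Frees \<open>tangent_map\<close> from the chosen chart: the formula in the chart
  \<open>c\<close> and the definition both compute the velocity of \<open>F\<close> along a chart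
  line with velocity \<open>v\<close>.\<close>

lemma tangent_map_chart:
  assumes F: "mdiff A B F x" and v: "v \<in> tangent_space A x"
    and c: "c \<in> charts_at A x" and d: "d \<in> charts_at B (F x)"
  shows "tangent_map A B F x v d = frechet_derivative (snd d \<circ> F \<circ> chart_inv c) (at (snd c x)) (v c)"
proof -
  define \<gamma> where "\<gamma> s = chart_inv c (snd c x + s *\<^sub>R v c)" for s :: real
  have \<gamma>0: "\<gamma> 0 = x" using c by (simp add: \<gamma>_def)
  have \<gamma>: "has_velocity A \<gamma> 0 v" unfolding \<gamma>_def[abs_def] by (rule A.chart_line_velocity[OF c v])
  have "((snd d \<circ> F \<circ> \<gamma>) has_vector_derivative tangent_map A B F x v d) (at 0)"
    using B.has_velocity_chart[OF velocity_map[of F \<gamma> 0 v], of d] F \<gamma> d \<gamma>0 by (simp add: o_assoc)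
  moreover have "((snd d \<circ> F \<circ> \<gamma>) has_vector_derivative
      frechet_derivative (snd d \<circ> F \<circ> chart_inv c) (at (snd c x)) (v c)) (at 0)"
    using velocity_in_chart[of F \<gamma> 0 v c d] F \<gamma> c d \<gamma>0 by simp
  ultimately show ?thesis by (rule vector_derivative_unique_at)
qed

lemma tangent_map_add:
  assumes F: "mdiff A B F x" and v: "v \<in> tangent_space A x" "w \<in> tangent_space A x"
  shows "tangent_map A B F x (v + w) = tangent_map A B F x v + tangent_map A B F x w"
proof -
  obtain c d where c: "c \<in> charts_at A x" and d: "d \<in> charts_at B (F x)"
    using A.covering B.covering by blast
  have lin: "linear (frechet_derivative (snd d \<circ> F \<circ> chart_inv c) (at (snd c x)))"
    using mdiff_has_derivative[OF F c d] has_derivative_linear by blast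
  show ?thesis
    by (rule B.tangent_eqI[OF tangent_map_in[OF F] _ d])
      (use v in \<open>auto intro!: subspace_add[OF B.tangent_space_subspace] tangent_map_in[OF F]
        simp: tangent_map_chart[OF F _ c d] subspace_add[OF A.tangent_space_subspace] linear_add[OF lin]\<close>)
qed

lemma tangent_map_scale:
  assumes F: "mdiff A B F x" and v: "v \<in> tangent_space A x"
  shows "tangent_map A B F x (r *\<^sub>R v) = r *\<^sub>R tangent_map A B F x v"
proof -
  obtain c d where c: "c \<in> charts_at A x" and d: "d \<in> charts_at B (F x)"
    using A.covering B.covering by blast
  have lin: "linear (frechet_derivative (snd d \<circ> F \<circ> chart_inv c) (at (snd c x)))"
    using mdiff_has_derivative[OF F c d] has_derivative_linear by blast
  have e: "(r *\<^sub>R u) c = r *\<^sub>R u c" for u :: "'k \<Rightarrow> 'l::real_vector" and c by (simp add: scaleR_fun_def)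
  show ?thesis
    by (rule B.tangent_eqI[OF tangent_map_in[OF F] _ d])
      (use v in \<open>auto intro!: subspace_scale[OF B.tangent_space_subspace] tangent_map_in[OF F]
        simp: tangent_map_chart[OF F _ c d] subspace_scale[OF A.tangent_space_subspace] linear_scale[OF lin] e\<close>)
qed

end

lemma mdiff_comp:
  assumes "smooth_manifold A" "smooth_manifold B" "smooth_manifold C"
    and F: "mdiff A B F x" and H: "mdiff B C H (F x)"
  shows "mdiff A C (\<lambda>x. H (F x)) x"
proof -
  interpret AB: manifold_pair A B using assms by (simp add: manifold_pair_def)
  interpret BC: manifold_pair B C using assms by (simp add: manifold_pair_def)
  obtain d where d: "d \<in> charts_at B (F x)" using AB.B.covering by blast
  have "(snd e \<circ> (\<lambda>x. H (F x)) \<circ> chart_inv c) differentiable (at (snd c x))"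
    if c: "c \<in> charts_at A x" and e: "e \<in> charts_at C (H (F x))" for c e
  proof -
    have "(((snd e \<circ> H) \<circ> (F \<circ> chart_inv c)) has_derivative
      (\<lambda>v. frechet_derivative (snd e \<circ> H \<circ> chart_inv d) (at (snd d (F x)))
        (frechet_derivative (snd d \<circ> F \<circ> chart_inv c) (at (snd c x)) v))) (at (snd c x))"
      by (rule AB.B.chain_through_chart[where Q="F \<circ> chart_inv c" and c=d
            and f'="frechet_derivative (snd e \<circ> H \<circ> chart_inv d) (at (snd d (F x)))"])
        (use c d mdiff_has_derivative[OF F c d] mdiff_has_derivative[OF H d e]
          AB.isCont_in_chart[OF F c] in \<open>simp_all only: o_assoc[symmetric] o_apply AB.A.chart_inv_chart\<close>)
    then show ?thesis by (auto simp: differentiable_def o_def)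
  qed
  moreover have "isCont (\<lambda>x. H (F x)) x"
    using mdiff_isCont[OF F] mdiff_isCont[OF H] by (rule isCont_o2)
  ultimately show ?thesis by (auto simp: mdiff_def)
qed

text \<open>Both sides are the velocity of the image of one chart line under the composite
  map.\<close>

lemma tangent_map_comp:
  assumes "smooth_manifold A" "smooth_manifold B" "smooth_manifold C"
    and F: "mdiff A B F x" and H: "mdiff B C H (F x)" and v: "v \<in> tangent_space A x"
  shows "tangent_map A C (\<lambda>x. H (F x)) x v = tangent_map B C H (F x) (tangent_map A B F x v)"
proof -
  interpret AB: manifold_pair A B using assms by (simp add: manifold_pair_def)
  interpret BC: manifold_pair B C using assms by (simp add: manifold_pair_def)
  interpret AC: manifold_pair A C using assms by (simp add: manifold_pair_def)
  obtain c where c: "c \<in> charts_at A x" using AB.A.covering by blast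
  define \<gamma> where "\<gamma> s = chart_inv c (snd c x + s *\<^sub>R v c)" for s :: real
  have \<gamma>0: "\<gamma> 0 = x" using c by (simp add: \<gamma>_def)
  have \<gamma>: "has_velocity A \<gamma> 0 v" unfolding \<gamma>_def[abs_def] by (rule AB.A.chart_line_velocity[OF c v])
  have 1: "has_velocity C ((\<lambda>x. H (F x)) \<circ> \<gamma>) 0 (tangent_map A C (\<lambda>x. H (F x)) x v)"
    using AC.velocity_map[of "\<lambda>x. H (F x)" \<gamma> 0 v] mdiff_comp[OF assms(1-5)] \<gamma> \<gamma>0 by simp
  have "has_velocity B (F \<circ> \<gamma>) 0 (tangent_map A B F x v)"
    using AB.velocity_map[of F \<gamma> 0 v] F \<gamma> \<gamma>0 by simp
  then have "has_velocity C (H \<circ> (F \<circ> \<gamma>)) 0 (tangent_map B C H (F x) (tangent_map A B F x v))"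
    using BC.velocity_map[of H "F \<circ> \<gamma>" 0] H \<gamma>0 by simp
  then show ?thesis using 1 BC.B.has_velocity_unique by (auto simp: o_def)
qed

section \<open>Maps on products, their chart expressions and their partial maps\<close>

lemma prod_chart_inv:
  assumes "smooth_manifold A" "smooth_manifold B" "c \<in> A" "d \<in> B" "p \<in> snd c ` fst c" "q \<in> snd d ` fst d"
  shows "chart_inv (fst c \<times> fst d, map_prod (snd c) (snd d)) (p, q) = (chart_inv c p, chart_inv d q)"
proof -
  interpret A: smooth_manifold A by fact
  interpret B: smooth_manifold B by fact
  have "inj_on (map_prod (snd c) (snd d)) (fst c \<times> fst d)"
    using is_chart_inj[OF A.is_chart[OF assms(3)]] is_chart_inj[OF B.is_chart[OF assms(4)]]
    by (rule map_prod_inj_on)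
  then show ?thesis
    unfolding chart_inv_def fst_conv snd_conv using assms
    by (intro inv_into_f_eq) (simp_all add: f_inv_into_f inv_into_into)
qed

text \<open>Membership in the chart images is demanded explicitly, because \<open>chart_inv\<close>
  has no controlled values outside of them.\<close>

definition map_dom where
  "map_dom c d F U = {z. fst z \<in> snd c ` fst c \<and> snd z \<in> snd d ` fst d \<and>
     F (chart_inv c (fst z), chart_inv d (snd z)) \<in> U}"

lemma prod_smooth_map:
  assumes "smooth_manifold A" "smooth_manifold B" "smooth_manifold C"
    and F: "smooth_map (prod_atlas A B) C F" and cde: "c \<in> A" "d \<in> B" "e \<in> C"
  shows "open (map_dom c d F (fst e))"
    and "smooth_on (\<lambda>z. snd e (F (chart_inv c (fst z), chart_inv d (snd z)))) (map_dom c d F (fst e))"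
proof -
  interpret A: smooth_manifold A by fact
  interpret B: smooth_manifold B by fact
  interpret C: smooth_manifold C by fact
  let ?cd = "(fst c \<times> fst d, map_prod (snd c) (snd d))"
  let ?f = "\<lambda>z. F (chart_inv c (fst z), chart_inv d (snd z))"
  let ?S = "snd c ` fst c \<times> snd d ` fst d"
  have S: "open ?S"
    using is_chart_open[OF A.is_chart[OF cde(1)]] is_chart_open[OF B.is_chart[OF cde(2)]]
    by (intro open_Times)
  have "continuous_on ?S (\<lambda>z. (chart_inv c (fst z), chart_inv d (snd z)))"
    by (intro continuous_on_Pair
        continuous_on_compose2[OF is_chart_cont_inv[OF A.is_chart[OF cde(1)]]]
        continuous_on_compose2[OF is_chart_cont_inv[OF B.is_chart[OF cde(2)]]] continuous_intros) auto
  moreover have "continuous_on UNIV F" using F unfolding smooth_map_def by blast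
  ultimately have "continuous_on ?S ?f"
    using continuous_on_compose2 by blast
  then have "open (?S \<inter> ?f -` fst e)"
    by (rule continuous_open_preimage[OF _ S is_chart_open(1)[OF C.is_chart[OF cde(3)]]])
  also have "?S \<inter> ?f -` fst e = map_dom c d F (fst e)" by (auto simp: map_dom_def)
  finally show op: "open (map_dom c d F (fst e))" .
  have inv: "chart_inv ?cd z = (chart_inv c (fst z), chart_inv d (snd z))" if "z \<in> ?S" for z
    using prod_chart_inv[OF assms(1,2) cde(1,2), of "fst z" "snd z"] that by auto
  have "?cd \<in> prod_atlas A B" using cde unfolding prod_atlas_def by blast
  then have "smooth_on (snd e \<circ> F \<circ> chart_inv ?cd) (snd ?cd ` (fst ?cd \<inter> F -` fst e))"
    using F cde unfolding smooth_map_def by blast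
  moreover have "map_dom c d F (fst e) \<subseteq> snd ?cd ` (fst ?cd \<inter> F -` fst e)"
  proof
    fix z assume z: "z \<in> map_dom c d F (fst e)"
    then have "z = snd ?cd (chart_inv c (fst z), chart_inv d (snd z))"
      using A.chart_chart_inv[OF cde(1)] B.chart_chart_inv[OF cde(2)] by (auto simp: map_dom_def prod_eq_iff)
    moreover have "(chart_inv c (fst z), chart_inv d (snd z)) \<in> fst ?cd \<inter> F -` fst e"
      using z A.chart_inv_in[OF cde(1)] B.chart_inv_in[OF cde(2)] by (auto simp: map_dom_def)
    ultimately show "z \<in> snd ?cd ` (fst ?cd \<inter> F -` fst e)" by blast
  qed
  ultimately have "times_differentiable_on n (snd e \<circ> F \<circ> chart_inv ?cd) (map_dom c d F (fst e))" for n
    unfolding smooth_on_def using times_differentiable_on_subset by blast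
  note td = this
  show "smooth_on (\<lambda>z. snd e (?f z)) (map_dom c d F (fst e))"
    unfolding smooth_on_def
  proof
    fix n
    show "times_differentiable_on n (\<lambda>z. snd e (?f z)) (map_dom c d F (fst e))"
      by (rule times_differentiable_on_cong[OF op _ td])
        (simp add: inv map_dom_def mem_Times_iff)
  qed
qed

lemma prod_smooth_map_has_derivative:
  assumes "smooth_manifold A" "smooth_manifold B" "smooth_manifold C"
    and F: "smooth_map (prod_atlas A B) C F"
    and c: "c \<in> charts_at A x" and d: "d \<in> charts_at B y" and e: "e \<in> charts_at C (F (x, y))"
  shows "((\<lambda>z. snd e (F (chart_inv c (fst z), chart_inv d (snd z)))) has_derivative
    frechet_derivative (\<lambda>z. snd e (F (chart_inv c (fst z), chart_inv d (snd z)))) (at (snd c x, snd d y)))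
    (at (snd c x, snd d y))"
proof -
  interpret A: smooth_manifold A by fact
  interpret B: smooth_manifold B by fact
  have "times_differentiable_on 1 (\<lambda>z. snd e (F (chart_inv c (fst z), chart_inv d (snd z)))) (map_dom c d F (fst e))"
    using prod_smooth_map(2)[OF assms(1-4) charts_atD(1)[OF c] charts_atD(1)[OF d] charts_atD(1)[OF e]]
    unfolding smooth_on_def by blast
  moreover have "(snd c x, snd d y) \<in> map_dom c d F (fst e)"
    using c d e by (auto simp: map_dom_def dest: charts_atD)
  ultimately show ?thesis by (auto simp: frechet_derivative_works[symmetric])
qed

lemma slice_has_derivative:
  assumes "smooth_manifold A" "smooth_manifold B" "smooth_manifold C"
    and F: "smooth_map (prod_atlas A B) C F"
    and c: "c \<in> charts_at A x" and d: "d \<in> charts_at B y" and e: "e \<in> charts_at C (F (x, y))"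
  shows "((snd e \<circ> (\<lambda>a. F (a, y)) \<circ> chart_inv c) has_derivative
    (\<lambda>v. frechet_derivative (\<lambda>z. snd e (F (chart_inv c (fst z), chart_inv d (snd z)))) (at (snd c x, snd d y)) (v, 0)))
    (at (snd c x))"
   and "((snd e \<circ> (\<lambda>b. F (x, b)) \<circ> chart_inv d) has_derivative
    (\<lambda>v. frechet_derivative (\<lambda>z. snd e (F (chart_inv c (fst z), chart_inv d (snd z)))) (at (snd c x, snd d y)) (0, v)))
    (at (snd d y))"
proof -
  interpret A: smooth_manifold A by fact
  interpret B: smooth_manifold B by fact
  note D = prod_smooth_map_has_derivative[OF assms]
  let ?f = "\<lambda>z. snd e (F (chart_inv c (fst z), chart_inv d (snd z)))"
  have "((\<lambda>p. ?f (p, snd d y)) has_derivative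
      (\<lambda>v. frechet_derivative ?f (at (snd c x, snd d y)) (v, 0))) (at (snd c x))"
    by (rule has_derivative_compose[where f="\<lambda>p. (p, snd d y)", OF _ D]) (auto intro!: derivative_eq_intros)
  then show "((snd e \<circ> (\<lambda>a. F (a, y)) \<circ> chart_inv c) has_derivative
    (\<lambda>v. frechet_derivative ?f (at (snd c x, snd d y)) (v, 0))) (at (snd c x))"
    using d by (simp add: o_def)
  have "((\<lambda>p. ?f (snd c x, p)) has_derivative
      (\<lambda>v. frechet_derivative ?f (at (snd c x, snd d y)) (0, v))) (at (snd d y))"
    by (rule has_derivative_compose[where f="\<lambda>p. (snd c x, p)", OF _ D]) (auto intro!: derivative_eq_intros)
  then show "((snd e \<circ> (\<lambda>b. F (x, b)) \<circ> chart_inv d) has_derivative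
    (\<lambda>v. frechet_derivative ?f (at (snd c x, snd d y)) (0, v))) (at (snd d y))"
    using c by (simp add: o_def)
qed

text \<open>Source of all differentiability used for translations of the group, orbit maps and the
  maps \<open>act a\<close>: they are partial maps of the multiplication and of the action.\<close>

lemma slice_mdiff:
  assumes "smooth_manifold A" "smooth_manifold B" "smooth_manifold C"
    and F: "smooth_map (prod_atlas A B) C F"
  shows "mdiff A C (\<lambda>a. F (a, y)) x" "mdiff B C (\<lambda>b. F (x, b)) y"
proof -
  interpret A: smooth_manifold A by fact
  interpret B: smooth_manifold B by fact
  obtain c d where cd: "c \<in> charts_at A x" "d \<in> charts_at B y" using A.covering B.covering by blast
  have F_cont: "continuous_on UNIV F" using F unfolding smooth_map_def by blast
  have "continuous_on UNIV (\<lambda>a. F (a, y))" "continuous_on UNIV (\<lambda>b. F (x, b))"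
    by (intro continuous_on_compose2[OF F_cont] continuous_intros subset_UNIV)+
  then have "isCont (\<lambda>a. F (a, y)) x" "isCont (\<lambda>b. F (x, b)) y"
    by (auto simp: continuous_on_eq_continuous_at)
  then show "mdiff A C (\<lambda>a. F (a, y)) x" "mdiff B C (\<lambda>b. F (x, b)) y"
    unfolding mdiff_def differentiable_def
    using slice_has_derivative(1)[OF assms _ cd(2)] slice_has_derivative(2)[OF assms cd(1)] by blast+
qed

section \<open>Reparametrized velocities; integral curves and their uniqueness\<close>

lemma (in smooth_manifold) smooth_manifold_A: "smooth_manifold A"
  by (rule smooth_manifold_axioms)

lemma (in smooth_manifold) has_velocity_cong:
  assumes "has_velocity A \<gamma> t v" "eventually (\<lambda>s. \<gamma> s = \<gamma>' s) (nhds t)"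
  shows "has_velocity A \<gamma>' t v"
proof -
  have eq: "\<gamma>' t = \<gamma> t" using eventually_nhds_x_imp_x[OF assms(2)] by simp
  obtain c where c: "c \<in> charts_at A (\<gamma> t)" using covering by blast
  have "isCont \<gamma>' t"
    using assms isCont_cong[OF assms(2)] by (simp add: has_velocity_def)
  moreover have "((snd c \<circ> \<gamma>') has_vector_derivative v c) (at t)"
  proof -
    have "eventually (\<lambda>s. (snd c \<circ> \<gamma>) s = (snd c \<circ> \<gamma>') s) (nhds t)"
      using assms(2) by eventually_elim simp
    then show ?thesis
      using has_velocity_chart[OF assms(1) c] eq
        has_vector_derivative_cong_ev[where x=t and S=UNIV and f="snd c \<circ> \<gamma>" and g="snd c \<circ> \<gamma>'"]
      by simp
  qed
  ultimately show ?thesis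
    using assms(1) c eq by (intro has_velocityI[of c]) (simp_all add: has_velocity_def)
qed

lemma (in smooth_manifold) has_velocity_reparam:
  assumes "has_velocity A \<gamma> (r * t + b) v"
  shows "has_velocity A (\<lambda>s. \<gamma> (r * s + b)) t (r *\<^sub>R v)"
proof -
  obtain c where c: "c \<in> charts_at A (\<gamma> (r * t + b))" using covering by blast
  have "isCont (\<lambda>s. \<gamma> (r * s + b)) t"
    using assms by (intro isCont_o2[of t "\<lambda>s. r * s + b" \<gamma>]) (auto simp: has_velocity_def)
  moreover have "((snd c \<circ> (\<lambda>s. \<gamma> (r * s + b))) has_vector_derivative (r *\<^sub>R v) c) (at t)"
  proof -
    have "((\<lambda>s. r * s + b) has_vector_derivative r) (at t)"
      by (auto intro!: derivative_eq_intros simp: has_vector_derivative_def)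
    from vector_diff_chain_at[OF this has_velocity_chart[OF assms c]]
    show ?thesis by (simp add: o_def scaleR_fun_def)
  qed
  ultimately show ?thesis
    using assms c
    by (intro has_velocityI[of c]) (simp_all add: has_velocity_def subspace_scale[OF tangent_space_subspace])
qed

lemma (in smooth_manifold) smooth_vfield_chart:
  "smooth_vfield A X \<Longrightarrow> c \<in> A \<Longrightarrow> times_differentiable_on n (\<lambda>y. X (chart_inv c y) c) (snd c ` fst c)"
  unfolding smooth_vfield_def smooth_on_def by blast

lemma (in smooth_manifold) integral_curves_eventually_eq:
  assumes X: "smooth_vfield A X" and I: "open I" "t0 \<in> I"
    and 1: "\<And>t. t \<in> I \<Longrightarrow> has_velocity A \<gamma>1 t (X (\<gamma>1 t))"
    and 2: "\<And>t. t \<in> I \<Longrightarrow> has_velocity A \<gamma>2 t (X (\<gamma>2 t))"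
    and eq: "\<gamma>2 t0 = \<gamma>1 t0"
  shows "eventually (\<lambda>t. \<gamma>1 t = \<gamma>2 t) (nhds t0)"
proof -
  obtain c where c: "c \<in> charts_at A (\<gamma>1 t0)" using covering by blast
  have cA: "c \<in> A" and x: "snd c (\<gamma>1 t0) \<in> snd c ` fst c" using c by (auto simp: charts_at_def)
  have "isCont \<gamma>1 t0" "isCont \<gamma>2 t0" using 1 2 I by (auto simp: has_velocity_def)
  then have "eventually (\<lambda>t. c \<in> charts_at A (\<gamma>1 t)) (nhds t0)" "eventually (\<lambda>t. c \<in> charts_at A (\<gamma>2 t)) (nhds t0)"
    using charts_at_eventually[of c \<gamma>1 t0] charts_at_eventually[of c \<gamma>2 t0] c eq by simp_all
  moreover have "eventually (\<lambda>t. t \<in> I) (nhds t0)" using I by (rule eventually_nhds_in_open)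
  ultimately have ev: "eventually (\<lambda>t. c \<in> charts_at A (\<gamma>1 t) \<and> c \<in> charts_at A (\<gamma>2 t) \<and> t \<in> I) (nhds t0)"
    by (simp add: eventually_conj)
  then obtain d where d: "d > 0" "\<And>t. t \<in> ball t0 d \<Longrightarrow> c \<in> charts_at A (\<gamma>1 t) \<and> c \<in> charts_at A (\<gamma>2 t) \<and> t \<in> I"
    unfolding eventually_nhds_metric by (auto simp: dist_commute)
  have d1: "((snd c \<circ> \<gamma>1) has_vector_derivative X (chart_inv c ((snd c \<circ> \<gamma>1) t)) c) (at t)"
    and d2: "((snd c \<circ> \<gamma>2) has_vector_derivative X (chart_inv c ((snd c \<circ> \<gamma>2) t)) c) (at t)"
    if "t \<in> ball t0 d" for t
    using has_velocity_chart[OF 1] has_velocity_chart[OF 2] d(2)[OF that] by simp_all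
  have x': "(snd c \<circ> \<gamma>1) t0 \<in> snd c ` fst c" and eq': "(snd c \<circ> \<gamma>2) t0 = (snd c \<circ> \<gamma>1) t0"
    using x eq by simp_all
  obtain e where e: "e > 0" "\<And>t. t \<in> ball t0 e \<Longrightarrow> (snd c \<circ> \<gamma>1) t = (snd c \<circ> \<gamma>2) t"
    using ode_local_unique[OF is_chart_open(2)[OF is_chart[OF cA]] x' smooth_vfield_chart[OF X cA] d(1) d1 d2 eq']
    by metis
  have "eventually (\<lambda>t. t \<in> ball t0 e) (nhds t0)" using e by (intro eventually_nhds_in_open) auto
  then show ?thesis
    using ev
  proof eventually_elim
    case (elim t)
    then have "snd c (\<gamma>1 t) = snd c (\<gamma>2 t)" using e(2)[of t] by simp
    moreover have "chart_inv c (snd c (\<gamma>1 t)) = \<gamma>1 t" "chart_inv c (snd c (\<gamma>2 t)) = \<gamma>2 t"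
      using elim(2) chart_inv_chart by blast+
    ultimately show ?case by metis
  qed
qed

text \<open>The times of agreement form an open set by local uniqueness, the times of disagreement
  by the Hausdorff property; the connected \<open>I\<close> cannot meet both.\<close>

lemma (in smooth_manifold) integral_curves_eq:
  assumes X: "smooth_vfield A X" and I: "open I" "connected I" "t0 \<in> I"
    and 1: "\<And>t. t \<in> I \<Longrightarrow> has_velocity A \<gamma>1 t (X (\<gamma>1 t))"
    and 2: "\<And>t. t \<in> I \<Longrightarrow> has_velocity A \<gamma>2 t (X (\<gamma>2 t))"
    and eq: "\<gamma>1 t0 = \<gamma>2 t0" and t: "t \<in> I"
  shows "\<gamma>1 t = \<gamma>2 t"
proof (rule ccontr)
  assume neq: "\<gamma>1 t \<noteq> \<gamma>2 t"
  let ?U = "{t \<in> I. \<gamma>1 t = \<gamma>2 t}" and ?V = "{t \<in> I. \<gamma>1 t \<noteq> \<gamma>2 t}"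
  have "open ?U"
    unfolding open_subopen[of ?U]
  proof
    fix s assume s: "s \<in> ?U"
    have "eventually (\<lambda>t. \<gamma>1 t = \<gamma>2 t) (nhds s)"
      by (rule integral_curves_eventually_eq[OF X I(1) _ 1 2]) (use s in auto)
    moreover have "eventually (\<lambda>t. t \<in> I) (nhds s)" using I s by (intro eventually_nhds_in_open) auto
    ultimately have "eventually (\<lambda>t. t \<in> ?U) (nhds s)" by eventually_elim simp
    then show "\<exists>T. open T \<and> s \<in> T \<and> T \<subseteq> ?U" unfolding eventually_nhds by blast
  qed
  moreover have "open ?V"
  proof -
    have "continuous_on I \<gamma>1" "continuous_on I \<gamma>2"
      using 1 2 by (auto simp: has_velocity_def intro!: continuous_at_imp_continuous_on)
    then have "continuous_on I (\<lambda>t. (\<gamma>1 t, \<gamma>2 t))" by (rule continuous_on_Pair)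
    then have "open (I \<inter> (\<lambda>t. (\<gamma>1 t, \<gamma>2 t)) -` {(x, y). x \<noteq> y})"
      using I(1) open_diagonal_complement
      by (intro continuous_open_preimage) (auto simp: case_prod_unfold)
    also have "I \<inter> (\<lambda>t. (\<gamma>1 t, \<gamma>2 t)) -` {(x, y). x \<noteq> y} = ?V" by auto
    finally show ?thesis .
  qed
  ultimately show False
    using connectedD[OF I(2), of ?U ?V] I(3) t eq neq by blast
qed

lemma (in smooth_manifold) tangent_map_id:
  assumes v: "v \<in> tangent_space A x"
  shows "tangent_map A A (\<lambda>x. x) x v = v"
proof -
  interpret AA: manifold_pair A A by unfold_locales
  obtain c where c: "c \<in> charts_at A x" using covering by blast
  have m: "mdiff A A (\<lambda>x. x) x"
    unfolding mdiff_def o_def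
    using transition_has_derivative unfolding o_def differentiable_def by (intro conjI continuous_ident) blast
  show ?thesis
    by (rule tangent_eqI[OF AA.tangent_map_in[OF m] v c])
      (use AA.tangent_map_chart[OF m v c c] transition_derivative_id[OF c] in \<open>simp add: o_def\<close>)
qed

section \<open>Linearity and antisymmetry of the bracket of vector fields\<close>

context smooth_manifold begin

lemma vfield_bracket_anti: "vfield_bracket A Y X = - vfield_bracket A X Y"
  by (intro ext) (simp add: vfield_bracket_def)

lemma smooth_vfield_has_derivative:
  assumes X: "smooth_vfield A X" and c: "c \<in> charts_at A x"
  shows "((\<lambda>y. X (chart_inv c y) c) has_derivative
    frechet_derivative (\<lambda>y. X (chart_inv c y) c) (at (snd c x))) (at (snd c x))"
  using smooth_vfield_chart[OF X charts_atD(1)[OF c], of 1] c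
  by (auto simp: frechet_derivative_works[symmetric] charts_at_def)

lemma vfield_bracket_add:
  assumes "smooth_vfield A X" "smooth_vfield A Y" "smooth_vfield A W"
  shows "vfield_bracket A X (Y + W) = vfield_bracket A X Y + vfield_bracket A X W"
proof (intro ext)
  fix x c
  show "vfield_bracket A X (Y + W) x c = (vfield_bracket A X Y + vfield_bracket A X W) x c"
  proof (cases "c \<in> charts_at A x")
    case True
    note d = smooth_vfield_has_derivative[OF assms(1) True] smooth_vfield_has_derivative[OF assms(2) True]
      smooth_vfield_has_derivative[OF assms(3) True]
    have "frechet_derivative (\<lambda>y. (Y + W) (chart_inv c y) c) (at (snd c x)) =
      (\<lambda>v. frechet_derivative (\<lambda>y. Y (chart_inv c y) c) (at (snd c x)) v
        + frechet_derivative (\<lambda>y. W (chart_inv c y) c) (at (snd c x)) v)"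
      using frechet_derivative_at[OF has_derivative_add[OF d(2,3)]] by simp
    then show ?thesis
      using True linear_add[OF has_derivative_linear[OF d(1)]] by (simp add: vfield_bracket_def)
  qed (simp add: vfield_bracket_def)
qed

lemma vfield_bracket_scale:
  assumes "smooth_vfield A X" "smooth_vfield A Y"
  shows "vfield_bracket A X (r *\<^sub>R Y) = r *\<^sub>R vfield_bracket A X Y"
proof (intro ext)
  fix x c
  have s: "(r *\<^sub>R f) x = r *\<^sub>R f x" for f :: "'x \<Rightarrow> 'y::real_vector" and x
    by (simp add: scaleR_fun_def)
  show "vfield_bracket A X (r *\<^sub>R Y) x c = (r *\<^sub>R vfield_bracket A X Y) x c"
  proof (cases "c \<in> charts_at A x")
    case True
    note d = smooth_vfield_has_derivative[OF assms(1) True] smooth_vfield_has_derivative[OF assms(2) True]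
    have "frechet_derivative (\<lambda>y. (r *\<^sub>R Y) (chart_inv c y) c) (at (snd c x)) =
      (\<lambda>v. r *\<^sub>R frechet_derivative (\<lambda>y. Y (chart_inv c y) c) (at (snd c x)) v)"
      using frechet_derivative_at[OF has_derivative_scaleR_right[OF d(2)]] by (simp add: s)
    then show ?thesis
      using True linear_scale[OF has_derivative_linear[OF d(1)]]
      by (simp add: vfield_bracket_def s scaleR_diff_right)
  qed (simp add: vfield_bracket_def s)
qed

end

section \<open>Lie groups\<close>

context lie_group begin

lemma in_carrier [simp]: "x \<in> carrier G"
  by (simp add: carrier_UNIV)

sublocale AA: manifold_pair A A
  by unfold_locales

lemma mult_mdiff: "mdiff A A (\<lambda>b. a \<otimes> b) x" "mdiff A A (\<lambda>b. b \<otimes> a) x"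
  using slice_mdiff[OF smooth_manifold_A smooth_manifold_A smooth_manifold_A smooth_mult] by simp_all

lemma lie_algebraD:
  assumes "X \<in> lie_algebra G A"
  shows "smooth_vfield A X" "X a \<in> tangent_space A a"
    "tangent_map A A (\<lambda>b. a \<otimes> b) b (X b) = X (a \<otimes> b)"
  using assms by (auto simp: lie_algebra_def smooth_vfield_def)

lemma lie_algebra_at:
  assumes "X \<in> lie_algebra G A"
  shows "X a = tangent_map A A (\<lambda>b. a \<otimes> b) \<one> (X \<one>)"
  using lie_algebraD(3)[OF assms, of a \<one>] by simp

lemma lie_algebra_subspace: "subspace (lie_algebra G A)"
proof (rule subspaceI)
  have op: "open (snd c ` fst c)" if "c \<in> A" for c by (rule is_chart_open(2)[OF is_chart[OF that]])
  have s: "(r *\<^sub>R f) x = r *\<^sub>R f x" for r and f :: "'x \<Rightarrow> 'y::real_vector" and x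
    by (simp add: scaleR_fun_def)
  have "tangent_map A A (\<lambda>b. a \<otimes> b) b 0 = 0" for a b
    using AA.tangent_map_scale[OF mult_mdiff(1)[of a b] subspace_0[OF tangent_space_subspace], of 0] by simp
  then show "0 \<in> lie_algebra G A"
    by (auto simp: lie_algebra_def smooth_vfield_def smooth_on_def times_differentiable_on_zero subspace_0[OF tangent_space_subspace])
  show "X + Y \<in> lie_algebra G A" if X: "X \<in> lie_algebra G A" and Y: "Y \<in> lie_algebra G A" for X Y
  proof -
    have "smooth_on (\<lambda>y. (X + Y) (chart_inv c y) c) (snd c ` fst c)" if "c \<in> A" for c
      unfolding smooth_on_def plus_fun_apply
      using smooth_vfield_chart[OF lie_algebraD(1)[OF X] that] smooth_vfield_chart[OF lie_algebraD(1)[OF Y] that]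
      by (intro allI times_differentiable_on_add op that)
    moreover have "tangent_map A A (\<lambda>b. a \<otimes> b) b ((X + Y) b) = (X + Y) (a \<otimes> b)" for a b
      using AA.tangent_map_add[OF mult_mdiff(1)[of a b] lie_algebraD(2)[OF X, of b] lie_algebraD(2)[OF Y, of b]]
        lie_algebraD(3)[OF X, of a b] lie_algebraD(3)[OF Y, of a b] by simp
    ultimately show ?thesis
      using lie_algebraD(2)[OF X] lie_algebraD(2)[OF Y]
      unfolding lie_algebra_def smooth_vfield_def by (simp add: subspace_add[OF tangent_space_subspace])
  qed
  show "r *\<^sub>R X \<in> lie_algebra G A" if X: "X \<in> lie_algebra G A" for X r
  proof -
    have "smooth_on (\<lambda>y. (r *\<^sub>R X) (chart_inv c y) c) (snd c ` fst c)" if "c \<in> A" for c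
      unfolding smooth_on_def s
      using smooth_vfield_chart[OF lie_algebraD(1)[OF X] that]
      by (intro allI times_differentiable_on_scaleR op that)
    moreover have "tangent_map A A (\<lambda>b. a \<otimes> b) b ((r *\<^sub>R X) b) = (r *\<^sub>R X) (a \<otimes> b)" for a b
      using AA.tangent_map_scale[OF mult_mdiff(1)[of a b] lie_algebraD(2)[OF X, of b], of r]
        lie_algebraD(3)[OF X, of a b] by (simp add: s)
    ultimately show ?thesis
      using lie_algebraD(2)[OF X]
      unfolding lie_algebra_def smooth_vfield_def by (simp add: subspace_scale[OF tangent_space_subspace] s)
  qed
qed

definition left_field :: "('g, 'd) tangent \<Rightarrow> ('g, 'd) vfield" where
  "left_field u = (\<lambda>a. tangent_map A A (\<lambda>b. a \<otimes> b) \<one> u)"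

definition mu :: "('g, 'd) chart \<Rightarrow> ('g, 'd) chart \<Rightarrow> ('g, 'd) chart \<Rightarrow> 'd \<times> 'd \<Rightarrow> 'd" where
  "mu c d e = (\<lambda>z. snd e (chart_inv c (fst z) \<otimes> chart_inv d (snd z)))"

definition mu_dom :: "('g, 'd) chart \<Rightarrow> ('g, 'd) chart \<Rightarrow> ('g, 'd) chart \<Rightarrow> ('d \<times> 'd) set" where
  "mu_dom c d e = map_dom c d (\<lambda>(a, b). a \<otimes> b) (fst e)"

lemma mu_smooth:
  assumes "c \<in> A" "d \<in> A" "e \<in> A"
  shows "open (mu_dom c d e)" "times_differentiable_on n (mu c d e) (mu_dom c d e)"
  using prod_smooth_map[OF smooth_manifold_A smooth_manifold_A smooth_manifold_A smooth_mult assms]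
  by (simp_all add: mu_def[abs_def] mu_dom_def smooth_on_def)

lemma mu_dom_iff:
  "c \<in> charts_at A x \<Longrightarrow> d \<in> charts_at A y \<Longrightarrow>
    (snd c x, snd d y) \<in> mu_dom c d e \<longleftrightarrow> x \<otimes> y \<in> fst e"
  by (auto simp: mu_dom_def map_dom_def dest: charts_atD)

lemma mu_slice_derivative:
  assumes "c \<in> charts_at A x" "d \<in> charts_at A y" "e \<in> charts_at A (x \<otimes> y)"
  shows "frechet_derivative (snd e \<circ> (\<lambda>a. a \<otimes> y) \<circ> chart_inv c) (at (snd c x))
      = (\<lambda>v. frechet_derivative (mu c d e) (at (snd c x, snd d y)) (v, 0))"
    and "frechet_derivative (snd e \<circ> (\<lambda>b. x \<otimes> b) \<circ> chart_inv d) (at (snd d y))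
      = (\<lambda>v. frechet_derivative (mu c d e) (at (snd c x, snd d y)) (0, v))"
  using slice_has_derivative[OF smooth_manifold_A smooth_manifold_A smooth_manifold_A smooth_mult assms(1,2), of e] assms(3)
  by (auto simp: mu_def[abs_def] dest: frechet_derivative_at)

lemma left_field_chart:
  assumes u: "u \<in> tangent_space A \<one>" and c: "c \<in> charts_at A a" and d: "d \<in> charts_at A \<one>"
    and e: "e \<in> charts_at A a"
  shows "left_field u a e = frechet_derivative (mu c d e) (at (snd c a, snd d \<one>)) (0, u d)"
  using AA.tangent_map_chart[OF mult_mdiff(1) u d, of e a] mu_slice_derivative(2)[OF c d, of e] e
  by (simp add: left_field_def)

text \<open>In a chart the field is the partial derivative of the multiplication in the second
  factor, taken at the identity, hence smooth in the first factor. Invariance is the chain rule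
  applied to associativity.\<close>

lemma left_field_in:
  assumes u: "u \<in> tangent_space A \<one>"
  shows "left_field u \<in> lie_algebra G A"
proof -
  have T: "left_field u a \<in> tangent_space A a" for a
    using AA.tangent_map_in[OF mult_mdiff(1)[of a \<one>], of u] by (simp add: left_field_def)
  obtain d where d: "d \<in> charts_at A \<one>" using covering by blast
  have dA: "d \<in> A" using d by (rule charts_atD)
  have "times_differentiable_on n (\<lambda>y. left_field u (chart_inv c y) c) (snd c ` fst c)" if c: "c \<in> A" for c n
  proof -
    have dom: "(y, snd d \<one>) \<in> mu_dom c d c" if "y \<in> snd c ` fst c" for y
      using mu_dom_iff[of c "chart_inv c y" d \<one> c] chart_inv_charts_at[OF c that] chart_chart_inv[OF c that]
        chart_inv_in[OF c that] d by simp
    \<comment> \<open>The partial derivative costs one order of differentiability, whence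
      \<open>Suc n\<close> for the multiplication.\<close>
    have "times_differentiable_on n (\<lambda>z. frechet_derivative (mu c d c) (at z) (0, u d)) (mu_dom c d c)"
      using mu_smooth(2)[OF c dA c, of "Suc n"] by simp
    from times_differentiable_on_slice[OF mu_smooth(1)[OF c dA c] this, of "snd d \<one>"]
    have "times_differentiable_on n (\<lambda>y. frechet_derivative (mu c d c) (at (y, snd d \<one>)) (0, u d)) (snd c ` fst c)"
      by (rule times_differentiable_on_subset) (use dom in auto)
    then show ?thesis
      by (rule times_differentiable_on_cong[OF is_chart_open(2)[OF is_chart[OF c]], rotated])
        (use left_field_chart[OF u chart_inv_charts_at[OF c] d chart_inv_charts_at[OF c]] chart_chart_inv[OF c] in simp)
  qed
  then have "smooth_vfield A (left_field u)"
    using T by (simp add: smooth_vfield_def smooth_on_def)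
  moreover have "tangent_map A A (\<lambda>b. a \<otimes> b) b (left_field u b) = left_field u (a \<otimes> b)" for a b
  proof -
    have "(\<lambda>x. a \<otimes> (b \<otimes> x)) = (\<lambda>x. a \<otimes> b \<otimes> x)" by (simp add: m_assoc)
    then show ?thesis
      using tangent_map_comp[OF smooth_manifold_A smooth_manifold_A smooth_manifold_A mult_mdiff(1)[of b \<one>] mult_mdiff(1)[of a] u]
      by (simp add: left_field_def)
  qed
  ultimately show ?thesis by (simp add: lie_algebra_def)
qed

lemma left_field_one:
  assumes u: "u \<in> tangent_space A \<one>"
  shows "left_field u \<one> = u"
proof -
  obtain d where d: "d \<in> charts_at A \<one>" using covering by blast
  have eq: "(\<lambda>b. \<one> \<otimes> b) = (\<lambda>b. b)" by simp
  have "left_field u \<one> \<in> tangent_space A \<one>" using lie_algebraD(2)[OF left_field_in[OF u]] .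
  moreover have "left_field u \<one> d = u d"
    using AA.tangent_map_chart[OF mult_mdiff(1)[of \<one> \<one>] u d, of d] d transition_derivative_id[OF d]
    unfolding left_field_def eq by (simp add: o_def)
  ultimately show ?thesis using u d by (metis tangent_eqI)
qed

section \<open>One-parameter subgroups and the exponential map\<close>

lemma velocity_translate:
  assumes "X \<in> lie_algebra G A" "has_velocity A \<gamma> t (X (\<gamma> t))"
  shows "has_velocity A (\<lambda>s. a \<otimes> \<gamma> s) t (X (a \<otimes> \<gamma> t))"
  using AA.velocity_map[OF mult_mdiff(1) assms(2), of a] lie_algebraD(3)[OF assms(1), of a "\<gamma> t"]
  by (simp add: o_def)

lemma local_integral_curve:
  assumes X: "X \<in> lie_algebra G A"
  obtains \<delta> \<gamma> where "\<delta> > 0" "\<gamma> 0 = \<one>" "\<And>t. \<bar>t\<bar> < \<delta> \<Longrightarrow> has_velocity A \<gamma> t (X (\<gamma> t))"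
proof -
  obtain c where c: "c \<in> charts_at A \<one>" using covering by blast
  have cA: "c \<in> A" and x: "snd c \<one> \<in> snd c ` fst c" using c by (auto simp: charts_at_def)
  obtain \<delta> y where \<delta>: "\<delta> > 0" and y0: "y 0 = snd c \<one>" and
    y: "\<And>t. t \<in> {-\<delta><..<\<delta>} \<Longrightarrow> y t \<in> snd c ` fst c \<and> (y has_vector_derivative X (chart_inv c (y t)) c) (at t)"
    using ode_solution[OF is_chart_open(2)[OF is_chart[OF cA]] x smooth_vfield_chart[OF lie_algebraD(1)[OF X] cA]] by metis
  show ?thesis
  proof (rule that[of \<delta> "\<lambda>t. chart_inv c (y t)"])
    show "chart_inv c (y 0) = \<one>" using c by (simp add: y0)
    fix t assume "\<bar>t\<bar> < \<delta>"
    then have t: "t \<in> {-\<delta><..<\<delta>}" by auto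
    note yt = y[OF t]
    show "has_velocity A (\<lambda>t. chart_inv c (y t)) t (X (chart_inv c (y t)))"
    proof (rule has_velocityI[of c])
      show "c \<in> charts_at A (chart_inv c (y t))" using yt chart_inv_charts_at[OF cA] by simp
      show "isCont (\<lambda>t. chart_inv c (y t)) t"
        using yt has_vector_derivative_continuous chart_inv_isCont[OF cA]
        by (intro isCont_o2[of t y "chart_inv c"]) auto
      show "((snd c \<circ> (\<lambda>t. chart_inv c (y t))) has_vector_derivative X (chart_inv c (y t)) c) (at t)"
        by (rule has_vector_derivative_transform_within_open[of y _ _ "{-\<delta><..<\<delta>}"])
          (use t yt y chart_chart_inv[OF cA] in auto)
    qed (use lie_algebraD(2)[OF X] in simp)
  qed (rule \<delta>)
qed

text \<open>For fixed \<open>s\<close> both sides are integral curves in \<open>t\<close> that start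
  at \<open>\<gamma> s\<close>, the right one by left invariance. They are compared where both
  \<open>t\<close> and \<open>s + t\<close> are admissible times, an intersection of two intervals
  around 0.\<close>

lemma local_integral_curve_mult:
  assumes X: "X \<in> lie_algebra G A" and \<gamma>0: "\<gamma> 0 = \<one>"
    and \<gamma>: "\<And>t. \<bar>t\<bar> < \<delta> \<Longrightarrow> has_velocity A \<gamma> t (X (\<gamma> t))"
    and st: "\<bar>s\<bar> < \<delta>" "\<bar>t\<bar> < \<delta>" "\<bar>s + t\<bar> < \<delta>"
  shows "\<gamma> (s + t) = \<gamma> s \<otimes> \<gamma> t"
proof (rule integral_curves_eq[OF lie_algebraD(1)[OF X], of "{-\<delta><..<\<delta>} \<inter> {-\<delta>-s<..<\<delta>-s}" 0])
  have "convex ({-\<delta><..<\<delta>} \<inter> {-\<delta>-s<..<\<delta>-s})" by (intro convex_Int) auto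
  then show "connected ({-\<delta><..<\<delta>} \<inter> {-\<delta>-s<..<\<delta>-s})" by (rule convex_connected)
  fix t assume t: "t \<in> {-\<delta><..<\<delta>} \<inter> {-\<delta>-s<..<\<delta>-s}"
  show "has_velocity A (\<lambda>t. \<gamma> (s + t)) t (X (\<gamma> (s + t)))"
    using has_velocity_reparam[of \<gamma> 1 t s] \<gamma>[of "s + t"] t by (auto simp: add.commute)
  show "has_velocity A (\<lambda>t. \<gamma> s \<otimes> \<gamma> t) t (X (\<gamma> s \<otimes> \<gamma> t))"
    by (rule velocity_translate[OF X \<gamma>]) (use t in auto)
qed (use st \<gamma>0 in auto)

text \<open>The local curve is extended by group powers: the value at \<open>t\<close> is the power
  \<open>2 ^ m\<close> of the value at \<open>t / 2 ^ m\<close>, for \<open>m\<close> large enough.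
  The extension is a homomorphism, so its velocity has to be known only at time 0.\<close>

lemma global_integral_curve:
  assumes X: "X \<in> lie_algebra G A"
  obtains \<gamma> where "\<gamma> 0 = \<one>" "\<And>t. has_velocity A \<gamma> t (X (\<gamma> t))"
proof -
  obtain \<delta> \<gamma> where \<delta>: "\<delta> > 0" and \<gamma>0: "\<gamma> 0 = \<one>" and
    \<gamma>: "\<And>t. \<bar>t\<bar> < \<delta> \<Longrightarrow> has_velocity A \<gamma> t (X (\<gamma> t))"
    using local_integral_curve[OF X] by metis
  have mult: "\<gamma> (s + t) = \<gamma> s \<otimes> \<gamma> t" if "\<bar>s\<bar> < \<delta>" "\<bar>t\<bar> < \<delta>" "\<bar>s + t\<bar> < \<delta>" for s t
    by (rule local_integral_curve_mult[where X=X and \<delta>=\<delta>]) (use X \<gamma>0 \<gamma> that in simp_all)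
  \<comment> \<open>Needed to split the power of a product in the proof of
    \<open>\<Gamma>_add\<close>.\<close>
  have comm: "\<gamma> s \<otimes> \<gamma> t = \<gamma> t \<otimes> \<gamma> s" if "\<bar>s\<bar> < \<delta>" "\<bar>t\<bar> < \<delta>" "\<bar>s + t\<bar> < \<delta>" for s t
    using mult[of s t] mult[of t s] that by (simp add: add.commute)
  have double: "\<gamma> (t / 2 ^ m) [^] ((2::nat) ^ m) = \<gamma> t" if "\<bar>t\<bar> < \<delta>" for t m
  proof (induction m)
    case (Suc m)
    have "\<bar>t\<bar> / 2 ^ m \<le> \<bar>t\<bar>" by (simp add: divide_le_eq mult_le_cancel_left1)
    then have small: "\<bar>t / 2 ^ m\<bar> < \<delta>" using that by simp
    have "\<gamma> (t / 2 ^ Suc m) [^] (2::nat) = \<gamma> (t / 2 ^ Suc m) \<otimes> \<gamma> (t / 2 ^ Suc m)"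
      by (simp add: numeral_2_eq_2)
    also have "\<dots> = \<gamma> (t / 2 ^ m)"
      using mult[of "t / 2 ^ Suc m" "t / 2 ^ Suc m"] small by (simp add: field_simps)
    finally have "\<gamma> (t / 2 ^ Suc m) [^] ((2::nat) ^ Suc m) = \<gamma> (t / 2 ^ m) [^] ((2::nat) ^ m)"
      using nat_pow_pow[of "\<gamma> (t / 2 ^ Suc m)" 2 "2 ^ m"] by simp
    then show ?case using Suc by simp
  qed simp
  \<comment> \<open>\<open>LEAST\<close> merely fixes some exponent that brings the time below
    \<open>\<delta>\<close>; by \<open>double\<close> every larger one gives the same value.\<close>
  define \<Gamma> where "\<Gamma> t = (let m = (LEAST m. \<bar>t\<bar> / 2 ^ m < \<delta>) in \<gamma> (t / 2 ^ m) [^] ((2::nat) ^ m))" for t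
  have ex: "eventually (\<lambda>m. \<bar>t\<bar> / 2 ^ m < \<delta>) sequentially" for t
  proof -
    have "(\<lambda>m. \<bar>t\<bar> * (1 / 2) ^ m) \<longlonglongrightarrow> \<bar>t\<bar> * 0"
      by (intro tendsto_intros LIMSEQ_power_zero) simp
    then have "(\<lambda>m. \<bar>t\<bar> / 2 ^ m) \<longlonglongrightarrow> 0" by (simp add: power_one_over field_simps)
    from order_tendstoD(2)[OF this \<delta>] show ?thesis .
  qed
  have \<Gamma>: "\<Gamma> t = \<gamma> (t / 2 ^ m) [^] ((2::nat) ^ m)" if m: "\<bar>t\<bar> / 2 ^ m < \<delta>" for t m
  proof -
    define n where "n = (LEAST m. \<bar>t\<bar> / 2 ^ m < \<delta>)"
    have n: "\<bar>t\<bar> / 2 ^ n < \<delta>" "n \<le> m" unfolding n_def using m by (auto intro: LeastI Least_le)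
    have "\<gamma> (t / 2 ^ m) [^] ((2::nat) ^ m) = (\<gamma> (t / 2 ^ n / 2 ^ (m - n)) [^] ((2::nat) ^ (m - n))) [^] ((2::nat) ^ n)"
      using n(2) by (simp add: nat_pow_pow power_add[symmetric] divide_divide_eq_left)
    also have "\<dots> = \<gamma> (t / 2 ^ n) [^] ((2::nat) ^ n)" using double[of "t / 2 ^ n"] n(1) by simp
    finally show ?thesis by (simp add: \<Gamma>_def n_def[symmetric] Let_def)
  qed
  have \<Gamma>_local: "\<Gamma> t = \<gamma> t" if "\<bar>t\<bar> < \<delta>" for t using \<Gamma>[of t 0] that by simp
  have \<Gamma>_add: "\<Gamma> (s + t) = \<Gamma> s \<otimes> \<Gamma> t" for s t
  proof -
    \<comment> \<open>One exponent that serves all three times.\<close>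
    obtain m where m: "\<bar>s\<bar> / 2 ^ m < \<delta>" "\<bar>t\<bar> / 2 ^ m < \<delta>" "\<bar>s + t\<bar> / 2 ^ m < \<delta>"
      using eventually_happens'[OF sequentially_bot eventually_conj[OF ex[of s] eventually_conj[OF ex[of t] ex[of "s + t"]]]]
      by blast
    let ?s = "s / 2 ^ m" and ?t = "t / 2 ^ m"
    have st: "\<bar>?s\<bar> < \<delta>" "\<bar>?t\<bar> < \<delta>" "\<bar>?s + ?t\<bar> < \<delta>" using m by (simp_all add: add_divide_distrib[symmetric])
    have "\<Gamma> (s + t) = \<gamma> (?s + ?t) [^] ((2::nat) ^ m)" using \<Gamma>[OF m(3)] by (simp add: add_divide_distrib)
    also have "\<dots> = (\<gamma> ?s \<otimes> \<gamma> ?t) [^] ((2::nat) ^ m)" using mult[OF st] by simp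
    also have "\<dots> = \<gamma> ?s [^] ((2::nat) ^ m) \<otimes> \<gamma> ?t [^] ((2::nat) ^ m)"
      using pow_mult_distrib[OF comm[OF st]] by simp
    finally show ?thesis using \<Gamma> m by simp
  qed
  show ?thesis
  proof (rule that[of \<Gamma>])
    show "\<Gamma> 0 = \<one>" using \<Gamma>_local[of 0] \<delta> \<gamma>0 by simp
    fix t
    have "eventually (\<lambda>s. s \<in> ball 0 \<delta>) (nhds (0::real))" using \<delta> by (intro eventually_nhds_in_open) auto
    then have "eventually (\<lambda>s. \<gamma> s = \<Gamma> s) (nhds 0)"
      by eventually_elim (simp add: \<Gamma>_local)
    then have "has_velocity A \<Gamma> 0 (X (\<Gamma> 0))"
      using has_velocity_cong[OF \<gamma>[of 0]] \<delta> \<Gamma>_local[of 0] by simp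
    \<comment> \<open>By additivity the curve near \<open>t\<close> is the left translate by
      \<open>\<Gamma> t\<close> of the curve near 0.\<close>
    then have "has_velocity A (\<lambda>s. \<Gamma> t \<otimes> \<Gamma> s) 0 (X (\<Gamma> t \<otimes> \<Gamma> 0))" by (rule velocity_translate[OF X])
    \<comment> \<open>Time 0 is written as \<open>1 * t + - t\<close> to match the pattern
      \<open>r * t + b\<close> of \<open>has_velocity_reparam\<close>.\<close>
    then have "has_velocity A (\<lambda>s. \<Gamma> (t + s)) (1 * t + - t) (X (\<Gamma> t))" by (simp add: \<Gamma>_add[symmetric])
    from has_velocity_reparam[OF this] show "has_velocity A \<Gamma> t (X (\<Gamma> t))" by simp
  qed
qed

text \<open>Uniqueness of integral curves on the whole line resolves the definite
  description.\<close>

lemma lie_exp_eq: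
  assumes X: "X \<in> lie_algebra G A" and \<gamma>: "\<gamma> 0 = \<one>" "\<And>t. has_velocity A \<gamma> t (X (\<gamma> t))"
  shows "lie_exp G A X = \<gamma> 1"
proof -
  have "(THE \<gamma>. \<gamma> 0 = \<one> \<and> (\<forall>t. has_velocity A \<gamma> t (X (\<gamma> t)))) = \<gamma>"
  proof (rule the_equality)
    fix \<gamma>' assume \<gamma>': "\<gamma>' 0 = \<one> \<and> (\<forall>t. has_velocity A \<gamma>' t (X (\<gamma>' t)))"
    show "\<gamma>' = \<gamma>"
      by (rule ext, rule integral_curves_eq[OF lie_algebraD(1)[OF X], of UNIV 0])
        (use \<gamma> \<gamma>' in auto)
  qed (use \<gamma> in simp)
  then show ?thesis by (simp add: lie_exp_def)
qed

text \<open>Running the integral curve of \<open>X\<close> at speed \<open>t\<close> gives that of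
  \<open>t *\<^sub>R X\<close>, so its value at time 1 is that of the original curve at time
  \<open>t\<close>.\<close>

lemma lie_exp_curve:
  assumes X: "X \<in> lie_algebra G A"
  shows "has_velocity A (\<lambda>t. lie_exp G A (t *\<^sub>R X)) 0 (X \<one>)" "lie_exp G A (0 *\<^sub>R X) = \<one>"
proof -
  obtain \<gamma> where \<gamma>: "\<gamma> 0 = \<one>" "\<And>t. has_velocity A \<gamma> t (X (\<gamma> t))" using global_integral_curve[OF X] by metis
  have "lie_exp G A (t *\<^sub>R X) = \<gamma> (t * 1 + 0)" for t
  proof (rule lie_exp_eq[where \<gamma>="\<lambda>s. \<gamma> (t * s + 0)"])
    show "t *\<^sub>R X \<in> lie_algebra G A" using subspace_scale[OF lie_algebra_subspace X] .
    show "has_velocity A (\<lambda>s. \<gamma> (t * s + 0)) s ((t *\<^sub>R X) (\<gamma> (t * s + 0)))" for s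
      using has_velocity_reparam[where r=t and t=s and b=0, OF \<gamma>(2)] by (simp add: scaleR_fun_def)
  qed (use \<gamma> in simp)
  then have eq: "(\<lambda>t. lie_exp G A (t *\<^sub>R X)) = \<gamma>" by simp
  show "has_velocity A (\<lambda>t. lie_exp G A (t *\<^sub>R X)) 0 (X \<one>)" unfolding eq using \<gamma>(2)[of 0] \<gamma>(1) by simp
  show "lie_exp G A (0 *\<^sub>R X) = \<one>" using fun_cong[OF eq, of 0] \<gamma>(1) by simp
qed

end

section \<open>Bracket and adjoint action in a chart around the identity\<close>

context lie_group begin

lemma mu_diff2:
  assumes "c \<in> A" "d \<in> A" "e \<in> A" "p \<in> mu_dom c d e"
  shows "((\<lambda>p. frechet_derivative (mu c d e) (at p) w) has_derivative
    frechet_derivative (\<lambda>p. frechet_derivative (mu c d e) (at p) w) (at p)) (at p)"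
  using mu_smooth(2)[OF assms(1-3), of 2] assms(4)
  by (simp add: numeral_2_eq_2 frechet_derivative_works[symmetric] del: split_paired_All)

text \<open>Coordinate form of the differential at the identity of left translation by the point
  with coordinates \<open>y\<close>; \<open>right_mu\<close> belongs to right translation.\<close>

definition left_mu :: "('g, 'd) chart \<Rightarrow> 'd \<Rightarrow> 'd \<Rightarrow> 'd" where
  "left_mu c y w = frechet_derivative (mu c c c) (at (y, snd c \<one>)) (0, w)"

definition right_mu :: "('g, 'd) chart \<Rightarrow> 'd \<Rightarrow> 'd \<Rightarrow> 'd" where
  "right_mu c y w = frechet_derivative (mu c c c) (at (snd c \<one>, y)) (w, 0)"

text \<open>The bilinear mixed term in the second-order expansion of the multiplication at the
  identity.\<close>

definition mu2 :: "('g, 'd) chart \<Rightarrow> 'd \<Rightarrow> 'd \<Rightarrow> 'd" where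
  "mu2 c v w = frechet_derivative (\<lambda>p. frechet_derivative (mu c c c) (at p) (0, w))
     (at (snd c \<one>, snd c \<one>)) (v, 0)"

lemma one_mu_dom: "c \<in> charts_at A \<one> \<Longrightarrow> (snd c \<one>, snd c \<one>) \<in> mu_dom c c c"
  using mu_dom_iff[of c \<one> c \<one> c] by (simp add: charts_atD)

lemma left_mu_has_derivative:
  assumes c: "c \<in> charts_at A \<one>"
  shows "((\<lambda>y. left_mu c y w) has_derivative (\<lambda>v. mu2 c v w)) (at (snd c \<one>))"
proof -
  have cA: "c \<in> A" using c by (rule charts_atD)
  show ?thesis
    unfolding left_mu_def mu2_def
    by (rule has_derivative_compose[where f="\<lambda>y. (y, snd c \<one>)", OF _ mu_diff2[OF cA cA cA one_mu_dom[OF c]]])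
      (auto intro!: derivative_eq_intros)
qed

text \<open>Here the second factor is differentiated last, in \<open>left_mu\<close> the first one.
  Symmetry of second derivatives expresses both by the same \<open>mu2\<close>, with exchanged
  arguments.\<close>

lemma right_mu_has_derivative:
  assumes c: "c \<in> charts_at A \<one>"
  shows "((\<lambda>y. right_mu c y w) has_derivative (\<lambda>v. mu2 c w v)) (at (snd c \<one>))"
proof -
  have cA: "c \<in> A" using c by (rule charts_atD)
  have "((\<lambda>y. right_mu c y w) has_derivative
      (\<lambda>v. frechet_derivative (\<lambda>p. frechet_derivative (mu c c c) (at p) (w, 0)) (at (snd c \<one>, snd c \<one>)) (0, v)))
      (at (snd c \<one>))"
    unfolding right_mu_def
    by (rule has_derivative_compose[where f="\<lambda>y. (snd c \<one>, y)", OF _ mu_diff2[OF cA cA cA one_mu_dom[OF c]]])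
      (auto intro!: derivative_eq_intros)
  moreover have "frechet_derivative (\<lambda>p. frechet_derivative (mu c c c) (at p) (w, 0)) (at (snd c \<one>, snd c \<one>)) (0, v)
      = mu2 c w v" for v
    unfolding mu2_def
    by (rule frechet_derivative_symmetric[OF mu_smooth(1)[OF cA cA cA] one_mu_dom[OF c] mu_smooth(2)[OF cA cA cA]])
  ultimately show ?thesis by (simp only:)
qed

lemma lie_algebra_chart:
  assumes X: "X \<in> lie_algebra G A" and c: "c \<in> charts_at A \<one>" and y: "y \<in> snd c ` fst c"
  shows "X (chart_inv c y) c = left_mu c y (X \<one> c)"
proof -
  have cA: "c \<in> A" using c by (rule charts_atD)
  have "X = left_field (X \<one>)"
    by (rule ext) (simp add: left_field_def lie_algebra_at[OF X, symmetric])
  then show ?thesis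
    using left_field_chart[OF lie_algebraD(2)[OF X] chart_inv_charts_at[OF cA y] c chart_inv_charts_at[OF cA y]]
    by (simp add: left_mu_def chart_chart_inv[OF cA y])
qed

text \<open>Near the identity a left-invariant field has the coordinates
  \<open>left_mu c y w\<close>, with \<open>w\<close> its fixed value at the identity, so its
  derivative there is a slot of \<open>mu2\<close>.\<close>

lemma bracket_at_one:
  assumes X: "X \<in> lie_algebra G A" and Y: "Y \<in> lie_algebra G A" and c: "c \<in> charts_at A \<one>"
  shows "vfield_bracket A X Y \<one> c = mu2 c (X \<one> c) (Y \<one> c) - mu2 c (Y \<one> c) (X \<one> c)"
proof -
  have cA: "c \<in> A" and x: "snd c \<one> \<in> snd c ` fst c" using c by (auto simp: charts_at_def)
  have "frechet_derivative (\<lambda>y. Z (chart_inv c y) c) (at (snd c \<one>)) = (\<lambda>v. mu2 c v (Z \<one> c))"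
    if Z: "Z \<in> lie_algebra G A" for Z
  proof -
    have "frechet_derivative (\<lambda>y. Z (chart_inv c y) c) (at (snd c \<one>))
        = frechet_derivative (\<lambda>y. left_mu c y (Z \<one> c)) (at (snd c \<one>))"
      by (rule frechet_derivative_cong[OF is_chart_open(2)[OF is_chart[OF cA]] x]) (rule lie_algebra_chart[OF Z c])
    also have "\<dots> = (\<lambda>v. mu2 c v (Z \<one> c))"
      using frechet_derivative_at[OF left_mu_has_derivative[OF c]] by simp
    finally show ?thesis .
  qed
  then show ?thesis using X Y c by (simp add: vfield_bracket_def)
qed

text \<open>This is Ad(a^-1), split into right translation by \<open>a\<close> followed by left
  translation by \<open>inv a\<close>.\<close>

definition ad_inv :: "'g \<Rightarrow> ('g, 'd) tangent \<Rightarrow> ('g, 'd) tangent" where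
  "ad_inv a u = tangent_map A A (\<lambda>b. inv a \<otimes> b) a (tangent_map A A (\<lambda>b. b \<otimes> a) \<one> u)"

lemma right_tangent_in: "tangent_map A A (\<lambda>b. b \<otimes> a) \<one> u \<in> tangent_space A a"
  using AA.tangent_map_in[OF mult_mdiff(2)[of a \<one>]] by simp

lemma ad_inv_in: "ad_inv a u \<in> tangent_space A \<one>"
  using AA.tangent_map_in[OF mult_mdiff(1)[of "inv a" a]] by (simp add: ad_inv_def)

text \<open>Cancelling \<open>a\<close> against \<open>inv a\<close> leaves a linear equation for
  \<open>ad_inv a u\<close> in which no inverse occurs.\<close>

lemma left_ad_inv:
  "tangent_map A A (\<lambda>b. a \<otimes> b) \<one> (ad_inv a u) = tangent_map A A (\<lambda>b. b \<otimes> a) \<one> u"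
proof -
  have "(\<lambda>x. a \<otimes> (inv a \<otimes> x)) = (\<lambda>x. x)" by (simp add: m_assoc[symmetric])
  then show ?thesis
    using tangent_map_comp[OF smooth_manifold_A smooth_manifold_A smooth_manifold_A
        mult_mdiff(1)[of "inv a" a] mult_mdiff(1)[of a] right_tangent_in[of a u]]
      tangent_map_id[OF right_tangent_in[of a u]]
    by (simp add: ad_inv_def)
qed

lemma ad_inv_chart:
  assumes u: "u \<in> tangent_space A \<one>" and c: "c \<in> charts_at A \<one>" and a: "c \<in> charts_at A a"
  shows "left_mu c (snd c a) (ad_inv a u c) = right_mu c (snd c a) (u c)"
proof -
  have "tangent_map A A (\<lambda>b. a \<otimes> b) \<one> (ad_inv a u) c = left_mu c (snd c a) (ad_inv a u c)"
    using left_field_chart[OF ad_inv_in a c a] by (simp add: left_field_def left_mu_def)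
  moreover have "tangent_map A A (\<lambda>b. b \<otimes> a) \<one> u c = right_mu c (snd c a) (u c)"
    using AA.tangent_map_chart[OF mult_mdiff(2)[of a \<one>] u c, of c] mu_slice_derivative(1)[OF c a, of c] a
    by (simp add: right_mu_def)
  ultimately show ?thesis by (simp add: left_ad_inv)
qed

lemma left_mu_one:
  assumes c: "c \<in> charts_at A \<one>"
  shows "left_mu c (snd c \<one>) w = w"
  using left_field_chart[OF tangent_of_in[OF c] c c c] left_field_one[OF tangent_of_in[OF c]] c
  by (simp add: left_mu_def)

lemma right_mu_one:
  assumes c: "c \<in> charts_at A \<one>"
  shows "right_mu c (snd c \<one>) w = w"
proof -
  have "frechet_derivative (snd c \<circ> (\<lambda>a. a \<otimes> \<one>) \<circ> chart_inv c) (at (snd c \<one>)) w = w"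
    using transition_derivative_id[OF c] by (simp add: o_def)
  then show ?thesis using mu_slice_derivative(1)[OF c c, of c] c by (simp add: right_mu_def)
qed

lemma left_mu_linear:
  assumes c: "c \<in> charts_at A \<one>" and a: "c \<in> charts_at A a"
  shows "linear (left_mu c (snd c a))"
proof -
  have "c \<in> charts_at A (a \<otimes> \<one>)" using a by simp
  from mu_slice_derivative(2)[OF a c this] mdiff_has_derivative[OF mult_mdiff(1) c this]
  show ?thesis using has_derivative_linear unfolding left_mu_def by metis
qed

text \<open>
  In the chart, \<open>b s = ad_inv (\<beta> s) U\<close> is determined by \<open>left_mu (b s) = right_mu U\<close>, where both sides have explicit
  derivatives; differentiability of inversion is not needed.
\<close>

lemma ad_inv_has_derivative:
  assumes U: "U \<in> lie_algebra G A" and Y: "Y \<in> lie_algebra G A" and c: "c \<in> charts_at A \<one>"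
    and \<beta>0: "\<beta> 0 = \<one>" and \<beta>: "has_velocity A \<beta> 0 (Y \<one>)"
  shows "((\<lambda>s. ad_inv (\<beta> s) (U \<one>) c) has_vector_derivative - vfield_bracket A Y U \<one> c) (at 0)"
    "ad_inv (\<beta> 0) (U \<one>) c = U \<one> c"
proof -
  let ?y = "\<lambda>s. snd c (\<beta> s)" and ?u = "U \<one> c" and ?b = "\<lambda>s. ad_inv (\<beta> s) (U \<one>) c"
  have UT: "U \<one> \<in> tangent_space A \<one>" using lie_algebraD(2)[OF U] .
  have y: "(?y has_vector_derivative Y \<one> c) (at 0)"
    using has_velocity_chart[OF \<beta>] c \<beta>0 by (simp add: o_def)
  have mu2_lin: "linear (\<lambda>v. mu2 c v w)" "linear (\<lambda>v. mu2 c w v)" for w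
    using has_derivative_linear[OF left_mu_has_derivative[OF c]] has_derivative_linear[OF right_mu_has_derivative[OF c]]
    by auto
  have chain: "((\<lambda>s. F (?y s)) has_vector_derivative F' (Y \<one> c)) (at 0)"
    if F: "(F has_derivative F') (at (snd c \<one>))" for F and F' :: "'d \<Rightarrow> 'd"
  proof -
    have "((\<lambda>s. F (?y s)) has_derivative (\<lambda>h. F' (h *\<^sub>R Y \<one> c))) (at 0)"
      by (rule has_derivative_compose[where f="?y"])
        (use y F \<beta>0 in \<open>simp_all add: has_vector_derivative_def\<close>)
    then show ?thesis
      by (simp add: has_vector_derivative_def linear_scale[OF has_derivative_linear[OF F]])
  qed
  have "isCont \<beta> 0" using \<beta> by (simp add: has_velocity_def)
  then have ev: "eventually (\<lambda>s. c \<in> charts_at A (\<beta> s)) (at 0)"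
    using charts_at_eventually[of c \<beta> 0] c \<beta>0 by (simp add: eventually_nhds_conv_at)
  have b0: "?b 0 = right_mu c (?y 0) ?u"
    using ad_inv_chart[OF UT c, of \<one>] c left_mu_one[OF c] by (simp add: \<beta>0)
  then show "?b 0 = ?u" by (simp add: \<beta>0 right_mu_one[OF c])
  \<comment> \<open>Derivative of the right side minus derivative of the left side of the linear
    equation: two values of \<open>mu2\<close> whose difference is minus the bracket of
    \<open>Y\<close> and \<open>U\<close>.\<close>
  have "(?b has_vector_derivative mu2 c ?u (Y \<one> c) - mu2 c (Y \<one> c) (?b 0)) (at 0)"
  proof (rule linear_solution_has_vector_derivative[where P="\<lambda>s. left_mu c (?y s)" and q="\<lambda>s. right_mu c (?y s) ?u"])
    show "eventually (\<lambda>s. linear (left_mu c (?y s))) (at 0)"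
      using ev by eventually_elim (rule left_mu_linear[OF c])
    show "left_mu c (?y 0) w = w" for w using left_mu_one[OF c] by (simp add: \<beta>0)
    show "((\<lambda>s. left_mu c (?y s) w) has_vector_derivative mu2 c (Y \<one> c) w) (at 0)" for w
      by (rule chain[OF left_mu_has_derivative[OF c]])
    show "((\<lambda>s. right_mu c (?y s) ?u) has_vector_derivative mu2 c ?u (Y \<one> c)) (at 0)"
      by (rule chain[OF right_mu_has_derivative[OF c]])
    show "eventually (\<lambda>s. left_mu c (?y s) (?b s) = right_mu c (?y s) ?u) (at 0)"
      using ev by eventually_elim (rule ad_inv_chart[OF UT c])
    show "?b 0 = right_mu c (?y 0) ?u" by (rule b0)
  qed
  then show "(?b has_vector_derivative - vfield_bracket A Y U \<one> c) (at 0)"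
    using \<open>?b 0 = ?u\<close> bracket_at_one[OF Y U c] by simp
qed

end

section \<open>Isometric actions\<close>

locale homogeneous_action =
  lie_group G AG + M: riemannian_manifold AM g + transitive_action G "UNIV :: 'm set" act
  for G :: "'g::{t2_space, second_countable_topology} monoid" (structure)
    and AG :: "('g, 'd::euclidean_space) chart set"
    and AM :: "('m::{t2_space, second_countable_topology}, 'e::euclidean_space) chart set"
    and g :: "('m, 'e) metric"
    and act :: "'g \<Rightarrow> 'm \<Rightarrow> 'm" +
  assumes smooth_action: "smooth_map (prod_atlas AG AM) AM (\<lambda>(a, x). act a x)"
    and isometric_action: "riemannian_isometry AM g (act a)"
begin

sublocale GM: manifold_pair AG AM by unfold_locales
sublocale MM: manifold_pair AM AM by unfold_locales

lemma act_mult: "act (a \<otimes> b) x = act a (act b x)"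
  using composition_rule[of x a b] by simp

lemma act_one [simp]: "act \<one> x = x"
  using fun_cong[OF id_eq_one, of x] by simp

lemma act_mdiff: "mdiff AG AM (\<lambda>b. act b x) a" "mdiff AM AM (act a) x"
  using slice_mdiff[OF smooth_manifold_A M.smooth_manifold_A M.smooth_manifold_A smooth_action] by simp_all

definition orbit_map :: "'m \<Rightarrow> ('g, 'd) tangent \<Rightarrow> ('m, 'e) tangent" where
  "orbit_map x u = tangent_map AG AM (\<lambda>b. act b x) \<one> u"

lemma orbit_map_in: "orbit_map x u \<in> tangent_space AM x"
  using GM.tangent_map_in[OF act_mdiff(1)[of x \<one>]] by (simp add: orbit_map_def)

text \<open>The orbit map sends the curve \<open>lie_exp\<close> to the curve in the definition, and
  uniqueness of velocities resolves the description. From here on a Killing field is a linear image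
  of \<open>U \<one>\<close>.\<close>

lemma killing_field_eq:
  assumes "U \<in> lie_algebra G AG"
  shows "killing_field G AG AM act U x = orbit_map x (U \<one>)"
proof -
  have "has_velocity AM (\<lambda>t. act (lie_exp G AG (t *\<^sub>R U)) x) 0 (orbit_map x (U \<one>))"
    using GM.velocity_map[OF act_mdiff(1) lie_exp_curve(1)[OF assms], of x] lie_exp_curve(2)[OF assms]
    by (simp add: o_def orbit_map_def)
  then show ?thesis
    unfolding killing_field_def using M.has_velocity_unique by blast
qed

text \<open>The form f_x, carried by the tangent space at the identity.\<close>

definition pullback :: "'m \<Rightarrow> ('g, 'd) tangent \<Rightarrow> ('g, 'd) tangent \<Rightarrow> real" where
  "pullback x u v = g x (orbit_map x u) (orbit_map x v)"

abbreviation inn :: "('g, 'd) vfield \<Rightarrow> ('g, 'd) vfield \<Rightarrow> 'm \<Rightarrow> real" where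
  "inn \<equiv> killing_inner G AG AM g act"

lemma inn_eq:
  "U \<in> lie_algebra G AG \<Longrightarrow> V \<in> lie_algebra G AG \<Longrightarrow> inn U V x = pullback x (U \<one>) (V \<one>)"
  by (simp add: killing_inner_def killing_field_eq pullback_def)

lemma pullback_sym: "pullback x u v = pullback x v u"
  unfolding pullback_def by (intro M.metric_sym orbit_map_in)

lemma pullback_add:
  assumes "u \<in> tangent_space AG \<one>" "v \<in> tangent_space AG \<one>"
  shows "pullback x (u + v) w = pullback x u w + pullback x v w"
    "pullback x w (u + v) = pullback x w u + pullback x w v"
proof -
  show "pullback x (u + v) w = pullback x u w + pullback x v w" for w
    using GM.tangent_map_add[OF act_mdiff(1)[of x \<one>] assms] orbit_map_in
    by (simp add: pullback_def orbit_map_def[symmetric] M.metric_add)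
  then show "pullback x w (u + v) = pullback x w u + pullback x w v" by (simp add: pullback_sym)
qed

lemma pullback_scale:
  assumes "u \<in> tangent_space AG \<one>"
  shows "pullback x (r *\<^sub>R u) w = r * pullback x u w" "pullback x w (r *\<^sub>R u) = r * pullback x w u"
proof -
  show "pullback x (r *\<^sub>R u) w = r * pullback x u w" for w
    using GM.tangent_map_scale[OF act_mdiff(1)[of x \<one>] assms] orbit_map_in
    by (simp add: pullback_def orbit_map_def[symmetric] M.metric_scale)
  then show "pullback x w (r *\<^sub>R u) = r * pullback x w u" by (simp add: pullback_sym)
qed

text \<open>Differentiates \<open>act b (act a x) = act a (act (inv a \<otimes> b \<otimes> a)
  x)\<close> in \<open>b\<close> at the identity.\<close>

lemma orbit_map_act:
  assumes u: "u \<in> tangent_space AG \<one>"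
  shows "orbit_map (act a x) u = tangent_map AM AM (act a) x (orbit_map x (ad_inv a u))"
proof -
  note mans = smooth_manifold_A M.smooth_manifold_A
  let ?o = "\<lambda>b. act b x"
  have "orbit_map (act a x) u = tangent_map AG AM ?o a (tangent_map AG AG (\<lambda>b. b \<otimes> a) \<one> u)"
    using tangent_map_comp[OF mans(1,1,2) mult_mdiff(2)[of a \<one>] act_mdiff(1) u, of x]
    by (simp add: orbit_map_def act_mult)
  also have "\<dots> = tangent_map AG AM ?o a (tangent_map AG AG (\<lambda>b. a \<otimes> b) \<one> (ad_inv a u))"
    by (simp add: left_ad_inv)
  also have "\<dots> = tangent_map AG AM (\<lambda>b. act a (act b x)) \<one> (ad_inv a u)"
    using tangent_map_comp[OF mans(1,1,2) mult_mdiff(1)[of a \<one>] act_mdiff(1) ad_inv_in, of x]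
    by (simp add: act_mult)
  also have "\<dots> = tangent_map AM AM (act a) x (orbit_map x (ad_inv a u))"
    using tangent_map_comp[OF mans(1,2,2) act_mdiff(1)[of x \<one>] act_mdiff(2) ad_inv_in, of a]
    by (simp add: orbit_map_def)
  finally show ?thesis .
qed

lemma pullback_act:
  assumes "u \<in> tangent_space AG \<one>" "v \<in> tangent_space AG \<one>"
  shows "pullback (act a x) u v = pullback x (ad_inv a u) (ad_inv a v)"
  using isometric_action[of a] orbit_map_in
  by (simp add: pullback_def orbit_map_act assms riemannian_isometry_def)

section \<open>Inner products of Killing fields along curves in the group\<close>

lemma tangent_of_linear:
  assumes c: "c \<in> charts_at AG \<one>"
  shows "tangent_of AG \<one> c (v + w) = tangent_of AG \<one> c v + tangent_of AG \<one> c w"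
    "tangent_of AG \<one> c (r *\<^sub>R v) = r *\<^sub>R tangent_of AG \<one> c v"
  by (rule tangent_eqI[OF tangent_of_in[OF c]
        subspace_add[OF tangent_space_subspace tangent_of_in[OF c] tangent_of_in[OF c]] c], simp add: c)
    (rule tangent_eqI[OF tangent_of_in[OF c]
        subspace_scale[OF tangent_space_subspace tangent_of_in[OF c]] c], simp add: c scaleR_fun_def)

text \<open>The product rule for f_x, applied to two curves \<open>ad_inv (\<beta> s)\<close>. The
  curve is arbitrary with velocity \<open>Y \<one>\<close>, not just an exponential, because later
  it is a translated piece of a chart segment.\<close>

lemma inn_act_has_derivative:
  assumes U: "U \<in> lie_algebra G AG" and V: "V \<in> lie_algebra G AG" and Y: "Y \<in> lie_algebra G AG"
    and YU: "vfield_bracket AG Y U \<in> lie_algebra G AG" and YV: "vfield_bracket AG Y V \<in> lie_algebra G AG"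
    and \<beta>: "\<beta> 0 = \<one>" "has_velocity AG \<beta> 0 (Y \<one>)"
  shows "((\<lambda>s. inn U V (act (\<beta> s) x)) has_vector_derivative
    - (inn (vfield_bracket AG Y U) V x + inn U (vfield_bracket AG Y V) x)) (at 0)"
proof -
  obtain c where c: "c \<in> charts_at AG \<one>" using covering by blast
  \<comment> \<open>Read in a chart, the form is bilinear on a Euclidean space and thus bounded, as
    the product rule requires.\<close>
  define F where "F w z = pullback x (tangent_of AG \<one> c w) (tangent_of AG \<one> c z)" for w z
  have "bilinear F"
    unfolding bilinear_def F_def
    by (auto intro!: linearI simp: tangent_of_linear[OF c] pullback_add pullback_scale tangent_of_in[OF c])
  then interpret F: bounded_bilinear F by (simp add: bilinear_conv_bounded_bilinear)
  have eq: "pullback x u v = F (u c) (v c)" if "u \<in> tangent_space AG \<one>" "v \<in> tangent_space AG \<one>" for u v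
    using tangent_of_eq[OF that(1) c] tangent_of_eq[OF that(2) c] by (simp add: F_def)
  have T: "W \<one> \<in> tangent_space AG \<one>" if "W \<in> lie_algebra G AG" for W
    using lie_algebraD(2)[OF that] .
  note dU = ad_inv_has_derivative[OF U Y c \<beta>] and dV = ad_inv_has_derivative[OF V Y c \<beta>]
  have "((\<lambda>s. F (ad_inv (\<beta> s) (U \<one>) c) (ad_inv (\<beta> s) (V \<one>) c)) has_vector_derivative
      F (U \<one> c) (- vfield_bracket AG Y V \<one> c) + F (- vfield_bracket AG Y U \<one> c) (V \<one> c)) (at 0)"
    using F.has_vector_derivative[OF dU(1) dV(1)] dU(2) dV(2) by simp
  moreover have "inn U V (act a x) = F (ad_inv a (U \<one>) c) (ad_inv a (V \<one>) c)" for a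
    by (simp add: inn_eq[OF U V] pullback_act T U V eq ad_inv_in)
  ultimately show ?thesis
    by (simp add: inn_eq U V YU YV eq T F.minus_left F.minus_right add.commute)
qed

lemma inn_const_bracket:
  assumes U: "U \<in> lie_algebra G AG" and V: "V \<in> lie_algebra G AG" and Y: "Y \<in> lie_algebra G AG"
    and YU: "vfield_bracket AG Y U \<in> lie_algebra G AG" and YV: "vfield_bracket AG Y V \<in> lie_algebra G AG"
    and const: "\<And>x. inn U V x = k"
  shows "inn (vfield_bracket AG Y U) V x + inn U (vfield_bracket AG Y V) x = 0"
proof -
  have "((\<lambda>s::real. k) has_vector_derivative
    - (inn (vfield_bracket AG Y U) V x + inn U (vfield_bracket AG Y V) x)) (at 0)"
    using inn_act_has_derivative[OF U V Y YU YV, of "\<lambda>t. lie_exp G AG (t *\<^sub>R Y)" x] lie_exp_curve[OF Y]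
    by (simp add: const)
  from vector_derivative_unique_at[OF this has_vector_derivative_const] show ?thesis by simp
qed

text \<open>Any \<open>a\<close> in a coordinate ball is joined to the identity by a chart segment,
  along which the derivative vanishes. \<open>N\<close> is independent of \<open>x\<close>, so that
  its translates can be used around every group element.\<close>

lemma inn_locally_const:
  assumes U: "U \<in> lie_algebra G AG"
    and YU: "\<And>Y. Y \<in> lie_algebra G AG \<Longrightarrow> vfield_bracket AG Y U \<in> lie_algebra G AG"
    and zero: "\<And>Y x. Y \<in> lie_algebra G AG \<Longrightarrow> inn (vfield_bracket AG Y U) U x = 0"
  shows "\<exists>N. open N \<and> \<one> \<in> N \<and> (\<forall>a\<in>N. \<forall>x. inn U U (act a x) = inn U U x)"
proof -
  obtain c where c: "c \<in> charts_at AG \<one>" using covering by blast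
  have cA: "c \<in> AG" and x1: "snd c \<one> \<in> snd c ` fst c" using c by (auto simp: charts_at_def)
  obtain r where r: "r > 0" "ball (snd c \<one>) r \<subseteq> snd c ` fst c"
    using is_chart_open(2)[OF is_chart[OF cA]] x1 open_contains_ball by metis
  define N where "N = fst c \<inter> snd c -` ball (snd c \<one>) r"
  have "open N"
    unfolding N_def
    by (rule continuous_open_preimage[OF is_chart_cont[OF is_chart[OF cA]] is_chart_open(1)[OF is_chart[OF cA]]]) simp
  moreover have "\<one> \<in> N" using r c by (simp add: N_def charts_atD)
  moreover have "inn U U (act a x) = inn U U x" if a: "a \<in> N" for a x
  proof -
    have ca: "c \<in> charts_at AG a" using a cA by (auto simp: N_def charts_at_def)
    define w where "w = snd c a - snd c \<one>"
    define y where "y t = snd c \<one> + t *\<^sub>R w" for t :: real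
    define b where "b t = chart_inv c (y t)" for t
    have yS: "y t \<in> snd c ` fst c" if "t \<in> {0..1}" for t
    proof -
      have "norm (t *\<^sub>R w) \<le> 1 * norm w" using that by (simp only: norm_scaleR) (intro mult_right_mono, auto)
      also have "norm w < r" using a by (simp add: N_def w_def dist_norm norm_minus_commute)
      finally have "y t \<in> ball (snd c \<one>) r"
        unfolding y_def mem_ball dist_norm by (subst norm_minus_commute) simp
      then show ?thesis using r by blast
    qed
    have b01: "b 0 = \<one>" "b 1 = a" using c ca by (simp_all add: b_def y_def w_def)
    have vel: "has_velocity AG b t (tangent_of AG (b t) c w)" if t: "t \<in> {0..1}" for t
    proof -
      have cb: "c \<in> charts_at AG (b t)" unfolding b_def by (rule chart_inv_charts_at[OF cA yS[OF t]])
      have sb: "snd c (b t) = y t" unfolding b_def by (rule chart_chart_inv[OF cA yS[OF t]])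
      have "has_velocity AG (\<lambda>s. chart_inv c (snd c (b t) + s *\<^sub>R w)) (1 * t + - t) (tangent_of AG (b t) c w)"
        using chart_line_velocity[OF cb tangent_of_in[OF cb]] cb by simp
      moreover have "(\<lambda>s. chart_inv c (snd c (b t) + (1 * s + - t) *\<^sub>R w)) = b"
        unfolding sb by (simp add: fun_eq_iff b_def y_def algebra_simps)
      ultimately show ?thesis
        using has_velocity_reparam by fastforce
    qed
    have d: "((\<lambda>t. inn U U (act (b t) x)) has_vector_derivative 0) (at t)" if t: "t \<in> {0..1}" for t
    proof -
      \<comment> \<open>The segment near time \<open>t\<close>, translated from the right so as to
        pass through the identity at time 0. Its velocity there extends to a left-invariant field,
        and the factor split off moves the base point to \<open>act (b t) x\<close>.\<close>
      define \<beta> where "\<beta> s = b (1 * s + t) \<otimes> inv (b t)" for s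
      have "has_velocity AG (\<lambda>s. b (1 * s + t)) 0 (1 *\<^sub>R tangent_of AG (b t) c w)"
        by (rule has_velocity_reparam) (use vel[OF t] in simp)
      from AA.velocity_map[OF mult_mdiff(2) this, of "inv (b t)"]
      obtain v where v: "has_velocity AG \<beta> 0 v"
        unfolding o_def \<beta>_def[abs_def] by blast
      have \<beta>0: "\<beta> 0 = \<one>" by (simp add: \<beta>_def)
      have vT: "v \<in> tangent_space AG \<one>" using v \<beta>0 by (simp add: has_velocity_def)
      note Y = left_field_in[OF vT]
      have "((\<lambda>s. inn U U (act (\<beta> s) (act (b t) x))) has_vector_derivative
        - (inn (vfield_bracket AG (left_field v) U) U (act (b t) x) + inn U (vfield_bracket AG (left_field v) U) (act (b t) x))) (at 0)"
        by (rule inn_act_has_derivative[where \<beta>=\<beta>, OF U U Y YU[OF Y] YU[OF Y] \<beta>0]) (use v left_field_one[OF vT] in simp)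
      moreover have "inn U (vfield_bracket AG (left_field v) U) z = inn (vfield_bracket AG (left_field v) U) U z" for z
        using pullback_sym by (simp add: inn_eq U YU[OF Y])
      moreover have "act (\<beta> s) (act (b t) x) = act (b (s + t)) x" for s
        by (simp add: \<beta>_def act_mult[symmetric] m_assoc)
      ultimately have "((\<lambda>s. inn U U (act (b (s + t)) x)) has_vector_derivative 0) (at (t - t))"
        using zero[OF Y] by simp
      moreover have "((\<lambda>s. s - t) has_vector_derivative 1) (at t)"
        by (auto intro!: derivative_eq_intros simp: has_vector_derivative_def)
      ultimately show ?thesis
        using vector_diff_chain_at[of "\<lambda>s. s - t" 1 t "\<lambda>s. inn U U (act (b (s + t)) x)" 0] by (simp add: o_def)
    qed
    have "norm (inn U U (act (b 1) x) - inn U U (act (b 0) x)) \<le> 0 * \<bar>1 - 0\<bar>"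
      by (rule vector_derivative_bound[of "{0..1}" _ "\<lambda>_. 0"]) (auto intro: has_vector_derivative_at_within[OF d])
    then show ?thesis by (simp add: b01)
  qed
  ultimately show ?thesis by blast
qed

text \<open>
  \<open>G\<close> need not be connected, so local constancy of \<open>a \<mapsto> inn U U (act a x)\<close> is not enough. Its level sets
  are clopen in the compact group, hence their images in \<open>M\<close>, which partition \<open>M\<close>, are closed.
\<close>

lemma constant_lengthI:
  assumes compact_G: "compact (UNIV :: 'g set)" and connected_M: "connected (UNIV :: 'm set)"
    and U: "U \<in> lie_algebra G AG"
    and YU: "\<And>Y. Y \<in> lie_algebra G AG \<Longrightarrow> vfield_bracket AG Y U \<in> lie_algebra G AG"
    and zero: "\<And>Y x. Y \<in> lie_algebra G AG \<Longrightarrow> inn (vfield_bracket AG Y U) U x = 0"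
  shows "constant_length G AG AM g act U"
proof -
  have "\<exists>N. open N \<and> \<one> \<in> N \<and> (\<forall>a\<in>N. \<forall>x. inn U U (act a x) = inn U U x)"
    by (rule inn_locally_const[OF U]) (simp_all add: YU zero)
  then obtain N where N: "open N" "\<one> \<in> N" "\<forall>a\<in>N. \<forall>x. inn U U (act a x) = inn U U x"
    by blast
  have "inn U U x = inn U U x0" for x x0
  proof -
    let ?\<Phi> = "\<lambda>a. inn U U (act a x0)" and ?k = "inn U U x0"
    \<comment> \<open>\<open>P\<close> is left arbitrary so that complements are covered as well;
      this makes the sets clopen in the group, and in M it gives closedness both of a level set and
      of its complement.\<close>
    have "open {a. P (?\<Phi> a)}" for P
    proof (subst open_subopen, rule ballI)
      fix a assume a: "a \<in> {a. P (?\<Phi> a)}"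
      have "continuous_on UNIV (\<lambda>b. b \<otimes> inv a)"
        by (intro continuous_at_imp_continuous_on ballI mdiff_isCont[OF mult_mdiff(2)])
      then have "open ((\<lambda>b. b \<otimes> inv a) -` N)" using N(1) open_vimage by blast
      moreover have "a \<in> (\<lambda>b. b \<otimes> inv a) -` N" using N(2) by simp
      \<comment> \<open>\<open>b\<close> is \<open>b \<otimes> inv a\<close> times \<open>a\<close>,
        and \<open>N\<close> works at every point of M, in particular at
        \<open>act a x0\<close>.\<close>
      moreover have "?\<Phi> b = ?\<Phi> a" if "b \<otimes> inv a \<in> N" for b
        using bspec[OF N(3) that, rule_format, of "act a x0"] by (simp add: act_mult[symmetric] m_assoc)
      then have "(\<lambda>b. b \<otimes> inv a) -` N \<subseteq> {a. P (?\<Phi> a)}"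
        using a by (simp add: subset_iff)
      ultimately show "\<exists>T. open T \<and> a \<in> T \<and> T \<subseteq> {a. P (?\<Phi> a)}"
        by blast
    qed
    then have "closed {a. P (?\<Phi> a)}" for P
      using open_closed[of "{a. \<not> P (?\<Phi> a)}"] by (simp add: Compl_eq Collect_neg_eq[symmetric] closed_def)
    then have "compact {a. P (?\<Phi> a)}" for P
      using compact_Int_closed[OF compact_G] by fastforce
    moreover have cont: "continuous_on S (\<lambda>a. act a x0)" for S
      by (intro continuous_at_imp_continuous_on ballI mdiff_isCont[OF act_mdiff(1)])
    ultimately have "compact ((\<lambda>a. act a x0) ` {a. P (?\<Phi> a)})" for P
      using compact_continuous_image by blast
    \<comment> \<open>Transitivity: every point of M has the form \<open>act a x0\<close>, so the
      image is a full union of level sets.\<close>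
    moreover have "(\<lambda>a. act a x0) ` {a. P (?\<Phi> a)} = {x. P (inn U U x)}" for P
      using unique_orbit[of x0] by (auto simp: image_iff) metis
    ultimately have closed: "closed {x. P (inn U U x)}" for P
      using compact_imp_closed by metis
    have "- {x. inn U U x \<noteq> ?k} = {x. inn U U x = ?k}" by auto
    then have "open {x. inn U U x = ?k}"
      using open_Compl[OF closed[of "\<lambda>v. v \<noteq> ?k"]] by simp
    then have "{x. inn U U x = ?k} = {} \<or> {x. inn U U x = ?k} = UNIV"
      using connected_M closed[of "\<lambda>v. v = ?k"] unfolding connected_clopen by (metis (no_types, lifting) open_openin closed_closedin subtopology_UNIV)
    then show ?thesis by blast
  qed
  then show ?thesis unfolding constant_length_def constant_on_def by blast
qed

end

section \<open>Invariant forms on a sum of simple ideals\<close>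

text \<open>Geometry enters only through \<open>ip_deriv\<close>, the derivative formula for a pair
  whose inner product is constant. Constancy refers to all points at once, which is why
  \<open>ip\<close> is a family of forms and not a single one.\<close>

locale lie_form_family =
  fixes L :: "'v::real_vector set" and br :: "'v \<Rightarrow> 'v \<Rightarrow> 'v" and ip :: "'v \<Rightarrow> 'v \<Rightarrow> 'x \<Rightarrow> real"
  assumes L: "subspace L"
    and br_closed: "X \<in> L \<Longrightarrow> Y \<in> L \<Longrightarrow> br X Y \<in> L"
    and br_add: "X \<in> L \<Longrightarrow> Y \<in> L \<Longrightarrow> W \<in> L \<Longrightarrow> br X (Y + W) = br X Y + br X W"
    and br_scale: "X \<in> L \<Longrightarrow> Y \<in> L \<Longrightarrow> br X (r *\<^sub>R Y) = r *\<^sub>R br X Y"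
    and br_anti: "br Y X = - br X Y"
    and ip_add: "U \<in> L \<Longrightarrow> V \<in> L \<Longrightarrow> W \<in> L \<Longrightarrow> ip (U + V) W x = ip U W x + ip V W x"
    and ip_scale: "U \<in> L \<Longrightarrow> W \<in> L \<Longrightarrow> ip (r *\<^sub>R U) W x = r * ip U W x"
    and ip_sym: "U \<in> L \<Longrightarrow> V \<in> L \<Longrightarrow> ip U V x = ip V U x"
    and ip_deriv: "Y \<in> L \<Longrightarrow> U \<in> L \<Longrightarrow> V \<in> L \<Longrightarrow> (\<And>x. ip U V x = k) \<Longrightarrow>
      ip (br Y U) V x + ip U (br Y V) x = 0"
begin

lemma br_zero: "X \<in> L \<Longrightarrow> br X 0 = 0"
  using br_scale[of X 0 0] subspace_0[OF L] by simp

lemma ip_zero: "W \<in> L \<Longrightarrow> ip 0 W x = 0"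
  using ip_scale[of 0 W 0] subspace_0[OF L] by simp

lemma br_sum: "finite I \<Longrightarrow> X \<in> L \<Longrightarrow> (\<And>i. i \<in> I \<Longrightarrow> Y i \<in> L) \<Longrightarrow> br X (\<Sum>i\<in>I. Y i) = (\<Sum>i\<in>I. br X (Y i))"
  by (induction I rule: finite_induct) (simp_all add: br_zero br_add subspace_sum[OF L])

lemma ip_sum: "finite I \<Longrightarrow> W \<in> L \<Longrightarrow> (\<And>i. i \<in> I \<Longrightarrow> Y i \<in> L) \<Longrightarrow> ip (\<Sum>i\<in>I. Y i) W x = (\<Sum>i\<in>I. ip (Y i) W x)"
  by (induction I rule: finite_induct) (simp_all add: ip_zero ip_add subspace_sum[OF L])

lemma ip_sum_right:
  assumes "finite I" "W \<in> L" "\<And>i. i \<in> I \<Longrightarrow> Y i \<in> L"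
  shows "ip W (\<Sum>i\<in>I. Y i) x = (\<Sum>i\<in>I. ip W (Y i) x)"
proof -
  have "ip W (\<Sum>i\<in>I. Y i) x = ip (\<Sum>i\<in>I. Y i) W x"
    using assms by (intro ip_sym subspace_sum[OF L])
  also have "\<dots> = (\<Sum>i\<in>I. ip (Y i) W x)" by (rule ip_sum[OF assms])
  also have "\<dots> = (\<Sum>i\<in>I. ip W (Y i) x)" using assms by (intro sum.cong refl ip_sym)
  finally show ?thesis .
qed

lemma const_bracket:
  assumes "Y \<in> L" "U \<in> L" "\<And>x. ip U U x = k"
  shows "ip (br Y U) U x = 0"
  using ip_deriv[OF assms(1,2,2,3), of x] ip_sym[OF br_closed[OF assms(1,2)] assms(2)] by simp

lemma ideal_in: "lie_ideal br L I \<Longrightarrow> X \<in> I \<Longrightarrow> X \<in> L"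
  by (auto simp: lie_ideal_def)

lemma ideal_br: "lie_ideal br L I \<Longrightarrow> X \<in> L \<Longrightarrow> Y \<in> I \<Longrightarrow> br X Y \<in> I"
  by (auto simp: lie_ideal_def)

text \<open>\<open>T\<close> is kept general because the argument runs twice: once with the brackets
  \<open>br W (z j)\<close> of the other ideal, then in the other ideal with \<open>T\<close> all of
  the first one.\<close>

lemma simple_ideal_orthogonal:
  assumes I: "lie_ideal br L I" "simple_lie_algebra br I" and Z: "Z \<in> I" "Z \<noteq> 0"
    and T: "T \<subseteq> L" "\<And>Y V. Y \<in> I \<Longrightarrow> V \<in> T \<Longrightarrow> br Y V = 0"
    and orth: "\<And>Y V x. Y \<in> I \<Longrightarrow> V \<in> T \<Longrightarrow> ip (br Y Z) V x = 0"
    and A: "A \<in> I" and V: "V \<in> T"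
  shows "ip A V x = 0"
proof -
  have IL: "X \<in> L" if "X \<in> I" for X using ideal_in[OF I(1) that] .
  have subI: "subspace I" using I(1) by (simp add: lie_ideal_def)
  have simple: "J = {0} \<or> J = I" if "lie_ideal br I J" for J
    using I(2) that by (auto simp: simple_lie_algebra_def)
  \<comment> \<open>An ideal because \<open>I\<close> commutes with \<open>T\<close>:
    differentiating \<open>ip A V x = 0\<close> along \<open>Y\<close> leaves only the term with
    \<open>br Y A\<close>.\<close>
  define S where "S = {A \<in> I. \<forall>V\<in>T. \<forall>x. ip A V x = 0}"
  have "lie_ideal br I S"
    unfolding lie_ideal_def
  proof (intro conjI ballI)
    show "subspace S"
      using T(1) subspace_0[OF subI] subspace_add[OF subI] subspace_scale[OF subI] IL
      by (intro subspaceI) (auto simp: S_def ip_zero ip_add ip_scale subset_iff)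
    show "S \<subseteq> I" by (auto simp: S_def)
    fix Y A assume Y: "Y \<in> I" and A: "A \<in> S"
    have AI: "A \<in> I" using A by (simp add: S_def)
    have "ip (br Y A) V x = 0" if V: "V \<in> T" for V x
    proof -
      have VL: "V \<in> L" using V T(1) by blast
      have "ip (br Y A) V x + ip A (br Y V) x = 0"
        by (rule ip_deriv[OF IL[OF Y] IL[OF AI] VL, of 0]) (use A V in \<open>simp add: S_def\<close>)
      then show ?thesis
        using T(2)[OF Y V] ip_zero[OF IL[OF AI]] ip_sym[OF IL[OF AI] subspace_0[OF L]] by simp
    qed
    then show "br Y A \<in> S" using ideal_br[OF I(1) IL[OF Y] AI] by (simp add: S_def)
  qed
  then consider "S = {0}" | "S = I" using simple by blast
  then show ?thesis
  proof cases
    case 1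
    have brZ: "br Y Z = 0" if Y: "Y \<in> I" for Y
    proof -
      have "br Y Z \<in> S" using orth[OF Y] ideal_br[OF I(1) IL[OF Y] Z(1)] by (simp add: S_def)
      then show ?thesis using 1 by simp
    qed
    \<comment> \<open>This case is contradictory: \<open>Z\<close> would commute with
      \<open>I\<close>, so the center of \<open>I\<close> would be a nonzero ideal and hence all of
      \<open>I\<close>, which is not abelian.\<close>
    define C where "C = {X \<in> I. \<forall>Y\<in>I. br Y X = 0}"
    have "lie_ideal br I C"
      unfolding lie_ideal_def
    proof (intro conjI ballI)
      show "subspace C"
        using subspace_0[OF subI] subspace_add[OF subI] subspace_scale[OF subI] IL
        by (intro subspaceI) (auto simp: C_def br_zero br_add br_scale)
      show "br Y X \<in> C" if "Y \<in> I" "X \<in> C" for Y X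
        using that subspace_0[OF subI] IL by (auto simp: C_def br_zero)
    qed (auto simp: C_def)
    moreover have "Z \<in> C" using Z(1) brZ by (simp add: C_def)
    ultimately have "C = I" using simple Z(2) by blast
    moreover obtain X Y where "X \<in> I" "Y \<in> I" "br X Y \<noteq> 0" using I(2) by (auto simp: simple_lie_algebra_def)
    ultimately show ?thesis unfolding C_def by blast
  next
    case 2
    then show ?thesis using A V by (auto simp: S_def)
  qed
qed

end

section \<open>Center and simple ideals: the algebraic form of both directions\<close>

locale lie_decomposition = lie_form_family L br ip
  for L :: "'v::real_vector set" and br :: "'v \<Rightarrow> 'v \<Rightarrow> 'v" and ip :: "'v \<Rightarrow> 'v \<Rightarrow> 'x \<Rightarrow> real" +
  fixes c :: "'v set" and h :: "nat \<Rightarrow> 'v set" and k l :: nat and z :: "nat \<Rightarrow> 'v"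
  assumes cen: "c = lie_center br L"
    and ideals: "i \<in> {1..k} \<Longrightarrow> lie_ideal br L (h i) \<and> simple_lie_algebra br (h i)"
    and dec: "internal_direct_sum L {0..k} (\<lambda>i. if i = 0 then c else h i)"
    and l: "l \<le> k"
    and z0: "z 0 \<in> c" and zi: "\<And>i. i \<in> {1..l} \<Longrightarrow> z i \<in> h i" and znz: "\<And>i. i \<in> {1..l} \<Longrightarrow> z i \<noteq> 0"
begin

abbreviation "zsum \<equiv> (\<Sum>i = 0..l. z i)"

lemma h_in: "i \<in> {1..k} \<Longrightarrow> X \<in> h i \<Longrightarrow> X \<in> L"
  using ideals ideal_in by blast

lemma c_in: "X \<in> c \<Longrightarrow> X \<in> L"
  by (simp add: cen lie_center_def)

lemma br_center: "X \<in> L \<Longrightarrow> C \<in> c \<Longrightarrow> br X C = 0"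
  using br_anti[of X C] by (simp add: cen lie_center_def)

text \<open>Placing \<open>W\<close> in the slot \<open>i\<close> or in the slot \<open>j\<close>
  gives two decompositions of the same vector, which must coincide.\<close>

lemma h_disjoint:
  assumes ij: "i \<in> {1..k}" "j \<in> {1..k}" "i \<noteq> j" and W: "W \<in> h i" "W \<in> h j"
  shows "W = 0"
proof -
  let ?V = "\<lambda>i. if i = 0 then c else h i"
  have sub: "subspace (?V m)" if "m \<in> {0..k}" for m
    using dec that unfolding internal_direct_sum_def by blast
  have mem: "(\<lambda>m\<in>{0..k}. if m = n then W else 0) \<in> (\<Pi>\<^sub>E m\<in>{0..k}. ?V m)
      \<and> W = (\<Sum>m\<in>{0..k}. (\<lambda>m\<in>{0..k}. if m = n then W else 0) m)"
    if n: "n \<in> {1..k}" "W \<in> h n" for n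
  proof -
    have "(if m = n then W else 0) \<in> ?V m" if "m \<in> {0..k}" for m
      using n subspace_0[OF sub[OF that]] by (cases "m = n") auto
    moreover have "(\<Sum>m\<in>{0..k}. (\<lambda>m\<in>{0..k}. if m = n then W else 0) m) = (\<Sum>m\<in>{0..k}. if m = n then W else 0)"
      by (rule sum.cong) auto
    ultimately show ?thesis using n by (auto simp: sum.delta)
  qed
  have "\<exists>!Y. Y \<in> (\<Pi>\<^sub>E m\<in>{0..k}. ?V m) \<and> W = (\<Sum>m\<in>{0..k}. Y m)"
    using dec h_in[OF ij(1) W(1)] unfolding internal_direct_sum_def by blast
  then obtain Y0 where "Y = Y0"
    if "Y \<in> (\<Pi>\<^sub>E m\<in>{0..k}. ?V m) \<and> W = (\<Sum>m\<in>{0..k}. Y m)" for Y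
    by (elim ex1E) blast
  from this[OF mem[OF ij(1) W(1)]] this[OF mem[OF ij(2) W(2)]]
  have "(\<lambda>m\<in>{0..k}. if m = i then W else 0) = (\<lambda>m\<in>{0..k}. if m = j then W else 0)" by simp
  from fun_cong[OF this, of i] show ?thesis using ij by simp
qed

text \<open>The bracket lies in both ideals.\<close>

lemma h_commute:
  assumes ij: "i \<in> {1..k}" "j \<in> {1..k}" "i \<noteq> j" and X: "X \<in> h i" and Y: "Y \<in> h j"
  shows "br X Y = 0"
proof (rule h_disjoint[OF ij])
  show "br X Y \<in> h j" using ideals[OF ij(2)] ideal_br h_in[OF ij(1) X] Y by blast
  have "br Y X \<in> h i" using ideals[OF ij(1)] ideal_br h_in[OF ij(2) Y] X by blast
  then show "br X Y \<in> h i"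
    using br_anti[of X Y] ideals[OF ij(1)] subspace_neg by (auto simp: lie_ideal_def)
qed

text \<open>All other summands commute with \<open>h i\<close>, so on it \<open>Y\<close> acts
  through its own component there. Conditions for all of \<open>L\<close> thereby reduce to
  conditions for \<open>h i\<close>.\<close>

lemma br_component:
  assumes i: "i \<in> {1..k}" and X: "X \<in> h i" and Y: "Y \<in> L"
  obtains y where "y \<in> h i" "br Y X = br y X"
proof -
  obtain y where y: "y \<in> (\<Pi>\<^sub>E m\<in>{0..k}. if m = 0 then c else h m)" "Y = (\<Sum>m\<in>{0..k}. y m)"
    using dec Y unfolding internal_direct_sum_def by blast
  have ym: "y m \<in> (if m = 0 then c else h m)" if "m \<in> {0..k}" for m using y(1) that by blast
  have yL: "y m \<in> L" if "m \<in> {0..k}" for m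
    using ym[OF that] c_in h_in[of m] that by (cases "m = 0") auto
  have XL: "X \<in> L" using h_in[OF i X] .
  have zero: "br X (y m) = 0" if m: "m \<in> {0..k}" "m \<noteq> i" for m
    using ym[OF m(1)] br_center[OF XL] h_commute[OF i _ _ X, of m "y m"] m by (cases "m = 0") auto
  have "br X Y = (\<Sum>m\<in>{0..k}. br X (y m))" unfolding y(2) using XL yL by (intro br_sum) auto
  also have "\<dots> = (\<Sum>m\<in>{i}. br X (y m))"
    using zero i by (intro sum.mono_neutral_right) auto
  finally have "br X Y = br X (y i)" by simp
  then have "br Y X = br (y i) X" using br_anti[of X] by simp
  moreover have "y i \<in> h i" using ym[of i] i by simp
  ultimately show ?thesis using that by blast
qed

lemma z_in: "i \<in> {0..l} \<Longrightarrow> z i \<in> L"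
  using z0 c_in zi[of i] h_in[of i "z i"] l by (cases "i = 0") auto

lemma zsum_in: "zsum \<in> L"
  by (rule subspace_sum[OF L]) (rule z_in)

lemma br_zsum:
  assumes i: "i \<in> {1..l}" and Y: "Y \<in> h i"
  shows "br Y zsum = br Y (z i)"
proof -
  have YL: "Y \<in> L" using h_in[of i Y] i l Y by simp
  have zero: "br Y (z j) = 0" if "j \<in> {0..l}" "j \<noteq> i" for j
    using br_center[OF YL z0] h_commute[of i j Y "z j"] zi[of j] Y i l that by (cases "j = 0") auto
  have "br Y zsum = (\<Sum>j = 0..l. br Y (z j))" using YL z_in by (intro br_sum) auto
  also have "\<dots> = (\<Sum>j\<in>{i}. br Y (z j))"
    using zero i by (intro sum.mono_neutral_right) auto
  finally show ?thesis by simp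
qed

lemma constant_orthogonal:
  assumes const: "\<And>x. ip zsum zsum x = r"
    and ij: "i \<in> {1..l}" "j \<in> {1..l}" "i \<noteq> j" and U: "U \<in> h i" and V: "V \<in> h j"
  shows "ip U V x = 0"
proof -
  have ijk: "i \<in> {1..k}" "j \<in> {1..k}" using ij l by auto
  note I = ideals[OF ijk(1)] and J = ideals[OF ijk(2)]
  have brI: "br Y (z i) \<in> h i" if "Y \<in> h i" for Y
    using I ideal_br h_in[OF ijk(1) that] zi[OF ij(1)] by blast
  have brJ: "br W (z j) \<in> h j" if "W \<in> h j" for W
    using J ideal_br h_in[OF ijk(2) that] zi[OF ij(2)] by blast
  have mixed: "ip (br Y (z i)) (br W (z j)) x = 0" if Y: "Y \<in> h i" and W: "W \<in> h j" for Y W x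
  proof -
    have "ip (br Y (z i)) zsum x = 0" for x
      using const_bracket[OF h_in[OF ijk(1) Y] zsum_in const] br_zsum[OF ij(1) Y] by simp
    from ip_deriv[OF h_in[OF ijk(2) W] h_in[OF ijk(1) brI[OF Y]] zsum_in this]
    have "ip (br W (br Y (z i))) zsum x + ip (br Y (z i)) (br W zsum) x = 0" .
    \<comment> \<open>Distinct ideals commute, so only the term in which \<open>W\<close> meets
      \<open>z j\<close> survives.\<close>
    moreover have "br W (br Y (z i)) = 0"
      by (rule h_commute[OF ijk(2,1) _ W brI[OF Y]]) (use ij in simp)
    ultimately show ?thesis using ip_zero[OF zsum_in] br_zsum[OF ij(2) W] by simp
  qed
  \<comment> \<open>\<open>mixed\<close> only controls brackets on both sides. Here the left one is
    enlarged to all of \<open>h i\<close>; the second application, in \<open>h j\<close>, enlarges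
    the other.\<close>
  have half: "ip A (br W (z j)) x = 0" if A: "A \<in> h i" and W: "W \<in> h j" for A W x
  proof (rule simple_ideal_orthogonal[of "h i" "z i" "(\<lambda>W. br W (z j)) ` h j"])
    show "(\<lambda>W. br W (z j)) ` h j \<subseteq> L" using brJ h_in[OF ijk(2)] by blast
    show "br Y V = 0" if "Y \<in> h i" "V \<in> (\<lambda>W. br W (z j)) ` h j" for Y V
      using that brJ h_commute[OF ijk ij(3)] by blast
  qed (use I zi[OF ij(1)] znz[OF ij(1)] A W mixed in auto)
  have "ip V U x = 0"
  proof (rule simple_ideal_orthogonal[of "h j" "z j" "h i"])
    show "h i \<subseteq> L" using h_in[OF ijk(1)] by blast
    show "br Y W = 0" if "Y \<in> h j" "W \<in> h i" for Y W
      using that h_commute[OF ijk(2,1)] ij(3) by blast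
    show "ip (br Y (z j)) W x = 0" if "Y \<in> h j" "W \<in> h i" for Y W x
      using half[OF that(2,1)] ip_sym h_in[OF ijk(1) that(2)] h_in[OF ijk(2) brJ[OF that(1)]] by metis
  qed (use J zi[OF ij(2)] znz[OF ij(2)] U V in auto)
  then show ?thesis using ip_sym h_in[OF ijk(1) U] h_in[OF ijk(2) V] by metis
qed

text \<open>Orthogonality is a hypothesis because it is derived in one direction of the theorem and
  assumed in the other.\<close>

lemma ip_zsum:
  assumes orth: "\<And>j V x. j \<in> {1..l} \<Longrightarrow> j \<noteq> i \<Longrightarrow> V \<in> h j \<Longrightarrow> ip A V x = 0"
    and i: "i \<in> {1..l}" and A: "A \<in> h i"
  shows "ip A zsum x = ip A (z 0 + z i) x"
proof -
  have AL: "A \<in> L" using h_in[of i A] i l A by simp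
  have zL: "z 0 \<in> L" "z i \<in> L" using z_in i by auto
  have "ip A zsum x = (\<Sum>j = 0..l. ip A (z j) x)" using AL z_in by (intro ip_sum_right) auto
  also have "\<dots> = (\<Sum>j\<in>{0, i}. ip A (z j) x)"
  proof (rule sum.mono_neutral_right)
    show "\<forall>j\<in>{0..l} - {0, i}. ip A (z j) x = 0"
    proof
      fix j assume "j \<in> {0..l} - {0, i}"
      then have "j \<in> {1..l}" "j \<noteq> i" by auto
      then show "ip A (z j) x = 0" using orth zi by blast
    qed
  qed (use i in auto)
  also have "\<dots> = ip A (z 0) x + ip A (z i) x" using i by simp
  also have "\<dots> = ip A (z 0 + z i) x"
    using ip_add[OF zL AL] ip_sym[OF AL] zL subspace_add[OF L zL] by simp
  finally show ?thesis .
qed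

lemma z_pair_bracket:
  assumes i: "i \<in> {1..l}" and Y: "Y \<in> L"
  shows "br Y (z 0 + z i) = br Y (z i)"
  using br_add[OF Y, of "z 0" "z i"] z_in[of 0] z_in[of i] i br_center[OF Y z0] by simp

text \<open>After \<open>Y\<close> is replaced by its component in \<open>h i\<close>, the bracket
  lies in \<open>h i\<close>. It cannot distinguish \<open>z 0 + z i\<close> from
  \<open>zsum\<close>, neither in the bracket nor in the inner product.\<close>

lemma constant_pair:
  assumes const: "\<And>x. ip zsum zsum x = r" and i: "i \<in> {1..l}" and Y: "Y \<in> L"
  shows "ip (br Y (z 0 + z i)) (z 0 + z i) x = 0"
proof -
  have ik: "i \<in> {1..k}" using i l by simp
  obtain y where y: "y \<in> h i" "br Y (z i) = br y (z i)" using br_component[OF ik zi[OF i] Y] by metis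
  have yz: "br y (z i) \<in> h i" using ideals[OF ik] ideal_br h_in[OF ik y(1)] zi[OF i] by blast
  have "ip (br y (z i)) (z 0 + z i) x = ip (br y (z i)) zsum x"
    by (rule ip_zsum[symmetric, OF _ i yz]) (use constant_orthogonal[OF const i] yz in blast)
  also have "\<dots> = 0"
    using const_bracket[OF h_in[OF ik y(1)] zsum_in const] br_zsum[OF i y(1)] by simp
  finally show ?thesis using z_pair_bracket[OF i Y] y(2) by simp
qed

text \<open>The same comparison backwards: \<open>br Y zsum\<close> splits into brackets lying in
  the ideals, each seeing only its own \<open>z 0 + z i\<close>; the central summand contributes
  nothing.\<close>

lemma constant_sum:
  assumes const: "\<And>i. i \<in> {1..l} \<Longrightarrow> \<exists>r. \<forall>x. ip (z 0 + z i) (z 0 + z i) x = r"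
    and orth: "\<And>i j U V x. i \<in> {1..l} \<Longrightarrow> j \<in> {1..l} \<Longrightarrow> i \<noteq> j \<Longrightarrow> U \<in> h i \<Longrightarrow> V \<in> h j \<Longrightarrow> ip U V x = 0"
    and Y: "Y \<in> L"
  shows "ip (br Y zsum) zsum x = 0"
proof -
  have "br Y zsum = (\<Sum>j = 0..l. br Y (z j))" using Y z_in by (intro br_sum) auto
  then have "ip (br Y zsum) zsum x = (\<Sum>j = 0..l. ip (br Y (z j)) zsum x)"
    using ip_sum[of "{0..l}" zsum "\<lambda>j. br Y (z j)"] zsum_in br_closed[OF Y z_in] by simp
  also have "\<dots> = 0"
  proof (rule sum.neutral, rule ballI)
    fix i assume il: "i \<in> {0..l}"
    show "ip (br Y (z i)) zsum x = 0"
    proof (cases "i = 0")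
      case True
      then show ?thesis using br_center[OF Y z0] ip_zero[OF zsum_in] by simp
    next
      case False
      then have i: "i \<in> {1..l}" and ik: "i \<in> {1..k}" using il l by auto
      have zz: "z 0 + z i \<in> L" using subspace_add[OF L z_in z_in] il by simp
      have yz: "br Y (z i) \<in> h i" using ideals[OF ik] ideal_br Y zi[OF i] by blast
      have "ip (br Y (z i)) zsum x = ip (br Y (z i)) (z 0 + z i) x"
        by (rule ip_zsum[OF _ i yz]) (use orth[OF i] yz in blast)
      also have "\<dots> = ip (br Y (z 0 + z i)) (z 0 + z i) x" by (simp add: z_pair_bracket[OF i Y])
      also have "\<dots> = 0" using const[OF i] const_bracket[OF Y zz] by blast
      finally show ?thesis .
    qed
  qed
  finally show ?thesis .
qed

end

section \<open>Killing fields of constant length\<close>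

lemma (in homogeneous_action) lie_form_family:
  assumes closed: "\<And>X Y. X \<in> lie_algebra G AG \<Longrightarrow> Y \<in> lie_algebra G AG \<Longrightarrow> vfield_bracket AG X Y \<in> lie_algebra G AG"
  shows "lie_form_family (lie_algebra G AG) (vfield_bracket AG) inn"
proof
  have T: "W \<one> \<in> tangent_space AG \<one>" if "W \<in> lie_algebra G AG" for W
    using lie_algebraD(2)[OF that] .
  note add = subspace_add[OF lie_algebra_subspace] and scale = subspace_scale[OF lie_algebra_subspace]
  show "subspace (lie_algebra G AG)" by (rule lie_algebra_subspace)
  show "vfield_bracket AG X Y \<in> lie_algebra G AG" if "X \<in> lie_algebra G AG" "Y \<in> lie_algebra G AG" for X Y
    by (rule closed[OF that])
  show "vfield_bracket AG X (Y + W) = vfield_bracket AG X Y + vfield_bracket AG X W"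
    if "X \<in> lie_algebra G AG" "Y \<in> lie_algebra G AG" "W \<in> lie_algebra G AG" for X Y W
    using that by (intro vfield_bracket_add lie_algebraD)
  show "vfield_bracket AG X (r *\<^sub>R Y) = r *\<^sub>R vfield_bracket AG X Y"
    if "X \<in> lie_algebra G AG" "Y \<in> lie_algebra G AG" for X Y r
    using that by (intro vfield_bracket_scale lie_algebraD)
  show "vfield_bracket AG Y X = - vfield_bracket AG X Y" for X Y by (rule vfield_bracket_anti)
  show "inn (U + V) W x = inn U W x + inn V W x"
    if "U \<in> lie_algebra G AG" "V \<in> lie_algebra G AG" "W \<in> lie_algebra G AG" for U V W x
    using that by (simp add: inn_eq add pullback_add T)
  show "inn (r *\<^sub>R U) W x = r * inn U W x"
    if U: "U \<in> lie_algebra G AG" and W: "W \<in> lie_algebra G AG" for U W r x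
  proof -
    have "(r *\<^sub>R U) \<one> = r *\<^sub>R U \<one>" by (simp add: scaleR_fun_def)
    then show ?thesis
      using pullback_scale(1)[OF T[OF U]] by (simp add: inn_eq[OF scale[OF U] W] inn_eq[OF U W])
  qed
  show "inn U V x = inn V U x" if "U \<in> lie_algebra G AG" "V \<in> lie_algebra G AG" for U V x
    using that by (simp add: inn_eq pullback_sym)
  show "inn (vfield_bracket AG Y U) V x + inn U (vfield_bracket AG Y V) x = 0"
    if "Y \<in> lie_algebra G AG" "U \<in> lie_algebra G AG" "V \<in> lie_algebra G AG" "\<And>x. inn U V x = k" for Y U V k x
    by (rule inn_const_bracket[OF that(2,3,1) closed[OF that(1,2)] closed[OF that(1,3)] that(4)])
qed

text \<open>Each summand of \<open>Y\<close> is harmless: an ideal absorbs brackets by definition,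
  and a central one gives 0. Antisymmetry is used because \<open>lie_center\<close> puts the central
  element first.\<close>

lemma bracket_closed_decomposition:
  fixes L :: "'v::real_vector set" and h :: "nat \<Rightarrow> 'v set"
  assumes L: "subspace L"
    and add: "\<And>X Y W. X \<in> L \<Longrightarrow> Y \<in> L \<Longrightarrow> W \<in> L \<Longrightarrow> br X (Y + W) = br X Y + br X W"
    and anti: "\<And>X Y. br Y X = - br X Y"
    and dec: "internal_direct_sum L {0..k} (\<lambda>i. if i = 0 then lie_center br L else h i)"
    and ideals: "\<And>i. i \<in> {1..k} \<Longrightarrow> lie_ideal br L (h i)"
    and X: "X \<in> L" and Y: "Y \<in> L"
  shows "br X Y \<in> L"
proof -
  obtain y where y: "y \<in> (\<Pi>\<^sub>E m\<in>{0..k}. if m = 0 then lie_center br L else h m)" "Y = (\<Sum>m\<in>{0..k}. y m)"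
    using dec Y unfolding internal_direct_sum_def by blast
  have ym: "y m \<in> (if m = 0 then lie_center br L else h m)" if "m \<in> {0..k}" for m using y(1) that by blast
  have yL: "y m \<in> L \<and> br X (y m) \<in> L" if m: "m \<in> {0..k}" for m
  proof (cases "m = 0")
    case True
    then show ?thesis
      using ym[OF m] X anti[of X "y m"] subspace_0[OF L] by (simp add: lie_center_def)
  next
    case False
    then have "y m \<in> h m" "lie_ideal br L (h m)" using ym[OF m] ideals[of m] m by auto
    then show ?thesis using X unfolding lie_ideal_def by blast
  qed
  have br0: "br X 0 = 0" using add[of X 0 0] X subspace_0[OF L] by simp
  have "br X (\<Sum>m\<in>F. y m) \<in> L" if "finite F" "F \<subseteq> {0..k}" for F
    using that
  proof (induction F rule: finite_induct)
    case (insert a F)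
    have aF: "y a \<in> L" "br X (y a) \<in> L" "(\<Sum>m\<in>F. y m) \<in> L"
      using yL insert.prems by (auto intro!: subspace_sum[OF L])
    then show ?case
      using insert add[OF X aF(1,3)] subspace_add[OF L aF(2)] by simp
  qed (simp add: br0 subspace_0[OF L])
  then show ?thesis using y(2) by simp
qed

theorem theorem1:
  fixes G :: "'g::{t2_space, second_countable_topology} monoid"
    and AG :: "('g, 'd::euclidean_space) chart set"
    and AM :: "('m::{t2_space, second_countable_topology}, 'e::euclidean_space) chart set"
    and g :: "('m, 'e) metric"
    and act :: "'g \<Rightarrow> 'm \<Rightarrow> 'm"
    and \<cc> :: "('g, 'd) vfield set"
    and \<gg> :: "nat \<Rightarrow> ('g, 'd) vfield set"
    and Z :: "nat \<Rightarrow> ('g, 'd) vfield"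
    and k l :: nat
  assumes homogeneous: "homogeneous_riemannian_manifold G AG AM g act"
    and compact_M: "compact (UNIV :: 'm set)"
    and connected_M: "connected (UNIV :: 'm set)"
    and compact_G: "compact (UNIV :: 'g set)"
    and center: "\<cc> = lie_center (vfield_bracket AG) (lie_algebra G AG)"
    and simple_ideals: "bij_betw \<gg> {1..k} (simple_ideals (vfield_bracket AG) (lie_algebra G AG))"
    and decomposition: "internal_direct_sum (lie_algebra G AG) {0..k} (\<lambda>i. if i = 0 then \<cc> else \<gg> i)"
    and l: "1 \<le> l" "l \<le> k"
    and Z_center: "Z 0 \<in> \<cc>"
    and Z_simple: "\<And>i. i \<in> {1..l} \<Longrightarrow> Z i \<in> \<gg> i"
    and Z_nonzero: "\<And>i. i \<in> {1..l} \<Longrightarrow> Z i \<noteq> 0"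
  shows
    "(constant_length G AG AM g act (\<Sum>i = 0..l. Z i) \<longrightarrow>
        (\<forall>i\<in>{1..l}. \<forall>j\<in>{1..l}. i \<noteq> j \<longrightarrow>
           killing_orthogonal G AG AM g act (\<gg> i) (\<gg> j) \<and>
           killing_orthogonal G AG AM g act {Z i} (\<gg> j) \<and>
           killing_orthogonal G AG AM g act {Z i} {Z j}) \<and>
        (\<forall>i\<in>{1..l}. constant_length G AG AM g act (Z 0 + Z i))) \<and>
     ((\<forall>i\<in>{1..l}. constant_length G AG AM g act (Z 0 + Z i)) \<and>
      (\<forall>i\<in>{1..l}. \<forall>j\<in>{1..l}. i \<noteq> j \<longrightarrow> killing_orthogonal G AG AM g act (\<gg> i) (\<gg> j)) \<longrightarrow>
        constant_length G AG AM g act (\<Sum>i = 0..l. Z i))"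
proof -
  interpret H: homogeneous_action G AG AM g act
    using homogeneous
    unfolding homogeneous_riemannian_manifold_def homogeneous_riemannian_manifold_axioms_def
      homogeneous_action_def homogeneous_action_axioms_def by blast
  let ?L = "lie_algebra G AG" and ?br = "vfield_bracket AG"
  have ideals: "lie_ideal ?br ?L (\<gg> i) \<and> simple_lie_algebra ?br (\<gg> i)" if "i \<in> {1..k}" for i
    using bij_betwE[OF simple_ideals] that unfolding simple_ideals_def by blast
  \<comment> \<open>Closure has to come first, since the derivative formula speaks of inner products
    of brackets through their values at the identity.\<close>
  have closed: "?br X Y \<in> ?L" if "X \<in> ?L" "Y \<in> ?L" for X Y
  proof (rule bracket_closed_decomposition[OF H.lie_algebra_subspace _ _ _ _ that])
    show "?br X (Y + W) = ?br X Y + ?br X W" if "X \<in> ?L" "Y \<in> ?L" "W \<in> ?L" for X Y W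
      using that by (intro H.vfield_bracket_add H.lie_algebraD)
    show "?br Y X = - ?br X Y" for X Y by (rule H.vfield_bracket_anti)
    show "internal_direct_sum ?L {0..k} (\<lambda>i. if i = 0 then lie_center ?br ?L else \<gg> i)"
      using decomposition unfolding center .
  qed (use ideals in blast)
  interpret F: lie_form_family ?L ?br "killing_inner G AG AM g act"
    by (rule H.lie_form_family[OF closed])
  interpret D: lie_decomposition ?L ?br "killing_inner G AG AM g act" \<cc> \<gg> k l Z
    by unfold_locales (use center ideals decomposition l Z_center Z_simple Z_nonzero in simp_all)
  have const_iff: "constant_length G AG AM g act U \<longleftrightarrow> (\<exists>r. \<forall>x. killing_inner G AG AM g act U U x = r)" for U
    unfolding constant_length_def constant_on_def by simp
  have constI: "constant_length G AG AM g act U"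
    if "U \<in> ?L" "\<And>Y x. Y \<in> ?L \<Longrightarrow> killing_inner G AG AM g act (?br Y U) U x = 0" for U
    using that closed by (intro H.constant_lengthI[OF compact_G connected_M])
  have pair: "Z 0 + Z i \<in> ?L" if "i \<in> {1..l}" for i
    using subspace_add[OF F.L D.z_in D.z_in] that by simp
  show ?thesis
  proof (intro conjI impI ballI)
    fix i j assume c: "constant_length G AG AM g act (\<Sum>i = 0..l. Z i)"
      and ij: "i \<in> {1..l}" "j \<in> {1..l}" "i \<noteq> j"
    obtain r where r: "\<And>x. killing_inner G AG AM g act (\<Sum>i = 0..l. Z i) (\<Sum>i = 0..l. Z i) x = r"
      using c const_iff by blast
    have orth: "killing_inner G AG AM g act U V x = 0" if "U \<in> \<gg> i" "V \<in> \<gg> j" for U V x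
      by (rule D.constant_orthogonal[OF r ij that])
    show "killing_orthogonal G AG AM g act (\<gg> i) (\<gg> j)" "killing_orthogonal G AG AM g act {Z i} (\<gg> j)"
      "killing_orthogonal G AG AM g act {Z i} {Z j}"
      using orth Z_simple[OF ij(1)] Z_simple[OF ij(2)] unfolding killing_orthogonal_def by blast+
  next
    fix i assume c: "constant_length G AG AM g act (\<Sum>i = 0..l. Z i)" and i: "i \<in> {1..l}"
    obtain r where r: "\<And>x. killing_inner G AG AM g act (\<Sum>i = 0..l. Z i) (\<Sum>i = 0..l. Z i) x = r"
      using c const_iff by blast
    show "constant_length G AG AM g act (Z 0 + Z i)"
      by (rule constI[OF pair[OF i]]) (rule D.constant_pair[OF r i])
  next
    assume *: "(\<forall>i\<in>{1..l}. constant_length G AG AM g act (Z 0 + Z i)) \<and>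
      (\<forall>i\<in>{1..l}. \<forall>j\<in>{1..l}. i \<noteq> j \<longrightarrow> killing_orthogonal G AG AM g act (\<gg> i) (\<gg> j))"
    have const: "\<exists>r. \<forall>x. killing_inner G AG AM g act (Z 0 + Z i) (Z 0 + Z i) x = r" if "i \<in> {1..l}" for i
      using * that const_iff by blast
    have orth: "killing_inner G AG AM g act U V x = 0"
      if "i \<in> {1..l}" "j \<in> {1..l}" "i \<noteq> j" "U \<in> \<gg> i" "V \<in> \<gg> j" for i j U V x
      using * that unfolding killing_orthogonal_def by blast
    show "constant_length G AG AM g act (\<Sum>i = 0..l. Z i)"
      by (rule constI[OF D.zsum_in]) (rule D.constant_sum[OF const orth])
  qed
qed

end
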